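(* Let $n\ge d\ge 2$ be integers and let $\boldsymbol{\mu}$ be a $d$-part partition of $n$. The Zariski closure of $\mathcal{P}_{n,d}^{\boldsymbol{\mu}}$ in $\mathcal{P}_{n,d}$ is $$\overline{\mathcal{P}}_{n,d}^{\boldsymbol{\mu}}=\bigcup_{\boldsymbol{\mu}'\le\boldsymbol{\mu}}\mathcal{P}_{n,d}^{\boldsymbol{\mu}'},$$ where the union is over all $d$-part partitions $\boldsymbol{\mu}'$ of $n$ with $\boldsymbol{\mu}'\le\boldsymbol{\mu}$.
   Context: $\mathsf{k}$ is an arbitrary infinite field, $R=\mathsf{k}[s,t]$ with the standard grading, and $R_n$ is the space of homogeneous polynomials of degree $n$. A $d$-part partition is a tuple of integers $\boldsymbol{\mu}=(\mu_1,\dots,\mu_d)$ with $1\le\mu_1\le\cdots\le\mu_d$; put $|\boldsymbol{\mu}|=\mu_1+\cdots+\mu_d$; it is a partition of $n$ if $|\boldsymbol{\mu}|=n$. For $d$-part partitions, $\boldsymbol{\mu}\le\boldsymbol{\mu}'$ means $\mu_1+\cdots+\mu_i\le\mu_1'+\cdots+\mu_i'$ for all $i=1,\dots,d$. For linearly independent $a_0,\dots,a_d\in R_n$ with $I=\langle a_0,\dots,a_d\rangle\subseteq R$, there is a graded exact sequence $0\to\bigoplus_{i=1}^d R(-n-\mu_i)\to R(-n)^{d+1}\xrightarrow{(a_0,\dots,a_d)} I\to 0$ with uniquely determined integers $1\le\mu_1\le\cdots\le\mu_d$; the tuple $\boldsymbol{\mu}=(\mu_1,\dots,\mu_d)$ is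 called the $\boldsymbol{\mu}$-type (or type) of $(a_0,\dots,a_d)$. One has $|\boldsymbol{\mu}|=n-\deg\gcd(a_0,\dots,a_d)$. $\mathcal{P}_{n,d}\subseteq R_n^{d+1}$ is the set of $(a_0,\dots,a_d)$ that are linearly independent and relatively prime (a nonempty Zariski open subset of $R_n^{d+1}$), and for a $d$-part partition $\boldsymbol{\mu}$ of $n$, $\mathcal{P}_{n,d}^{\boldsymbol{\mu}}\subseteq\mathcal{P}_{n,d}$ is the subset of those of type $\boldsymbol{\mu}$. *)

theory Defs
  imports "HOL-Computational_Algebra.Polynomial" "HOL-Analysis.Abstract_Topology"
begin

text \<open>
  The ring \<open>R = k[s,t]\<close> is \<open>'a poly poly\<close>: the outer variable is \<open>s\<close>, the inner one is \<open>t\<close>, so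
  \<open>coeff (coeff p i) j\<close> is the coefficient of \<open>s^i t^j\<close>. Degrees are integers, so that the
  components of negative degree are zero and twists need no side conditions.
\<close>

definition graded_part :: "int \<Rightarrow> 'a::field poly poly set" where
  "graded_part k = {p. \<forall>i j. coeff (coeff p i) j \<noteq> 0 \<longrightarrow> int i + int j = k}"

text \<open>
  Elements of \<open>R^m\<close> are sequences that vanish from index \<open>m\<close> on. A list \<open>es\<close> of integers
  stands for the graded free module \<open>F\<close> that is the direct sum of the \<open>R(-es!i)\<close>; its component
  of degree \<open>k\<close> is \<open>free_part es k\<close>, since \<open>R(-e)\<close> has degree \<open>k\<close> component \<open>graded_part (k - e)\<close>.
\<close>

definition free_mod :: "nat \<Rightarrow> (nat \<Rightarrow> 'a::field poly poly) set" where
  "free_mod m = {c. \<forall>i\<ge>m. c i = 0}"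

definition free_part :: "int list \<Rightarrow> int \<Rightarrow> (nat \<Rightarrow> 'a::field poly poly) set" where
  "free_part es k = {c \<in> free_mod (length es). \<forall>i<length es. c i \<in> graded_part (k - es ! i)}"

definition graded_hom ::
  "int list \<Rightarrow> int list \<Rightarrow> ((nat \<Rightarrow> 'a::field poly poly) \<Rightarrow> (nat \<Rightarrow> 'a poly poly)) \<Rightarrow> bool" where
  "graded_hom es fs \<phi> \<longleftrightarrow>
     \<phi> ` free_mod (length es) \<subseteq> free_mod (length fs) \<and>
     (\<forall>b\<in>free_mod (length es). \<forall>c\<in>free_mod (length es).
        \<phi> (\<lambda>i. b i + c i) = (\<lambda>j. \<phi> b j + \<phi> c j)) \<and>
     (\<forall>r. \<forall>c\<in>free_mod (length es). \<phi> (\<lambda>i. r * c i) = (\<lambda>j. r * \<phi> c j)) \<and>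
     (\<forall>k. \<phi> ` free_part es k \<subseteq> free_part fs k)"

definition comb :: "nat \<Rightarrow> (nat \<Rightarrow> 'a::field poly poly) \<Rightarrow> (nat \<Rightarrow> 'a poly poly) \<Rightarrow> 'a poly poly" where
  "comb d a b = (\<Sum>j\<le>d. b j * a j)"

text \<open>The span over the ring itself, acting by multiplication, is the generated ideal.\<close>

definition gen_ideal :: "nat \<Rightarrow> (nat \<Rightarrow> 'a::field poly poly) \<Rightarrow> 'a poly poly set" where
  "gen_ideal d a = module.span (*) (a ` {..d})"

lemma module_mult: "module ((*) :: 'a::comm_ring_1 \<Rightarrow> 'a \<Rightarrow> 'a)"
  by standard (auto simp: algebra_simps)

lemma comb_add: "comb d a (\<lambda>i. b i + c i) = comb d a b + comb d a c"
  by (simp only: comb_def distrib_right sum.distrib)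

lemma comb_mult: "comb d a (\<lambda>i. r * b i) = r * comb d a b"
  by (simp only: comb_def mult.assoc sum_distrib_left)

lemma comb_unit:
  assumes "j \<le> d"
  shows "comb d a (\<lambda>i. if i = j then 1 else 0) = a j"
proof -
  have "comb d a (\<lambda>i. if i = j then 1 else 0) = (\<Sum>i\<le>d. if i = j then a i else 0)"
    unfolding comb_def by (intro sum.cong) auto
  then show ?thesis
    using assms by simp
qed

lemma gen_ideal_eq: "gen_ideal d a = comb d a ` free_mod (d + 1)"
proof
  show "gen_ideal d a \<subseteq> comb d a ` free_mod (d + 1)"
    unfolding gen_ideal_def
  proof (rule module.span_minimal[OF module_mult])
    show "a ` {..d} \<subseteq> comb d a ` free_mod (d + 1)"
    proof
      fix x assume "x \<in> a ` {..d}"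
      then obtain j where "j \<le> d" "x = a j" by blast
      then have "x = comb d a (\<lambda>i. if i = j then 1 else 0)"
        "(\<lambda>i. if i = j then 1 else 0) \<in> free_mod (d + 1)"
        by (simp_all add: comb_unit free_mod_def)
      then show "x \<in> comb d a ` free_mod (d + 1)" by (rule image_eqI)
    qed
    show "module.subspace (*) (comb d a ` free_mod (d + 1))"
      unfolding module.subspace_def[OF module_mult]
    proof (intro conjI ballI allI)
      have "comb d a (\<lambda>i. 0) = 0" "(\<lambda>i. 0) \<in> free_mod (d + 1)"
        by (simp_all add: comb_def free_mod_def)
      then show "0 \<in> comb d a ` free_mod (d + 1)" by (intro image_eqI[OF sym])
    next
      fix x y assume "x \<in> comb d a ` free_mod (d + 1)" "y \<in> comb d a ` free_mod (d + 1)"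
      then obtain b c where bc: "b \<in> free_mod (d + 1)" "c \<in> free_mod (d + 1)"
        "x = comb d a b" "y = comb d a c" by blast
      have "(\<lambda>i. b i + c i) \<in> free_mod (d + 1)"
        using bc(1,2) by (simp add: free_mod_def)
      then show "x + y \<in> comb d a ` free_mod (d + 1)"
        unfolding bc(3,4) comb_add[symmetric] by (rule imageI)
    next
      fix r x assume "x \<in> comb d a ` free_mod (d + 1)"
      then obtain b where b: "b \<in> free_mod (d + 1)" "x = comb d a b" by blast
      have "(\<lambda>i. r * b i) \<in> free_mod (d + 1)"
        using b(1) by (simp add: free_mod_def)
      then show "r * x \<in> comb d a ` free_mod (d + 1)"
        unfolding b(2) comb_mult[symmetric] by (rule imageI)
    qed
  qed
  show "comb d a ` free_mod (d + 1) \<subseteq> gen_ideal d a"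
  proof
    fix x assume "x \<in> comb d a ` free_mod (d + 1)"
    then obtain b where b: "x = comb d a b" by blast
    have "b j * a j \<in> gen_ideal d a" if "j \<in> {..d}" for j
      unfolding gen_ideal_def
      using that by (intro module.span_scale[OF module_mult] module.span_base[OF module_mult]) simp
    then show "x \<in> gen_ideal d a"
      unfolding b comb_def gen_ideal_def by (rule module.span_sum[OF module_mult])
  qed
qed

text \<open>Parts are indexed from 0: \<open>\<mu> ! i\<close> is the part \<open>\<mu>_(i+1)\<close>.\<close>

definition partition_d :: "nat \<Rightarrow> nat list \<Rightarrow> bool" where
  "partition_d d \<mu> \<longleftrightarrow> length \<mu> = d \<and> sorted \<mu> \<and> (\<forall>m\<in>set \<mu>. 1 \<le> m)"

definition partition_of :: "nat \<Rightarrow> nat \<Rightarrow> nat list \<Rightarrow> bool" where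
  "partition_of n d \<mu> \<longleftrightarrow> partition_d d \<mu> \<and> sum_list \<mu> = n"

definition partition_le :: "nat \<Rightarrow> nat list \<Rightarrow> nat list \<Rightarrow> bool" where
  "partition_le d \<mu> \<mu>' \<longleftrightarrow> (\<forall>i\<in>{1..d}. sum_list (take i \<mu>) \<le> sum_list (take i \<mu>'))"

text \<open>
  The conjuncts on \<open>\<phi>\<close> say that \<open>\<phi>\<close> is a graded map from the sum of the \<open>R(-n-\<mu>_i)\<close> to
  \<open>R(-n)^(d+1)\<close> and give exactness of \<open>0 \<rightarrow> \<Oplus> R(-n-\<mu>_i) \<rightarrow> R(-n)^(d+1) \<rightarrow> I \<rightarrow> 0\<close>
  at its three places from left to right.
\<close>

definition has_mu_type :: "nat \<Rightarrow> nat \<Rightarrow> (nat \<Rightarrow> 'a::field poly poly) \<Rightarrow> nat list \<Rightarrow> bool" where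
  "has_mu_type n d a \<mu> \<longleftrightarrow>
     partition_d d \<mu> \<and>
     (\<exists>\<phi>. graded_hom (map (\<lambda>m. int n + int m) \<mu>) (replicate (d + 1) (int n)) \<phi> \<and>
          inj_on \<phi> (free_mod d) \<and>
          \<phi> ` free_mod d = {b \<in> free_mod (d + 1). comb d a b = 0} \<and>
          comb d a ` free_mod (d + 1) = gen_ideal d a)"

text \<open>The affine space \<open>R_n^(d+1)\<close>; tuples are again continued by zero.\<close>

definition tuples :: "nat \<Rightarrow> nat \<Rightarrow> (nat \<Rightarrow> 'a::field poly poly) set" where
  "tuples n d = {a \<in> free_mod (d + 1). \<forall>j\<le>d. a j \<in> graded_part (int n)}"

text \<open>The scalar \<open>c\<close> of the ground field is \<open>[:c:]\<close> in \<open>k[t]\<close>.\<close>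

definition lin_indep :: "nat \<Rightarrow> (nat \<Rightarrow> 'a::field poly poly) \<Rightarrow> bool" where
  "lin_indep d a \<longleftrightarrow>
     (\<forall>c. (\<Sum>j\<le>d. smult [:c j:] (a j)) = 0 \<longrightarrow> (\<forall>j\<le>d. c j = 0))"

definition rel_prime :: "nat \<Rightarrow> (nat \<Rightarrow> 'a::field poly poly) \<Rightarrow> bool" where
  "rel_prime d a \<longleftrightarrow> (\<forall>p. (\<forall>j\<le>d. p dvd a j) \<longrightarrow> is_unit p)"

definition P_set :: "nat \<Rightarrow> nat \<Rightarrow> (nat \<Rightarrow> 'a::field poly poly) set" where
  "P_set n d = {a \<in> tuples n d. lin_indep d a \<and> rel_prime d a}"

definition P_mu :: "nat \<Rightarrow> nat \<Rightarrow> nat list \<Rightarrow> (nat \<Rightarrow> 'a::field poly poly) set" where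
  "P_mu n d \<mu> = {a \<in> P_set n d. has_mu_type n d a \<mu>}"

text \<open>
  Polynomial functions on \<open>R_n^(d+1)\<close>. The coordinates are the coefficients of \<open>s^i t^(n-i)\<close> in
  the entries of the tuple.
\<close>

inductive_set poly_funs :: "nat \<Rightarrow> nat \<Rightarrow> ((nat \<Rightarrow> 'a::field poly poly) \<Rightarrow> 'a) set"
  for n d :: nat where
  const: "(\<lambda>a. c) \<in> poly_funs n d"
| coord: "j \<le> d \<Longrightarrow> i \<le> n \<Longrightarrow> (\<lambda>a. coeff (coeff (a j) i) (n - i)) \<in> poly_funs n d"
| add: "f \<in> poly_funs n d \<Longrightarrow> g \<in> poly_funs n d \<Longrightarrow> (\<lambda>a. f a + g a) \<in> poly_funs n d"
| mult: "f \<in> poly_funs n d \<Longrightarrow> g \<in> poly_funs n d \<Longrightarrow> (\<lambda>a. f a * g a) \<in> poly_funs n d"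

definition zero_locus ::
  "nat \<Rightarrow> nat \<Rightarrow> ((nat \<Rightarrow> 'a::field poly poly) \<Rightarrow> 'a) set \<Rightarrow> (nat \<Rightarrow> 'a poly poly) set" where
  "zero_locus n d F = {a \<in> tuples n d. \<forall>f\<in>F. f a = 0}"

definition zariski :: "nat \<Rightarrow> nat \<Rightarrow> (nat \<Rightarrow> 'a::field poly poly) topology" where
  "zariski n d =
     topology (\<lambda>U. \<exists>F\<subseteq>poly_funs n d. U = tuples n d - zero_locus n d F)"

lemma istopology_zariski:
  "istopology (\<lambda>U::(nat \<Rightarrow> 'a::field poly poly) set.
     \<exists>F\<subseteq>poly_funs n d. U = tuples n d - zero_locus n d F)"
  unfolding istopology_def
proof (intro conjI allI impI)
  fix S T :: "(nat \<Rightarrow> 'a poly poly) set"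
  assume "\<exists>F\<subseteq>poly_funs n d. S = tuples n d - zero_locus n d F"
    and "\<exists>F\<subseteq>poly_funs n d. T = tuples n d - zero_locus n d F"
  then obtain F G where F: "F \<subseteq> poly_funs n d" "S = tuples n d - zero_locus n d F"
    and G: "G \<subseteq> poly_funs n d" "T = tuples n d - zero_locus n d G"
    by blast
  define H where "H = {\<lambda>a. f a * g a | f g. f \<in> F \<and> g \<in> G}"
  have H: "H \<subseteq> poly_funs n d"
    using F G unfolding H_def by (auto intro!: poly_funs.mult)
  have "zero_locus n d H = zero_locus n d F \<union> zero_locus n d G"
    unfolding zero_locus_def H_def by fastforce
  then show "\<exists>F\<subseteq>poly_funs n d. S \<inter> T = tuples n d - zero_locus n d F"
    using H F G by blast
next
  fix K :: "(nat \<Rightarrow> 'a poly poly) set set"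
  assume "\<forall>S\<in>K. \<exists>F\<subseteq>poly_funs n d. S = tuples n d - zero_locus n d F"
  then obtain F where F: "\<And>S. S \<in> K \<Longrightarrow> F S \<subseteq> poly_funs n d"
    "\<And>S. S \<in> K \<Longrightarrow> S = tuples n d - zero_locus n d (F S)"
    by metis
  have "x \<in> \<Union>K \<longleftrightarrow> x \<in> tuples n d - zero_locus n d (\<Union>(F ` K))" for x
  proof -
    have "x \<in> \<Union>K \<longleftrightarrow> (\<exists>S\<in>K. x \<in> tuples n d - zero_locus n d (F S))"
      using F(2) by blast
    also have "\<dots> \<longleftrightarrow> x \<in> tuples n d - zero_locus n d (\<Union>(F ` K))"
      unfolding zero_locus_def by blast
    finally show ?thesis .
  qed
  then have "\<Union>K = tuples n d - zero_locus n d (\<Union>(F ` K))"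
    by blast
  then show "\<exists>F\<subseteq>poly_funs n d. \<Union>K = tuples n d - zero_locus n d F"
    using F(1) by (intro exI[of _ "\<Union>(F ` K)"]) blast
qed

lemma openin_zariski:
  "openin (zariski n d) U \<longleftrightarrow> (\<exists>F\<subseteq>poly_funs n d. U = tuples n d - zero_locus n d F)"
  unfolding zariski_def by (simp add: topology_inverse'[OF istopology_zariski])

lemma topspace_zariski:
  "topspace (zariski n d) = (tuples n d :: (nat \<Rightarrow> 'a::field poly poly) set)"
proof -
  have "zero_locus n d {\<lambda>a :: nat \<Rightarrow> 'a poly poly. 1} = {}"
    by (simp add: zero_locus_def)
  then have "openin (zariski n d) (tuples n d :: (nat \<Rightarrow> 'a poly poly) set)"
    unfolding openin_zariski by (intro exI[of _ "{\<lambda>a. 1}"]) (auto intro: poly_funs.const)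
  moreover have "topspace (zariski n d :: (nat \<Rightarrow> 'a poly poly) topology) \<subseteq> tuples n d"
    using openin_topspace[of "zariski n d :: (nat \<Rightarrow> 'a poly poly) topology"]
    unfolding openin_zariski by blast
  ultimately show ?thesis
    by (simp add: openin_subset subset_antisym)
qed

lemma closedin_zariski:
  fixes Z :: "(nat \<Rightarrow> 'a::field poly poly) set"
  shows "closedin (zariski n d) Z \<longleftrightarrow> (\<exists>F\<subseteq>poly_funs n d. Z = zero_locus n d F)"
proof -
  have sub: "zero_locus n d F \<subseteq> tuples n d" for F :: "((nat \<Rightarrow> 'a poly poly) \<Rightarrow> 'a) set"
    by (auto simp: zero_locus_def)
  show ?thesis
  proof
    assume "closedin (zariski n d) Z"
    then obtain F where "F \<subseteq> poly_funs n d" "Z \<subseteq> tuples n d"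
      "tuples n d - Z = tuples n d - zero_locus n d F"
      unfolding closedin_def topspace_zariski openin_zariski by blast
    then show "\<exists>F\<subseteq>poly_funs n d. Z = zero_locus n d F"
      using sub by blast
  next
    assume "\<exists>F\<subseteq>poly_funs n d. Z = zero_locus n d F"
    then show "closedin (zariski n d) Z"
      unfolding closedin_def topspace_zariski openin_zariski using sub by blast
  qed
qed

end

theory Submission
  imports Defs "Jordan_Normal_Form.Determinant" "HOL-Library.Function_Algebras"
begin

text \<open>
  Setting \<open>s = 1\<close> turns a tuple in \<open>R_n^(d+1)\<close> into a vector \<open>A\<close> over \<open>k[t]\<close> whose entries have
  degree at most \<open>n\<close>. By a Hilbert--Burch argument, a coprime tuple has type \<open>\<mu>\<close>, a partition of \<open>n\<close>,
  as soon as it has \<open>d\<close> linearly independent syzygies of degrees \<open>\<mu>_1, ..., \<mu>_d\<close>.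

  For one inclusion, the dimension of the space of syzygies of degree \<open>m\<close> is the sum of the
  \<open>max 0 (m + 1 - \<mu>_i)\<close>. It is upper semicontinuous, and a comparison of these dimensions for all \<open>m\<close>
  is the dominance order. For the other one, partitions that are comparable in the dominance order
  are connected by moves that replace parts \<open>e < f - 1\<close> by \<open>e + 1\<close>, \<open>f - 1\<close>, and each move is realised
  by a linear perturbation of the tuple.
\<close>

section \<open>Determinants of families of rows\<close>

text \<open>Setting \<open>s = 1\<close> forgets the factor \<open>s\<close>, so
  \<open>unimodular\<close> asks for two things: a Bezout identity, and a nonzero coefficient of
  \<open>t^n\<close>, which says that \<open>s\<close> does not divide every entry. The total degree
  \<open>n\<close> is the rigid case. The maximal minors of \<open>d\<close> independent syzygies
  are, up to sign, \<open>g\<close> times the entries of \<open>A\<close>, hence the row degrees add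
  up to at least \<open>deg g + n\<close>. If they add up to exactly \<open>n\<close>, then
  \<open>g\<close> is a nonzero constant, and Cramer's rule yields generation of all syzygies
  together with degree bounds. If they add up to more, then either \<open>g\<close> is not constant
  or the leading coefficients are dependent, and the total degree can be lowered. This gives the
  existence of a type without any general theory of resolutions. The field is only infinite, so
  closures are treated through the vanishing of polynomial functions. A type that is not dominated
  is separated by one determinant. A dominated one is reached along a line, where a one-variable
  polynomial with zeros at all nonzero scalars must vanish at \<open>0\<close> too. Points of the
  line may leave \<open>P_set n d\<close>; a second function, nonzero at the given tuple, is
  multiplied in to discard them.\<close>

definition rdet :: "nat \<Rightarrow> (nat \<Rightarrow> nat \<Rightarrow> 'a::comm_ring_1) \<Rightarrow> 'a" where
  "rdet N c = det (mat N N (\<lambda>(i, j). c i j))"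

lemma rdet_leibniz:
  "rdet N c = (\<Sum>p | p permutes {0..<N}. signof p * (\<Prod>i = 0..<N. c i (p i)))"
  unfolding rdet_def
  by (subst det_def'[of _ N]) (auto intro!: sum.cong prod.cong dest!: permutes_in_image)

lemma rdet_cong:
  assumes "\<And>i j. i < N \<Longrightarrow> j < N \<Longrightarrow> c i j = c' i j"
  shows "rdet N c = rdet N c'"
  unfolding rdet_def using assms by (intro arg_cong[where f = det] eq_matI) auto

lemma rdet_linear:
  assumes "k < N"
  shows "rdet N (c(k := (\<lambda>j. u * f j + v * g j))) = u * rdet N (c(k := f)) + v * rdet N (c(k := g))"
proof -
  have split: "(\<Prod>i = 0..<N. (c(k := h)) i (p i)) = h (p k) * (\<Prod>i\<in>{0..<N} - {k}. c i (p i))" for h p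
    using assms by (subst prod.remove[of _ k]) (auto intro!: prod.cong)
  show ?thesis
    unfolding rdet_leibniz split sum_distrib_left sum.distrib[symmetric]
    by (intro sum.cong refl) (simp add: algebra_simps)
qed

lemma rdet_zero_row:
  assumes "k < N"
  shows "rdet N (c(k := (\<lambda>j. 0))) = 0"
  using rdet_linear[OF assms, of c 0 "\<lambda>j. 0" 0 "\<lambda>j. 0"] by (simp del: fun_upd_apply)

lemma rdet_sum:
  assumes "k < N" "finite S"
  shows "rdet N (c(k := (\<lambda>j. \<Sum>s\<in>S. u s * f s j))) = (\<Sum>s\<in>S. u s * rdet N (c(k := f s)))"
  using assms(2)
proof (induction S rule: finite_induct)
  case empty
  then show ?case using rdet_zero_row[OF assms(1)] by (simp del: fun_upd_apply)
next
  case (insert x F)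
  then show ?case
    using rdet_linear[OF assms(1), of c "u x" "f x" 1 "\<lambda>j. \<Sum>s\<in>F. u s * f s j"] by (simp del: fun_upd_apply)
qed

lemma rdet_same:
  assumes "i \<noteq> j" "i < N" "j < N" "\<And>r. r < N \<Longrightarrow> c i r = c j r"
  shows "rdet N c = 0"
  unfolding rdet_def using assms
  by (intro det_identical_rows[of _ N i j]) (auto simp: row_def)

lemma rdet_zero_iff_right:
  fixes c :: "nat \<Rightarrow> nat \<Rightarrow> 'a::idom"
  shows "rdet N c = 0 \<longleftrightarrow> (\<exists>w. (\<exists>j<N. w j \<noteq> 0) \<and> (\<forall>i<N. (\<Sum>j<N. c i j * w j) = 0))"
proof -
  let ?M = "mat N N (\<lambda>(i, j). c i j)"
  have "rdet N c = 0 \<longleftrightarrow> (\<exists>v. v \<in> carrier_vec N \<and> v \<noteq> 0\<^sub>v N \<and> ?M *\<^sub>v v = 0\<^sub>v N)"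
    unfolding rdet_def by (rule det_0_iff_vec_prod_zero) simp
  also have "\<dots> \<longleftrightarrow> (\<exists>w. (\<exists>j<N. w j \<noteq> 0) \<and> (\<forall>i<N. (\<Sum>j<N. c i j * w j) = 0))"
  proof
    assume "\<exists>v. v \<in> carrier_vec N \<and> v \<noteq> 0\<^sub>v N \<and> ?M *\<^sub>v v = 0\<^sub>v N"
    then obtain v where v: "v \<in> carrier_vec N" "v \<noteq> 0\<^sub>v N" "?M *\<^sub>v v = 0\<^sub>v N" by blast
    have "\<exists>j<N. v $ j \<noteq> 0" 
    proof (rule ccontr)
      assume "\<not> (\<exists>j<N. v $ j \<noteq> 0)"
      then have "v = 0\<^sub>v N" using v(1) by (intro eq_vecI) auto
      then show False using v(2) by contradiction
    qed
    moreover have "(\<Sum>j<N. c i j * v $ j) = 0" if "i < N" for i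
    proof -
      have "(\<Sum>j<N. c i j * v $ j) = (?M *\<^sub>v v) $ i"
        using that v(1) by (auto simp: scalar_prod_def atLeast0LessThan intro!: sum.cong)
      then show ?thesis using v(3) that by simp
    qed
    ultimately show "\<exists>w. (\<exists>j<N. w j \<noteq> 0) \<and> (\<forall>i<N. (\<Sum>j<N. c i j * w j) = 0)"
      by (intro exI[of _ "\<lambda>j. v $ j"]) auto
  next
    assume "\<exists>w. (\<exists>j<N. w j \<noteq> 0) \<and> (\<forall>i<N. (\<Sum>j<N. c i j * w j) = 0)"
    then obtain w j where w: "j < N" "w j \<noteq> 0" "\<And>i. i < N \<Longrightarrow> (\<Sum>j<N. c i j * w j) = 0" by blast
    have "vec N w \<noteq> 0\<^sub>v N" using w(1,2) by (metis index_vec index_zero_vec(1))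
    moreover have "?M *\<^sub>v vec N w = 0\<^sub>v N"
    proof (rule eq_vecI)
      fix i assume "i < dim_vec (0\<^sub>v N :: 'a vec)"
      moreover have "(?M *\<^sub>v vec N w) $ i = (\<Sum>j<N. c i j * w j)" if "i < N"
        using that by (auto simp: scalar_prod_def atLeast0LessThan intro!: sum.cong)
      ultimately show "(?M *\<^sub>v vec N w) $ i = 0\<^sub>v N $ i" using w(3) by simp
    qed simp
    ultimately show "\<exists>v. v \<in> carrier_vec N \<and> v \<noteq> 0\<^sub>v N \<and> ?M *\<^sub>v v = 0\<^sub>v N"
      by (intro exI[of _ "vec N w"]) auto
  qed
  finally show ?thesis .
qed

lemma rdet_transpose: "rdet N (\<lambda>i j. c j i) = rdet N c"
proof -
  have "mat N N (\<lambda>(i, j). c j i) = transpose_mat (mat N N (\<lambda>(i, j). c i j))"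
    by (rule eq_matI) auto
  then have "rdet N (\<lambda>i j. c j i) = det (transpose_mat (mat N N (\<lambda>(i, j). c i j)))"
    by (simp only: rdet_def)
  also have "\<dots> = rdet N c"
    unfolding rdet_def by (rule det_transpose) (rule mat_carrier)
  finally show ?thesis .
qed

lemma rdet_zero_iff_left:
  fixes c :: "nat \<Rightarrow> nat \<Rightarrow> 'a::idom"
  shows "rdet N c = 0 \<longleftrightarrow> (\<exists>v. (\<exists>i<N. v i \<noteq> 0) \<and> (\<forall>j<N. (\<Sum>i<N. v i * c i j) = 0))"
proof -
  have *: "(\<Sum>i<N. c i j * v i) = (\<Sum>i<N. v i * c i j)" for v j
    by (rule sum.cong) (simp_all add: mult.commute)
  show ?thesis
    using rdet_zero_iff_right[of N "\<lambda>i j. c j i"] unfolding rdet_transpose[of N c] * .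
qed

text \<open>The coefficients come from multiplying \<open>x\<close> by the adjugate. Nothing is
  divided, so the identity can be used over \<open>k[t]\<close>, where the determinant is usually
  not invertible.\<close>

lemma rdet_cramer:
  "\<exists>v. \<forall>r<N. (\<Sum>i<N. v i * c i r) = rdet N c * x r"
proof -
  let ?M = "mat N N (\<lambda>(i, j). c i j)"
  let ?B = "adj_mat ?M"
  have M: "?M \<in> carrier_mat N N" by simp
  have B: "?B \<in> carrier_mat N N" "?B * ?M = det ?M \<cdot>\<^sub>m 1\<^sub>m N"
    using adj_mat[OF M] by auto
  have BM: "(\<Sum>i<N. ?B $$ (j, i) * c i r) = (if j = r then rdet N c else 0)" if "j < N" "r < N" for j r
  proof -
    have "(\<Sum>i<N. ?B $$ (j, i) * c i r) = (?B * ?M) $$ (j, r)"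
      using that B(1) by (auto simp: scalar_prod_def atLeast0LessThan intro!: sum.cong)
    then show ?thesis using B(2) that by (simp add: rdet_def)
  qed
  define v where "v i = (\<Sum>j<N. x j * ?B $$ (j, i))" for i
  have "(\<Sum>i<N. v i * c i r) = rdet N c * x r" if "r < N" for r
  proof -
    have "(\<Sum>i<N. v i * c i r) = (\<Sum>i<N. \<Sum>j<N. x j * (?B $$ (j, i) * c i r))"
      by (simp add: v_def sum_distrib_right mult.assoc)
    also have "\<dots> = (\<Sum>j<N. x j * (\<Sum>i<N. ?B $$ (j, i) * c i r))"
      by (subst sum.swap) (simp add: sum_distrib_left)
    also have "\<dots> = (\<Sum>j<N. if j = r then x r * rdet N c else 0)"
      using that by (intro sum.cong) (auto simp: BM)
    finally show ?thesis using that by (simp add: mult.commute)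
  qed
  then show ?thesis by blast
qed

text \<open>The hypothesis provides a left inverse matrix, and determinants are
  multiplicative.\<close>

lemma rdet_dvd_one:
  assumes "\<And>j. j < N \<Longrightarrow> \<exists>v. \<forall>r<N. (\<Sum>i<N. v i * c i r) = (if r = j then 1 else 0)"
  shows "rdet N c dvd 1"
proof -
  obtain V where V: "\<And>j r. j < N \<Longrightarrow> r < N \<Longrightarrow> (\<Sum>i<N. V j i * c i r) = (if r = j then 1 else 0)"
    using assms by metis
  let ?M = "mat N N (\<lambda>(i, j). c i j)" and ?V = "mat N N (\<lambda>(i, j). V i j)"
  have "?V * ?M = 1\<^sub>m N"
  proof (rule eq_matI)
    fix j r assume "j < dim_row (1\<^sub>m N :: 'a mat)" "r < dim_col (1\<^sub>m N :: 'a mat)"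
    then have "j < N" "r < N" by auto
    moreover from this have "(?V * ?M) $$ (j, r) = (\<Sum>i<N. V j i * c i r)"
      by (auto simp: scalar_prod_def atLeast0LessThan intro!: sum.cong)
    ultimately show "(?V * ?M) $$ (j, r) = 1\<^sub>m N $$ (j, r)" using V[of j r] by auto
  qed auto
  then have "det ?V * rdet N c = 1"
    unfolding rdet_def using det_mult[of ?V N ?M] by simp
  then show ?thesis by (metis dvd_triv_right)
qed

section \<open>Formal degrees and leading coefficients of determinants\<close>

lemma coeff_mult_top:
  fixes p q :: "'a::comm_semiring_1 poly"
  assumes "degree p \<le> m" "degree q \<le> n"
  shows "coeff (p * q) (m + n) = coeff p m * coeff q n"
proof -
  have "coeff p i * coeff q (m + n - i) = 0" if "i \<le> m + n" "i \<noteq> m" for i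
  proof (cases "i < m")
    case True
    then have "degree q < m + n - i" using assms by linarith
    then show ?thesis by (simp add: coeff_eq_0)
  next
    case False
    then have "degree p < i" using assms that by linarith
    then show ?thesis by (simp add: coeff_eq_0)
  qed
  then have "(\<Sum>i\<le>m + n. coeff p i * coeff q (m + n - i)) = (\<Sum>i\<in>{m}. coeff p i * coeff q (m + n - i))"
    by (intro sum.mono_neutral_right) auto
  then show ?thesis unfolding coeff_mult by simp
qed

lemma coeff_prod_sum:
  fixes f :: "'b \<Rightarrow> 'a::comm_semiring_1 poly"
  assumes "\<And>i. i \<in> S \<Longrightarrow> degree (f i) \<le> \<mu> i"
  shows "degree (prod f S) \<le> sum \<mu> S \<and> coeff (prod f S) (sum \<mu> S) = (\<Prod>i\<in>S. coeff (f i) (\<mu> i))"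
  using assms
proof (induction S rule: infinite_finite_induct)
  case (insert x F)
  have IH: "degree (prod f F) \<le> sum \<mu> F" "coeff (prod f F) (sum \<mu> F) = (\<Prod>i\<in>F. coeff (f i) (\<mu> i))"
    using insert by auto
  have d: "degree (f x) \<le> \<mu> x" using insert by auto
  have "coeff (f x * prod f F) (\<mu> x + sum \<mu> F) = coeff (f x) (\<mu> x) * coeff (prod f F) (sum \<mu> F)"
    by (rule coeff_mult_top[OF d IH(1)])
  moreover have "degree (f x * prod f F) \<le> \<mu> x + sum \<mu> F"
    using degree_mult_le[of "f x" "prod f F"] d IH(1) by linarith
  ultimately show ?case using insert IH by simp
qed auto

text \<open>The \<open>\<mu> i\<close> are formal row degrees that need not be attained. Every term
  of the Leibniz formula has formal degree the sum of the \<open>\<mu> i\<close>, so the coefficient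
  there is the determinant of the leading coefficients; its vanishing is what detects a drop in
  degree.\<close>

lemma rdet_degree:
  fixes c :: "nat \<Rightarrow> nat \<Rightarrow> 'a::comm_ring_1 poly"
  assumes "\<And>i j. i < N \<Longrightarrow> j < N \<Longrightarrow> degree (c i j) \<le> \<mu> i"
  shows "degree (rdet N c) \<le> (\<Sum>i<N. \<mu> i)"
    and "coeff (rdet N c) (\<Sum>i<N. \<mu> i) = rdet N (\<lambda>i j. coeff (c i j) (\<mu> i))"
proof -
  have *: "degree (\<Prod>i = 0..<N. c i (p i)) \<le> (\<Sum>i<N. \<mu> i) \<and>
      coeff (\<Prod>i = 0..<N. c i (p i)) (\<Sum>i<N. \<mu> i) = (\<Prod>i = 0..<N. coeff (c i (p i)) (\<mu> i))"
    if "p permutes {0..<N}" for p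
    using coeff_prod_sum[of "{0..<N}" "\<lambda>i. c i (p i)" \<mu>] assms permutes_in_image[OF that]
    by (auto simp: atLeast0LessThan)
  have s: "signof p = of_int (sign p)" for p :: "nat \<Rightarrow> nat" by (simp add: sign_def)
  have sg: "(signof p :: 'a poly) = [:signof p:]" for p :: "nat \<Rightarrow> nat"
    by (simp add: sign_def one_pCons)
  show "degree (rdet N c) \<le> (\<Sum>i<N. \<mu> i)"
    unfolding rdet_leibniz sg using *
    by (intro degree_sum_le) (auto intro: finite_permutations order.trans[OF degree_smult_le])
  show "coeff (rdet N c) (\<Sum>i<N. \<mu> i) = rdet N (\<lambda>i j. coeff (c i j) (\<mu> i))"
    unfolding rdet_leibniz sg coeff_sum using * by (intro sum.cong) auto
qed

section \<open>The Hilbert--Burch theorem in one variable\<close>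

definition dot :: "nat \<Rightarrow> (nat \<Rightarrow> 'a::comm_ring_1) \<Rightarrow> (nat \<Rightarrow> 'a) \<Rightarrow> 'a" where
  "dot d b A = (\<Sum>j\<le>d. b j * A j)"

definition unit_vec_fun :: "nat \<Rightarrow> nat \<Rightarrow> 'a::comm_ring_1" where
  "unit_vec_fun k = (\<lambda>j. if j = k then 1 else 0)"

lemma dot_unit: "k \<le> d \<Longrightarrow> dot d (unit_vec_fun k) A = A k"
  by (simp add: dot_def unit_vec_fun_def if_distrib[of "\<lambda>x. x * _"] cong: if_cong)

lemma dot_linear: "dot d (\<lambda>j. u * f j + v * g j) A = u * dot d f A + v * dot d g A"
  by (simp add: dot_def sum.distrib sum_distrib_left algebra_simps)

lemma dot_sum: "dot d (\<lambda>j. \<Sum>i\<in>S. r i * p i j) A = (\<Sum>i\<in>S. r i * dot d (p i) A)"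
  unfolding dot_def sum_distrib_left sum_distrib_right
  by (subst sum.swap) (simp add: mult.assoc)

lemma dot_cong: "(\<And>j. j \<le> d \<Longrightarrow> f j = g j) \<Longrightarrow> dot d f A = dot d g A"
  by (simp add: dot_def)

text \<open>Coprimality of a tuple of forms, read off at \<open>s = 1\<close>. The coefficient of
  \<open>t^n\<close> in \<open>A j\<close> is the value of the form at \<open>s = 0\<close>,
  \<open>t = 1\<close>; if all of these vanished, \<open>s\<close> would be a common factor.\<close>

definition unimodular :: "nat \<Rightarrow> nat \<Rightarrow> (nat \<Rightarrow> 'a::field poly) \<Rightarrow> bool" where
  "unimodular n d A \<longleftrightarrow> (\<forall>j\<le>d. degree (A j) \<le> n) \<and> (\<exists>u. dot d u A = 1) \<and>
     (\<exists>j\<le>d. coeff (A j) n \<noteq> 0)"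

definition lin_indep_rows :: "nat \<Rightarrow> (nat \<Rightarrow> nat \<Rightarrow> 'a::idom) \<Rightarrow> bool" where
  "lin_indep_rows d p \<longleftrightarrow>
     (\<forall>r. (\<forall>j\<le>d. (\<Sum>i<d. r i * p i j) = 0) \<longrightarrow> (\<forall>i<d. r i = 0))"

text \<open>The \<open>\<mu> i\<close> are only upper bounds for the degrees of the rows. Equality
  with the type is not imposed row by row; it follows once the bounds add up to
  \<open>n\<close>.\<close>

definition syz_family ::
  "nat \<Rightarrow> (nat \<Rightarrow> 'a::field poly) \<Rightarrow> (nat \<Rightarrow> nat) \<Rightarrow> (nat \<Rightarrow> nat \<Rightarrow> 'a poly) \<Rightarrow> bool" where
  "syz_family d A \<mu> p \<longleftrightarrow> (\<forall>i<d. \<forall>j\<le>d. degree (p i j) \<le> \<mu> i) \<and>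
     (\<forall>i<d. dot d (p i) A = 0) \<and> lin_indep_rows d p"

text \<open>For \<open>y = unit_vec_fun k\<close> this is, up to sign, the maximal minor of the rows
  \<open>p\<close> without column \<open>k\<close>. A general first row \<open>y\<close> packs all
  these minors into one linear form, which avoids signs and deleted columns.\<close>

definition bordered_det :: "nat \<Rightarrow> (nat \<Rightarrow> 'a::comm_ring_1) \<Rightarrow> (nat \<Rightarrow> nat \<Rightarrow> 'a) \<Rightarrow> 'a" where
  "bordered_det d y p = rdet (Suc d) (\<lambda>i. case i of 0 \<Rightarrow> y | Suc k \<Rightarrow> p k)"

lemma bordered_upd0: "(\<lambda>i. case i of 0 \<Rightarrow> y | Suc k \<Rightarrow> p k) = (\<lambda>i. case i of 0 \<Rightarrow> z | Suc k \<Rightarrow> p k)(0 := y)"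
  by (auto split: nat.split)

lemma bordered_updS:
  "(\<lambda>i. case i of 0 \<Rightarrow> y | Suc k \<Rightarrow> (p(l := x)) k) = (\<lambda>i. case i of 0 \<Rightarrow> y | Suc k \<Rightarrow> p k)(Suc l := x)"
  by (auto split: nat.split)

lemma bordered_det_linear0:
  "bordered_det d (\<lambda>j. u * f j + v * g j) p = u * bordered_det d f p + v * bordered_det d g p"
proof -
  have "bordered_det d h p = rdet (Suc d) ((\<lambda>i. case i of 0 \<Rightarrow> f | Suc k \<Rightarrow> p k)(0 := h))" for h
    unfolding bordered_det_def by (subst bordered_upd0[of h p f]) (rule refl)
  then show ?thesis by (simp only: rdet_linear[OF zero_less_Suc])
qed

lemma bordered_det_sum0:
  assumes "finite S"
  shows "bordered_det d (\<lambda>j. \<Sum>s\<in>S. u s * f s j) p = (\<Sum>s\<in>S. u s * bordered_det d (f s) p)"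
proof -
  have "bordered_det d h p = rdet (Suc d) ((\<lambda>i. case i of 0 \<Rightarrow> \<lambda>j. 0 | Suc k \<Rightarrow> p k)(0 := h))" for h
    unfolding bordered_det_def by (subst bordered_upd0[of h p "\<lambda>j. 0"]) (rule refl)
  then show ?thesis by (simp only: rdet_sum[OF zero_less_Suc assms])
qed

lemma bordered_det_linear:
  assumes "l < d"
  shows "bordered_det d y (p(l := (\<lambda>j. u * f j + v * g j))) =
    u * bordered_det d y (p(l := f)) + v * bordered_det d y (p(l := g))"
  unfolding bordered_det_def bordered_updS using assms by (intro rdet_linear) simp

lemma bordered_det_sum:
  assumes "l < d" "finite S"
  shows "bordered_det d y (p(l := (\<lambda>j. \<Sum>s\<in>S. u s * f s j))) =
    (\<Sum>s\<in>S. u s * bordered_det d y (p(l := f s)))"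
  unfolding bordered_det_def bordered_updS using assms by (intro rdet_sum) simp_all

lemma bordered_det_cong:
  assumes "\<And>j. j \<le> d \<Longrightarrow> y j = y' j" "\<And>i j. i < d \<Longrightarrow> j \<le> d \<Longrightarrow> p i j = p' i j"
  shows "bordered_det d y p = bordered_det d y' p'"
  unfolding bordered_det_def using assms by (intro rdet_cong) (auto split: nat.split)

lemma bordered_det_same0: "l < d \<Longrightarrow> bordered_det d (p l) p = 0"
  unfolding bordered_det_def by (intro rdet_same[of 0 "Suc l"]) auto

lemma bordered_det_same: "k \<noteq> l \<Longrightarrow> k < d \<Longrightarrow> l < d \<Longrightarrow> (\<And>j. j \<le> d \<Longrightarrow> p k j = p l j) \<Longrightarrow> bordered_det d y p = 0"
  unfolding bordered_det_def by (intro rdet_same[of "Suc k" "Suc l"]) auto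

lemma bordered_det_degree:
  fixes p :: "nat \<Rightarrow> nat \<Rightarrow> 'a::comm_ring_1 poly"
  assumes "\<And>i j. i < d \<Longrightarrow> j \<le> d \<Longrightarrow> degree (p i j) \<le> \<mu> i" "\<And>j. j \<le> d \<Longrightarrow> degree (y j) \<le> m"
  shows "degree (bordered_det d y p) \<le> m + (\<Sum>i<d. \<mu> i)"
    and "coeff (bordered_det d y p) (m + (\<Sum>i<d. \<mu> i)) =
      bordered_det d (\<lambda>j. coeff (y j) m) (\<lambda>i j. coeff (p i j) (\<mu> i))"
proof -
  define c where "c = (\<lambda>i. case i of 0 \<Rightarrow> y | Suc k \<Rightarrow> p k)"
  define \<nu> where "\<nu> = (\<lambda>i. case i of 0 \<Rightarrow> m | Suc k \<Rightarrow> \<mu> k)"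
  have *: "degree (c i j) \<le> \<nu> i" if "i < Suc d" "j < Suc d" for i j
    using assms that by (auto simp: c_def \<nu>_def split: nat.split)
  have s: "(\<Sum>i<Suc d. \<nu> i) = m + (\<Sum>i<d. \<mu> i)"
    by (subst sum.lessThan_Suc_shift) (simp add: \<nu>_def)
  have cc: "(\<lambda>i. case i of 0 \<Rightarrow> \<lambda>j. coeff (y j) m | Suc k \<Rightarrow> \<lambda>j. coeff (p k j) (\<mu> k)) =
     (\<lambda>i j. coeff (c i j) (\<nu> i))"
    by (auto simp: c_def \<nu>_def fun_eq_iff split: nat.split)
  show "degree (bordered_det d y p) \<le> m + (\<Sum>i<d. \<mu> i)"
    using rdet_degree(1)[of "Suc d" c \<nu>, OF *] s by (simp only: bordered_det_def c_def)
  show "coeff (bordered_det d y p) (m + (\<Sum>i<d. \<mu> i)) =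
      bordered_det d (\<lambda>j. coeff (y j) m) (\<lambda>i j. coeff (p i j) (\<mu> i))"
    using rdet_degree(2)[of "Suc d" c \<nu>, OF *] s by (simp only: bordered_det_def cc c_def[symmetric])
qed

lemma bordered_det_zero_iff:
  fixes p :: "nat \<Rightarrow> nat \<Rightarrow> 'a::idom"
  shows "bordered_det d y p = 0 \<longleftrightarrow> (\<exists>r0 r. (r0 \<noteq> 0 \<or> (\<exists>i<d. r i \<noteq> 0)) \<and>
     (\<forall>j\<le>d. r0 * y j + (\<Sum>i<d. r i * p i j) = 0))"
proof
  assume "bordered_det d y p = 0"
  then obtain v where v: "\<exists>i<Suc d. v i \<noteq> 0"
    "\<And>j. j < Suc d \<Longrightarrow> (\<Sum>i<Suc d. v i * (case i of 0 \<Rightarrow> y | Suc k \<Rightarrow> p k) j) = 0"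
    unfolding bordered_det_def rdet_zero_iff_left by blast
  have "\<forall>j\<le>d. v 0 * y j + (\<Sum>i<d. v (Suc i) * p i j) = 0"
    using v(2) by (subst (asm) sum.lessThan_Suc_shift) simp
  moreover have "v 0 \<noteq> 0 \<or> (\<exists>i<d. v (Suc i) \<noteq> 0)"
    using v(1) by (metis less_Suc_eq_0_disj)
  ultimately show "\<exists>r0 r. (r0 \<noteq> 0 \<or> (\<exists>i<d. r i \<noteq> 0)) \<and> (\<forall>j\<le>d. r0 * y j + (\<Sum>i<d. r i * p i j) = 0)"
    by (intro exI[of _ "v 0"] exI[of _ "\<lambda>i. v (Suc i)"]) simp
next
  assume "\<exists>r0 r. (r0 \<noteq> 0 \<or> (\<exists>i<d. r i \<noteq> 0)) \<and> (\<forall>j\<le>d. r0 * y j + (\<Sum>i<d. r i * p i j) = 0)"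
  then obtain r0 r where r: "r0 \<noteq> 0 \<or> (\<exists>i<d. r i \<noteq> 0)"
    "\<And>j. j \<le> d \<Longrightarrow> r0 * y j + (\<Sum>i<d. r i * p i j) = 0" by blast
  define v where "v = (\<lambda>i. case i of 0 \<Rightarrow> r0 | Suc k \<Rightarrow> r k)"
  have "\<exists>i<Suc d. v i \<noteq> 0" using r(1) by (auto simp: v_def intro: exI[of _ 0] exI[of _ "Suc _"])
  moreover have "(\<Sum>i<Suc d. v i * (case i of 0 \<Rightarrow> y | Suc k \<Rightarrow> p k) j) = 0" if "j < Suc d" for j
    using r(2)[of j] that by (subst sum.lessThan_Suc_shift) (simp add: v_def)
  ultimately show "bordered_det d y p = 0"
    unfolding bordered_det_def rdet_zero_iff_left by blast
qed

lemma bordered_det_cramer: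
  "\<exists>r0 r. \<forall>j\<le>d. r0 * y j + (\<Sum>i<d. r i * p i j) = bordered_det d y p * x j"
proof -
  obtain v where v: "\<And>j. j < Suc d \<Longrightarrow>
    (\<Sum>i<Suc d. v i * (case i of 0 \<Rightarrow> y | Suc k \<Rightarrow> p k) j) = bordered_det d y p * x j"
    using rdet_cramer[of "Suc d" "\<lambda>i. case i of 0 \<Rightarrow> y | Suc k \<Rightarrow> p k" x]
    unfolding bordered_det_def by blast
  have "\<forall>j\<le>d. v 0 * y j + (\<Sum>i<d. v (Suc i) * p i j) = bordered_det d y p * x j"
    using v by (subst (asm) sum.lessThan_Suc_shift) simp
  then show ?thesis by (intro exI[of _ "v 0"] exI[of _ "\<lambda>i. v (Suc i)"])
qed

lemma bordered_det_dvd_one: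
  assumes "\<And>k. k \<le> d \<Longrightarrow> \<exists>r0 r. \<forall>j\<le>d. r0 * y j + (\<Sum>i<d. r i * p i j) = unit_vec_fun k j"
  shows "bordered_det d y p dvd 1"
  unfolding bordered_det_def
proof (rule rdet_dvd_one)
  fix k assume "k < Suc d"
  then obtain r0 r where r: "\<And>j. j \<le> d \<Longrightarrow> r0 * y j + (\<Sum>i<d. r i * p i j) = unit_vec_fun k j"
    using assms[of k] by (auto simp: less_Suc_eq_le)
  define v where "v = (\<lambda>i. case i of 0 \<Rightarrow> r0 | Suc k \<Rightarrow> r k)"
  have "(\<Sum>i<Suc d. v i * (case i of 0 \<Rightarrow> y | Suc k \<Rightarrow> p k) j) = (if j = k then 1 else 0)"
    if "j < Suc d" for j
    using r[of j] that by (subst sum.lessThan_Suc_shift) (simp add: v_def unit_vec_fun_def)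
  then show "\<exists>v. \<forall>r<Suc d. (\<Sum>i<Suc d. v i * (case i of 0 \<Rightarrow> y | Suc k \<Rightarrow> p k) r) = (if r = k then 1 else 0)"
    by blast
qed

text \<open>The vector \<open>y - (y . A) u\<close> is orthogonal to \<open>A\<close>, and so are
  all the rows \<open>p i\<close>. With this vector as first row the matrix kills the nonzero vector
  \<open>A\<close>, hence is singular; linearity in the first row does the rest.\<close>

lemma bordered_det_syz:
  fixes p :: "nat \<Rightarrow> nat \<Rightarrow> 'a::idom"
  assumes "dot d u A = 1" "\<And>i. i < d \<Longrightarrow> dot d (p i) A = 0"
  shows "bordered_det d y p = bordered_det d u p * dot d y A"
proof -
  let ?z = "\<lambda>j. 1 * y j + (- dot d y A) * u j"
  have z: "dot d ?z A = 0" by (subst dot_linear) (simp add: assms(1))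
  have "\<exists>j\<le>d. A j \<noteq> 0"
  proof (rule ccontr)
    assume "\<not> (\<exists>j\<le>d. A j \<noteq> 0)"
    then have "dot d u A = 0" by (simp add: dot_def)
    then show False using assms(1) by simp
  qed
  then have "bordered_det d ?z p = 0"
    unfolding bordered_det_def rdet_zero_iff_right using z assms(2)
    by (intro exI[of _ A]) (auto simp: dot_def less_Suc_eq_le lessThan_Suc_atMost split: nat.split)
  then show ?thesis unfolding bordered_det_linear0 by (simp add: mult.commute)
qed

lemma lin_indep_rowsD: "lin_indep_rows d p \<Longrightarrow> (\<And>j. j \<le> d \<Longrightarrow> (\<Sum>i<d. r i * p i j) = 0) \<Longrightarrow> i < d \<Longrightarrow> r i = 0"
  unfolding lin_indep_rows_def by blast

lemma lin_indep_rows_if_det: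
  assumes "bordered_det d y p \<noteq> 0"
  shows "lin_indep_rows d p"
  unfolding lin_indep_rows_def
proof (intro allI impI)
  fix r i assume r: "\<forall>j\<le>d. (\<Sum>i<d. r i * p i j) = 0" and "i < d"
  show "r i = 0"
  proof (rule ccontr)
    assume "r i \<noteq> 0"
    then have "bordered_det d y p = 0"
      unfolding bordered_det_zero_iff using r \<open>i < d\<close> by (intro exI[of _ 0] exI[of _ r]) auto
    then show False using assms by contradiction
  qed
qed

text \<open>Pairing a dependency with \<open>A\<close> removes the syzygies and leaves
  \<open>r0 * dot d u A\<close>, so \<open>r0 = 0\<close> and only a dependency among the rows
  \<open>p i\<close> remains.\<close>

lemma bordered_det_nonzero:
  assumes "lin_indep_rows d p" "\<And>i. i < d \<Longrightarrow> dot d (p i) A = 0" "dot d u A \<noteq> 0"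
  shows "bordered_det d u p \<noteq> 0"
proof
  assume "bordered_det d u p = 0"
  then obtain r0 r where r: "r0 \<noteq> 0 \<or> (\<exists>i<d. r i \<noteq> 0)"
    "\<And>j. j \<le> d \<Longrightarrow> r0 * u j + (\<Sum>i<d. r i * p i j) = 0"
    unfolding bordered_det_zero_iff by blast
  have "dot d (\<lambda>j. r0 * u j + 1 * (\<Sum>i<d. r i * p i j)) A = r0 * dot d u A"
    unfolding dot_linear dot_sum by (simp add: assms(2))
  moreover have "dot d (\<lambda>j. r0 * u j + 1 * (\<Sum>i<d. r i * p i j)) A = 0"
    unfolding dot_def using r(2) by simp
  ultimately have "r0 = 0" using assms(3) by simp
  then have "\<forall>i<d. r i = 0" using r(2) lin_indep_rowsD[OF assms(1), of r] by simp
  then show False using r(1) \<open>r0 = 0\<close> by blast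
qed

text \<open>The degree bound is read off a single minor: some entry \<open>A j\<close> has degree
  exactly \<open>n\<close>, and the corresponding minor is \<open>g * A j\<close>, of degree at most
  the sum of the row degrees.\<close>

lemma hilbert_burch:
  fixes A :: "nat \<Rightarrow> 'a::field poly"
  assumes "unimodular n d A" "syz_family d A \<mu> p" "dot d u A = 1"
  shows "bordered_det d y p = bordered_det d u p * dot d y A"
    and "bordered_det d u p \<noteq> 0"
    and "degree (bordered_det d u p) + n \<le> (\<Sum>i<d. \<mu> i)"
proof -
  have syz: "dot d (p i) A = 0" if "i < d" for i using assms(2) that by (simp add: syz_family_def)
  show eq: "bordered_det d y p = bordered_det d u p * dot d y A" for y
    by (rule bordered_det_syz[OF assms(3) syz])
  show nz: "bordered_det d u p \<noteq> 0"
    using assms(2,3) by (intro bordered_det_nonzero[of d p A]) (auto simp: syz_family_def)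
  obtain j where j: "j \<le> d" "coeff (A j) n \<noteq> 0" using assms(1) by (auto simp: unimodular_def)
  then have A: "A j \<noteq> 0" "degree (A j) = n"
    using assms(1) le_degree[of "A j" n] by (auto simp: unimodular_def intro: antisym)
  have "degree (bordered_det d (unit_vec_fun j) p) \<le> 0 + (\<Sum>i<d. \<mu> i)"
    using assms(2) by (intro bordered_det_degree(1)) (auto simp: syz_family_def unit_vec_fun_def)
  then show "degree (bordered_det d u p) + n \<le> (\<Sum>i<d. \<mu> i)"
    unfolding eq[of "unit_vec_fun j"] dot_unit[OF j(1)] using nz A by (simp add: degree_mult_eq)
qed

lemma sum_fun_upd_le:
  fixes \<mu> :: "nat \<Rightarrow> nat"
  assumes "i < d"
  shows "(\<Sum>k<d. (\<mu>(i := m)) k) + \<mu> i = (\<Sum>k<d. \<mu> k) + m"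
  using assms by (subst (1 2) sum.remove[of _ i]) (auto intro!: sum.cong)

text \<open>Total degree \<open>n\<close> forces the common factor \<open>g\<close> to be a nonzero
  constant. Cramer's rule writes \<open>g x\<close> through \<open>u\<close> and the rows; pairing
  with \<open>A\<close> removes \<open>u\<close>, and \<open>g\<close> can be inverted. The degree
  bounds say that no cancellation of leading terms occurs in such a combination.\<close>

lemma syzygy_generation:
  fixes A :: "nat \<Rightarrow> 'a::field poly"
  assumes un: "unimodular n d A" and fam: "syz_family d A \<mu> p" and sum: "(\<Sum>i<d. \<mu> i) = n"
    and x: "dot d x A = 0" "\<And>j. j \<le> d \<Longrightarrow> degree (x j) \<le> m"
  obtains r where "\<And>j. j \<le> d \<Longrightarrow> x j = (\<Sum>i<d. r i * p i j)"
    "\<And>i. i < d \<Longrightarrow> r i \<noteq> 0 \<Longrightarrow> degree (r i) + \<mu> i \<le> m"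
proof -
  obtain u where u: "dot d u A = 1" using un by (auto simp: unimodular_def)
  have syz: "dot d (p i) A = 0" if "i < d" for i using fam that by (simp add: syz_family_def)
  define g where "g = bordered_det d u p"
  note hb = hilbert_burch[OF un fam u, folded g_def]
  have "degree g = 0" using hb(3) sum by simp
  then obtain c where c: "g = [:c:]" by (rule degree_eq_zeroE)
  have "c \<noteq> 0" using hb(2) c by simp
  obtain r0 r' where r': "\<And>j. j \<le> d \<Longrightarrow> r0 * u j + (\<Sum>i<d. r' i * p i j) = g * x j"
    using bordered_det_cramer[of d u p x] unfolding g_def by blast
  have "dot d (\<lambda>j. r0 * u j + 1 * (\<Sum>i<d. r' i * p i j)) A = r0"
    unfolding dot_linear dot_sum by (simp add: syz u)
  moreover have "dot d (\<lambda>j. r0 * u j + 1 * (\<Sum>i<d. r' i * p i j)) A = dot d (\<lambda>j. g * x j + 0 * x j) A"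
    using r' by (intro dot_cong) simp
  ultimately have "r0 = 0" unfolding dot_linear x(1) by simp
  define r where "r i = [:inverse c:] * r' i" for i
  have xr: "x j = (\<Sum>i<d. r i * p i j)" if "j \<le> d" for j
  proof -
    have "(\<Sum>i<d. r i * p i j) = [:inverse c:] * (\<Sum>i<d. r' i * p i j)"
      by (simp only: r_def sum_distrib_left mult.assoc)
    also have "\<dots> = x j" using r'[OF that] \<open>c \<noteq> 0\<close> by (simp add: \<open>r0 = 0\<close> c)
    finally show ?thesis by simp
  qed
  obtain j where j: "j \<le> d" "coeff (A j) n \<noteq> 0" using un by (auto simp: unimodular_def)
  then have A: "A j \<noteq> 0" "degree (A j) = n"
    using un le_degree[of "A j" n] by (auto simp: unimodular_def intro: antisym)
  \<comment> \<open>The minor with row \<open>i\<close> replaced by \<open>x\<close> is computed in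
    two ways. Expanding \<open>x\<close> gives \<open>r i * (g * A j)\<close>, of degree
    \<open>degree (r i) + n\<close>, since all other terms have a repeated row; the row degrees
    bound it by \<open>n - \<mu> i + m\<close>.\<close>
  have deg: "degree (r i) + \<mu> i \<le> m" if i: "i < d" "r i \<noteq> 0" for i
  proof -
    let ?e = "unit_vec_fun j :: nat \<Rightarrow> 'a poly"
    have "bordered_det d ?e (p(i := x)) = bordered_det d ?e (p(i := (\<lambda>j. \<Sum>k<d. r k * p k j)))"
      by (intro bordered_det_cong) (auto simp: xr)
    also have "\<dots> = (\<Sum>k<d. r k * bordered_det d ?e (p(i := p k)))"
      by (rule bordered_det_sum) (use i in auto)
    also have "\<dots> = (\<Sum>k<d. if k = i then r i * bordered_det d ?e p else 0)"
    proof (rule sum.cong)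
      fix k assume "k \<in> {..<d}"
      then have "k \<noteq> i \<Longrightarrow> bordered_det d ?e (p(i := p k)) = 0"
        using i by (intro bordered_det_same[of k i]) auto
      then show "r k * bordered_det d ?e (p(i := p k)) = (if k = i then r i * bordered_det d ?e p else 0)"
        by (cases "k = i") (auto simp: fun_upd_triv simp del: fun_upd_apply)
    qed simp
    also have "\<dots> = r i * (g * A j)" using i by (simp add: hb(1)[of ?e] dot_unit[OF j(1)])
    finally have *: "bordered_det d ?e (p(i := x)) = r i * (g * A j)" .
    have "degree (bordered_det d ?e (p(i := x))) \<le> 0 + (\<Sum>k<d. (\<mu>(i := m)) k)"
      using fam x(2) by (intro bordered_det_degree(1)) (auto simp: syz_family_def unit_vec_fun_def)
    moreover have "degree (r i * (g * A j)) = degree (r i) + n"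
      using i A hb(2) \<open>degree g = 0\<close> by (simp add: degree_mult_eq)
    ultimately show ?thesis unfolding * using sum_fun_upd_le[OF i(1), of \<mu> m] sum by linarith
  qed
  show thesis by (rule that[OF xr deg])
qed

section \<open>Existence of families of total degree n\<close>

text \<open>A relation among the new rows, multiplied by \<open>g\<close>, becomes a relation among
  the old ones with coefficients \<open>q\<close>. The \<open>i\<close>-th of them is
  \<open>r i * w i\<close>, so \<open>r i = 0\<close>, and then the others vanish as well.\<close>

lemma lin_indep_rows_replace:
  assumes "lin_indep_rows d p" "i < d" "g \<noteq> 0" "w i \<noteq> 0"
    and x: "\<And>j. j \<le> d \<Longrightarrow> g * x j = (\<Sum>k<d. w k * p k j)"
  shows "lin_indep_rows d (p(i := x))"
  unfolding lin_indep_rows_def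
proof (intro allI impI)
  fix r k assume r: "\<forall>j\<le>d. (\<Sum>k<d. r k * (p(i := x)) k j) = 0" and k: "k < d"
  define q where "q k = r i * w k + (if k = i then 0 else g * r k)" for k
  have "(\<Sum>k<d. q k * p k j) = 0" if "j \<le> d" for j
  proof -
    have "(\<Sum>k<d. q k * p k j) = r i * (g * x j) + (\<Sum>k<d. if k = i then 0 else g * (r k * p k j))"
      unfolding x[OF that] sum_distrib_left sum.distrib[symmetric]
      by (rule sum.cong) (auto simp: q_def algebra_simps)
    also have "\<dots> = g * (\<Sum>k<d. r k * (p(i := x)) k j)"
      unfolding sum_distrib_left sum.remove[OF finite_lessThan lessThan_iff[THEN iffD2, OF \<open>i < d\<close>]]
      by (auto simp: sum_distrib_left algebra_simps intro!: sum.cong)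
    finally show ?thesis using r that by simp
  qed
  then have q: "q k = 0" if "k < d" for k using lin_indep_rowsD[OF assms(1)] that by blast
  have "r i = 0" using q[OF \<open>i < d\<close>] \<open>w i \<noteq> 0\<close> by (simp add: q_def)
  then show "r k = 0" using q[OF k] \<open>g \<noteq> 0\<close> by (cases "k = i") (auto simp: q_def)
qed

text \<open>The exchange shared by both ways of lowering the total degree: \<open>g\<close> is the
  common factor of the minors in one case and \<open>1\<close> in the other.\<close>

lemma syz_family_replace:
  fixes A :: "nat \<Rightarrow> 'a::field poly"
  assumes fam: "syz_family d A \<mu> p" and i: "i < d" and g: "g \<noteq> 0" and w: "w i \<noteq> 0"
    and x: "\<And>j. j \<le> d \<Longrightarrow> g * x j = (\<Sum>k<d. w k * p k j)"
    and deg: "\<And>j. j \<le> d \<Longrightarrow> x j \<noteq> 0 \<Longrightarrow> degree (x j) < \<mu> i"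
  shows "syz_family d A (\<mu>(i := \<mu> i - 1)) (p(i := x))"
    and "(\<Sum>k<d. (\<mu>(i := \<mu> i - 1)) k) < (\<Sum>k<d. \<mu> k)"
proof -
  have "g * dot d x A = dot d (\<lambda>j. g * x j + 0 * x j) A" by (subst dot_linear) simp
  also have "\<dots> = dot d (\<lambda>j. \<Sum>k<d. w k * p k j) A" using x by (intro dot_cong) simp
  also have "\<dots> = 0" unfolding dot_sum using fam by (simp add: syz_family_def)
  finally have dx: "dot d x A = 0" using g by simp
  have li: "lin_indep_rows d p" using fam by (simp add: syz_family_def)
  \<comment> \<open>A nonzero entry has degree below \<open>\<mu> i\<close>, so
    \<open>\<mu> i\<close> is positive and \<open>\<mu> i - 1\<close> is not truncated.\<close>
  have "\<exists>j\<le>d. x j \<noteq> 0"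
  proof (rule ccontr)
    assume "\<not> (\<exists>j\<le>d. x j \<noteq> 0)"
    then have "(\<Sum>k<d. w k * p k j) = 0" if "j \<le> d" for j using x[OF that] that by simp
    then show False using lin_indep_rowsD[OF li _ i] w by blast
  qed
  then have pos: "\<mu> i > 0" using deg by fastforce
  have "degree (x j) \<le> \<mu> i - 1" if "j \<le> d" for j
    using deg[OF that] by (cases "x j = 0") auto
  then show "syz_family d A (\<mu>(i := \<mu> i - 1)) (p(i := x))"
    using fam lin_indep_rows_replace[OF li i g w x] dx by (auto simp: syz_family_def)
  show "(\<Sum>k<d. (\<mu>(i := \<mu> i - 1)) k) < (\<Sum>k<d. \<mu> k)"
    using sum_fun_upd_le[OF i, of \<mu> "\<mu> i - 1"] pos by linarith
qed

text \<open>If the maximal minors have a common factor \<open>g\<close>, some combination of the \<open>p_i\<close> with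
  coefficients of degree below that of \<open>g\<close> is divisible by \<open>g\<close>; the quotient replaces an involved
  \<open>p_i\<close> of largest degree.\<close>

lemma syz_family_reduce_content:
  fixes A :: "nat \<Rightarrow> 'a::field poly"
  assumes un: "unimodular n d A" and fam: "syz_family d A \<mu> p" and u: "dot d u A = 1"
    and g: "degree (bordered_det d u p) > 0"
  obtains \<mu>' p' where "syz_family d A \<mu>' p'" "(\<Sum>i<d. \<mu>' i) < (\<Sum>i<d. \<mu> i)"
proof -
  have syz: "dot d (p i) A = 0" if "i < d" for i using fam that by (simp add: syz_family_def)
  have li: "lin_indep_rows d p" using fam by (simp add: syz_family_def)
  define g where "g = bordered_det d u p"
  have g0: "g \<noteq> 0" using assms(4) by (auto simp: g_def)
  then have "\<not> g dvd 1" using assms(4) is_unit_iff_degree[of g] by (simp add: g_def)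
  note g0 = g0 this
  \<comment> \<open>Otherwise \<open>g\<close> could be cancelled from every such relation. Then
    \<open>u\<close> and the rows \<open>p i\<close> would generate all unit vectors, and their
    determinant \<open>g\<close> would be a unit.\<close>
  have "\<exists>x w. (\<forall>j\<le>d. g * x j = (\<Sum>i<d. w i * p i j)) \<and> (\<exists>i<d. \<not> g dvd w i)"
  proof (rule ccontr)
    assume neg: "\<nexists>x w. (\<forall>j\<le>d. g * x j = (\<Sum>i<d. w i * p i j)) \<and> (\<exists>i<d. \<not> g dvd w i)"
    have "\<exists>r0 r. \<forall>j\<le>d. r0 * u j + (\<Sum>i<d. r i * p i j) = unit_vec_fun k j" if k: "k \<le> d" for k
    proof -
      \<comment> \<open>The projection of a unit vector to the syzygies along
        \<open>u\<close>.\<close>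
      define x where "x = (\<lambda>j. 1 * unit_vec_fun k j + (- A k) * u j)"
      have dx: "dot d x A = 0" unfolding x_def dot_linear using u k by (simp add: dot_unit)
      obtain r0 r where r: "\<And>j. j \<le> d \<Longrightarrow> r0 * u j + (\<Sum>i<d. r i * p i j) = g * x j"
        using bordered_det_cramer[of d u p x] unfolding g_def by blast
      have "dot d (\<lambda>j. r0 * u j + 1 * (\<Sum>i<d. r i * p i j)) A = r0"
        unfolding dot_linear dot_sum by (simp add: syz u)
      moreover have "dot d (\<lambda>j. r0 * u j + 1 * (\<Sum>i<d. r i * p i j)) A = dot d (\<lambda>j. g * x j + 0 * x j) A"
        using r by (intro dot_cong) simp
      ultimately have "r0 = 0" unfolding dot_linear dx by simp
      then have "\<forall>j\<le>d. g * x j = (\<Sum>i<d. r i * p i j)" using r by simp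
      then have "\<forall>i<d. g dvd r i" using neg by blast
      then obtain s where s: "\<And>i. i < d \<Longrightarrow> r i = g * s i" unfolding dvd_def by metis
      have "A k * u j + (\<Sum>i<d. s i * p i j) = unit_vec_fun k j" if "j \<le> d" for j
      proof -
        have "g * x j = g * (\<Sum>i<d. s i * p i j)"
          using r[OF that] \<open>r0 = 0\<close> s by (simp add: sum_distrib_left mult.assoc)
        then have "x j = (\<Sum>i<d. s i * p i j)" using g0 by simp
        then show ?thesis by (simp add: x_def algebra_simps)
      qed
      then show ?thesis by blast
    qed
    then have "g dvd 1" unfolding g_def by (rule bordered_det_dvd_one)
    then show False using g0 by blast
  qed
  then obtain x w where xw: "\<And>j. j \<le> d \<Longrightarrow> g * x j = (\<Sum>i<d. w i * p i j)" "\<exists>i<d. \<not> g dvd w i"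
    by blast
  define w' where "w' i = w i mod g" for i
  define x' where "x' j = x j - (\<Sum>i<d. (w i div g) * p i j)" for j
  have x': "g * x' j = (\<Sum>i<d. w' i * p i j)" if "j \<le> d" for j
  proof -
    have "g * x' j = (\<Sum>i<d. w i * p i j - g * ((w i div g) * p i j))"
      by (simp add: x'_def right_diff_distrib xw(1)[OF that] sum_distrib_left sum_subtractf)
    also have "\<dots> = (\<Sum>i<d. w' i * p i j)"
    proof (rule sum.cong)
      fix i
      have "w i = g * (w i div g) + w' i" by (simp add: w'_def)
      then have "w i * p i j = (g * (w i div g) + w' i) * p i j" by (rule arg_cong)
      then show "w i * p i j - g * ((w i div g) * p i j) = w' i * p i j"
        by (simp only: algebra_simps)
    qed simp
    finally show ?thesis .
  qed
  define S where "S = {i. i < d \<and> w' i \<noteq> 0}"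
  have "finite S" "S \<noteq> {}" using xw(2) by (auto simp: S_def w'_def mod_eq_0_iff_dvd)
  then obtain i where i: "i \<in> S" "\<And>k. k \<in> S \<Longrightarrow> \<mu> k \<le> \<mu> i"
    using obtains_MAX[of S \<mu>] Max_ge[of "\<mu> ` S"] by (metis finite_imageI imageI)
  have deg: "degree (x' j) < \<mu> i" if "j \<le> d" "x' j \<noteq> 0" for j
  proof -
    have "degree (w' k * p k j) \<le> degree g - 1 + \<mu> i" if k: "k < d" for k
    proof (cases "w' k = 0")
      case False
      then have "k \<in> S" using k by (simp add: S_def)
      moreover have "degree (w' k) \<le> degree g - 1"
        using degree_mod_less'[of g "w k"] g0 False by (simp add: w'_def)
      moreover have "degree (p k j) \<le> \<mu> k" using fam k \<open>j \<le> d\<close> by (simp add: syz_family_def)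
      ultimately show ?thesis using i(2)[of k] degree_mult_le[of "w' k" "p k j"] by linarith
    qed simp
    then have "degree (\<Sum>k<d. w' k * p k j) \<le> degree g - 1 + \<mu> i" by (intro degree_sum_le) auto
    then have "degree (g * x' j) \<le> degree g - 1 + \<mu> i" by (simp only: x'[OF that(1)])
    then show ?thesis using that(2) g0 assms(4) by (simp add: degree_mult_eq g_def)
  qed
  have "i < d" "w' i \<noteq> 0" using i by (auto simp: S_def)
  from syz_family_replace[where w = w', OF fam this(1) g0(1) this(2) x' deg] show thesis by (rule that)
qed

text \<open>Here the minors have smaller degree than expected, so the vectors of leading coefficients are
  linearly dependent over the field.\<close>

lemma syz_family_reduce_leading:
  fixes A :: "nat \<Rightarrow> 'a::field poly"
  assumes un: "unimodular n d A" and fam: "syz_family d A \<mu> p" and u: "dot d u A = 1"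
    and g: "degree (bordered_det d u p) = 0" and gt: "n < (\<Sum>i<d. \<mu> i)"
  obtains \<mu>' p' where "syz_family d A \<mu>' p'" "(\<Sum>i<d. \<mu>' i) < (\<Sum>i<d. \<mu> i)"
proof -
  have syz: "dot d (p i) A = 0" if "i < d" for i using fam that by (simp add: syz_family_def)
  have li: "lin_indep_rows d p" using fam by (simp add: syz_family_def)
  have degA: "degree (A j) \<le> n" if "j \<le> d" for j using un that by (simp add: unimodular_def)
  have degp: "degree (p i j) \<le> \<mu> i" if "i < d" "j \<le> d" for i j using fam that by (simp add: syz_family_def)
  obtain j0 where j0: "j0 \<le> d" "coeff (A j0) n \<noteq> 0" using un by (auto simp: unimodular_def)
  define v where "v i j = coeff (p i j) (\<mu> i)" for i j
  define \<alpha> where "\<alpha> j = coeff (A j) n" for j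
  \<comment> \<open>The top coefficient of \<open>p i . A = 0\<close>: leading vectors are
    orthogonal to the nonzero vector \<open>\<alpha>\<close>.\<close>
  have v\<alpha>: "dot d (v i) \<alpha> = 0" if "i < d" for i
  proof -
    have "coeff (p i j * A j) (\<mu> i + n) = v i j * \<alpha> j" if "j \<le> d" for j
      unfolding v_def \<alpha>_def by (rule coeff_mult_top[OF degp[OF \<open>i < d\<close> that] degA[OF that]])
    then have "dot d (v i) \<alpha> = coeff (dot d (p i) A) (\<mu> i + n)"
      by (simp add: dot_def coeff_sum)
    then show ?thesis using syz[OF that] by simp
  qed
  let ?e = "unit_vec_fun j0 :: nat \<Rightarrow> 'a poly"
  \<comment> \<open>This minor is a constant times \<open>A j0\<close>. Its formal degree exceeds
    \<open>n\<close>, so its formal leading coefficient, the determinant of the \<open>v i\<close>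
    bordered by a unit vector, is zero.\<close>
  have "degree (bordered_det d ?e p) \<le> n"
    unfolding hilbert_burch(1)[OF un fam u, of ?e] dot_unit[OF j0(1)]
    using degree_mult_le[of "bordered_det d u p" "A j0"] degA[OF j0(1)] g by linarith
  then have "coeff (bordered_det d ?e p) (0 + (\<Sum>i<d. \<mu> i)) = 0"
    using gt by (intro coeff_eq_0) linarith
  moreover have "coeff (bordered_det d ?e p) (0 + (\<Sum>i<d. \<mu> i)) = bordered_det d (\<lambda>j. coeff (?e j) 0) v"
    unfolding v_def by (rule bordered_det_degree(2)) (auto simp: degp unit_vec_fun_def)
  ultimately have "bordered_det d (\<lambda>j. coeff (?e j) 0) v = 0" by (rule trans[OF sym, rotated])
  then obtain c0 c where c: "c0 \<noteq> 0 \<or> (\<exists>i<d. c i \<noteq> 0)"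
    "\<And>j. j \<le> d \<Longrightarrow> c0 * coeff (?e j) 0 + (\<Sum>i<d. c i * v i j) = 0"
    unfolding bordered_det_zero_iff by blast
  have e0: "(\<lambda>j. coeff (?e j) 0) = (unit_vec_fun j0 :: nat \<Rightarrow> 'a)" by (auto simp: unit_vec_fun_def)
  \<comment> \<open>Pairing with \<open>\<alpha>\<close> leaves \<open>c0 * \<alpha> j0\<close>, so
    the dependency involves only the leading vectors.\<close>
  have "dot d (\<lambda>j. c0 * coeff (?e j) 0 + 1 * (\<Sum>i<d. c i * v i j)) \<alpha> = c0 * \<alpha> j0"
    unfolding dot_linear dot_sum e0 dot_unit[OF j0(1)] by (simp add: v\<alpha>)
  moreover have "dot d (\<lambda>j. c0 * coeff (?e j) 0 + 1 * (\<Sum>i<d. c i * v i j)) \<alpha> = 0"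
    unfolding dot_def using c(2) by simp
  ultimately have "c0 = 0" using j0 by (simp add: \<alpha>_def)
  define S where "S = {i. i < d \<and> c i \<noteq> 0}"
  have "finite S" "S \<noteq> {}" using c(1) \<open>c0 = 0\<close> by (auto simp: S_def)
  then obtain i where i: "i \<in> S" "\<And>k. k \<in> S \<Longrightarrow> \<mu> k \<le> \<mu> i"
    using obtains_MAX[of S \<mu>] Max_ge[of "\<mu> ` S"] by (metis finite_imageI imageI)
  \<comment> \<open>Powers of \<open>t\<close> shift all involved rows to formal degree
    \<open>\<mu> i\<close>, where their leading terms cancel. If \<open>\<mu> k > \<mu> i\<close>,
    then \<open>c k = 0\<close>, so the truncated exponent is harmless.\<close>
  define w where "w k = monom (c k) (\<mu> i - \<mu> k)" for k
  define x where "x j = (\<Sum>k<d. w k * p k j)" for j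
  have deg: "degree (x j) < \<mu> i" if j: "j \<le> d" "x j \<noteq> 0" for j
  proof -
    have *: "degree (w k * p k j) \<le> \<mu> i \<and> coeff (w k * p k j) (\<mu> i) = c k * v k j" if k: "k < d" for k
    proof (cases "c k = 0")
      case False
      then have le: "\<mu> k \<le> \<mu> i" using i(2)[of k] k by (simp add: S_def)
      have "degree (w k) \<le> \<mu> i - \<mu> k" by (simp add: w_def degree_monom_le)
      then have "degree (w k * p k j) \<le> \<mu> i"
        using degree_mult_le[of "w k" "p k j"] degp[OF k j(1)] le by linarith
      moreover have "coeff (w k * p k j) (\<mu> i) = c k * v k j"
        using le by (simp add: w_def v_def coeff_monom_mult)
      ultimately show ?thesis by simp
    qed (simp add: w_def)
    then have "degree (x j) \<le> \<mu> i" unfolding x_def by (intro degree_sum_le) auto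
    moreover have "coeff (x j) (\<mu> i) = 0"
      unfolding x_def coeff_sum using * c(2)[OF j(1)] \<open>c0 = 0\<close> by simp
    ultimately show ?thesis using j(2) by (metis leading_coeff_0_iff order_le_less)
  qed
  have i': "i < d" "w i \<noteq> 0" using i by (auto simp: S_def w_def)
  have x: "1 * x j = (\<Sum>k<d. w k * p k j)" for j by (simp add: x_def)
  from syz_family_replace[where w = w, OF fam i'(1) one_neq_zero i'(2) x deg] show thesis by (rule that)
qed

text \<open>The syzygies \<open>A l e_k - A k e_l\<close> for \<open>k \<noteq> l\<close>, with
  \<open>A l\<close> nonzero. Column \<open>k\<close> of a combination contains only the coefficient
  of the \<open>k\<close>-th one, times \<open>A l\<close>, whence independence.\<close>

lemma koszul_family:
  fixes A :: "nat \<Rightarrow> 'a::field poly"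
  assumes un: "unimodular n d A"
  obtains p where "syz_family d A (\<lambda>i. n) p"
proof -
  have degA: "degree (A j) \<le> n" if "j \<le> d" for j using un that by (simp add: unimodular_def)
  obtain l where l: "l \<le> d" "A l \<noteq> 0" using un unfolding unimodular_def by (metis coeff_0)
  \<comment> \<open>Enumerates the indices up to \<open>d\<close> other than
    \<open>l\<close>.\<close>
  define \<sigma> where "\<sigma> i = (if i < l then i else Suc i)" for i
  define p where "p i = (\<lambda>j. A l * unit_vec_fun (\<sigma> i) j + (- A (\<sigma> i)) * unit_vec_fun l j)" for i
  have \<sigma>: "\<sigma> i \<le> d" "\<sigma> i \<noteq> l" if "i < d" for i using that l by (auto simp: \<sigma>_def)
  have \<sigma>inj: "\<sigma> i = \<sigma> k \<longleftrightarrow> i = k" for i k by (auto simp: \<sigma>_def)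
  have "dot d (p i) A = 0" if "i < d" for i
    unfolding p_def dot_linear dot_unit[OF \<sigma>(1)[OF that]] dot_unit[OF l(1)] by simp
  moreover have "degree (p i j) \<le> n" if "i < d" "j \<le> d" for i j
    using \<sigma>[OF that(1)] degA l by (auto simp: p_def unit_vec_fun_def)
  moreover have "lin_indep_rows d p"
    unfolding lin_indep_rows_def
  proof (intro allI impI)
    fix r i assume r: "\<forall>j\<le>d. (\<Sum>i<d. r i * p i j) = 0" and i: "i < d"
    have "(\<Sum>k<d. r k * p k (\<sigma> i)) = (\<Sum>k<d. if k = i then r k * A l else 0)"
      using \<sigma>[OF i] by (intro sum.cong) (auto simp: p_def unit_vec_fun_def \<sigma>inj)
    then show "r i = 0" using r \<sigma>(1)[OF i] i l by simp
  qed
  ultimately have "syz_family d A (\<lambda>i. n) p" by (simp add: syz_family_def)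
  then show thesis by (rule that)
qed

text \<open>Descent on the total degree, which cannot fall below \<open>n\<close>. Above
  \<open>n\<close>, the reduction to use depends on whether the common factor of the minors is
  constant.\<close>

lemma exists_minimal_family:
  fixes A :: "nat \<Rightarrow> 'a::field poly"
  assumes un: "unimodular n d A"
  obtains \<mu> p where "syz_family d A \<mu> p" "(\<Sum>i<d. \<mu> i) = n"
proof -
  obtain u where u: "dot d u A = 1" using un by (auto simp: unimodular_def)
  have "\<exists>\<mu>' p'. syz_family d A \<mu>' p' \<and> (\<Sum>i<d. \<mu>' i) = n" if "syz_family d A \<mu> p" for \<mu> p
    using that
  proof (induction "\<Sum>i<d. \<mu> i" arbitrary: \<mu> p rule: less_induct)
    case less
    note hb = hilbert_burch[OF un less.prems u]
    show ?case
    proof (cases "(\<Sum>i<d. \<mu> i) = n")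
      case False
      then have gt: "n < (\<Sum>i<d. \<mu> i)" using hb(3) by linarith
      obtain \<mu>' p' where "syz_family d A \<mu>' p'" "(\<Sum>i<d. \<mu>' i) < (\<Sum>i<d. \<mu> i)"
      proof (cases "degree (bordered_det d u p) = 0")
        case True
        then show ?thesis using syz_family_reduce_leading[OF un less.prems u _ gt] that by blast
      next
        case False
        then show ?thesis using syz_family_reduce_content[OF un less.prems u] that by blast
      qed
      then show ?thesis using less.hyps by blast
    qed (use less.prems in blast)
  qed
  then show thesis using koszul_family[OF un] that by metis
qed

lemma syz_family_permute:
  assumes fam: "syz_family d A \<mu> p" and \<pi>: "bij_betw \<pi> {..<d} {..<d}"
  shows "syz_family d A (\<mu> \<circ> \<pi>) (p \<circ> \<pi>)"
proof -
  have \<pi>': "\<pi> i < d" if "i < d" for i using \<pi> that by (auto simp: bij_betw_def)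
  have "lin_indep_rows d (p \<circ> \<pi>)"
    unfolding lin_indep_rows_def
  proof (intro allI impI)
    fix r i assume r: "\<forall>j\<le>d. (\<Sum>i<d. r i * (p \<circ> \<pi>) i j) = 0" and i: "i < d"
    let ?\<rho> = "inv_into {..<d} \<pi>"
    have "(\<Sum>i<d. r (?\<rho> i) * p i j) = 0" if "j \<le> d" for j
    proof -
      have "(\<Sum>i<d. r (?\<rho> i) * p i j) = (\<Sum>i<d. r (?\<rho> (\<pi> i)) * p (\<pi> i) j)"
        by (rule sum.reindex_bij_betw[OF \<pi>, symmetric])
      also have "\<dots> = (\<Sum>i<d. r i * (p \<circ> \<pi>) i j)"
        using \<pi> by (intro sum.cong) (auto simp: bij_betw_def inv_into_f_f)
      finally show ?thesis using r that by simp
    qed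
    then have "r (?\<rho> (\<pi> i)) = 0"
      using fam \<pi>'[OF i] lin_indep_rowsD[of d p "\<lambda>i. r (?\<rho> i)" "\<pi> i"] by (simp add: syz_family_def)
    then show "r i = 0" using \<pi> i by (simp add: bij_betw_def inv_into_f_f)
  qed
  then show ?thesis using fam \<pi>' by (auto simp: syz_family_def)
qed

lemma syz_family_sort:
  assumes fam: "syz_family d A \<mu> p"
  obtains l q where "syz_family d A (\<lambda>i. l ! i) q" "sorted l" "length l = d" "set l = \<mu> ` {..<d}"
    "sum_list l = (\<Sum>i<d. \<mu> i)"
proof -
  define ix where "ix = sort_key \<mu> [0..<d]"
  have ix: "set ix = {..<d}" "length ix = d" "distinct ix" by (auto simp: ix_def)
  have \<pi>: "bij_betw (\<lambda>i. ix ! i) {..<d} {..<d}"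
    using bij_betw_nth[OF ix(3)] ix by (metis order_refl)
  have fam': "syz_family d A (\<lambda>i. map \<mu> ix ! i) (\<lambda>i. p (ix ! i))"
    using syz_family_permute[OF fam \<pi>] ix by (simp add: syz_family_def comp_def)
  have "sum_list (map \<mu> ix) = (\<Sum>i<d. \<mu> i)"
    using ix by (simp add: sum_list_distinct_conv_sum_set)
  then show thesis using that[OF fam'] ix by (simp add: ix_def)
qed

section \<open>Homogenisation\<close>

text \<open>Terms of \<open>A\<close> of degree above \<open>k\<close> are dropped, so the result is
  always a form of degree \<open>k\<close>; it restores \<open>A\<close> at \<open>s = 1\<close>
  when \<open>degree A \<le> k\<close>.\<close>

definition homog :: "nat \<Rightarrow> 'a::field poly \<Rightarrow> 'a poly poly" where
  "homog k A = (\<Sum>i\<le>k. monom (monom (coeff A (k - i)) (k - i)) i)"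

definition hom_part :: "nat \<Rightarrow> 'a::field poly poly \<Rightarrow> 'a poly poly" where
  "hom_part k p = (\<Sum>i\<le>k. monom (monom (coeff (coeff p i) (k - i)) (k - i)) i)"

lemma coeff_homog: "coeff (coeff (homog k A) i) j = (if i + j = k then coeff A j else 0)"
proof -
  have "coeff (coeff (homog k A) i) j = (\<Sum>l\<le>k. if l = i then coeff (monom (coeff A (k - l)) (k - l)) j else 0)"
    unfolding homog_def coeff_sum by (intro sum.cong) auto
  also have "\<dots> = (if i + j = k then coeff A j else 0)"
    by (auto simp: coeff_monom)
  finally show ?thesis .
qed

lemma coeff_hom_part: "coeff (coeff (hom_part k p) i) j = (if i + j = k then coeff (coeff p i) j else 0)"
proof -
  have "coeff (coeff (hom_part k p) i) j =
      (\<Sum>l\<le>k. if l = i then coeff (monom (coeff (coeff p l) (k - l)) (k - l)) j else 0)"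
    unfolding hom_part_def coeff_sum by (intro sum.cong) auto
  also have "\<dots> = (if i + j = k then coeff (coeff p i) j else 0)"
    by (auto simp: coeff_monom)
  finally show ?thesis .
qed

lemma poly_poly_eqI: "(\<And>i j. coeff (coeff p i) j = coeff (coeff q i) j) \<Longrightarrow> p = q"
  by (intro poly_eqI) auto

lemma graded_partD: "p \<in> graded_part k \<Longrightarrow> coeff (coeff p i) j \<noteq> 0 \<Longrightarrow> int i + int j = k"
  by (auto simp: graded_part_def)

lemma graded_part_0 [simp]: "0 \<in> graded_part k"
  by (auto simp: graded_part_def)

lemma graded_part_add: "p \<in> graded_part k \<Longrightarrow> q \<in> graded_part k \<Longrightarrow> p + q \<in> graded_part k"
  unfolding graded_part_def by (auto, metis add_0)

lemma graded_part_sum: "(\<And>i. i \<in> S \<Longrightarrow> f i \<in> graded_part k) \<Longrightarrow> sum f S \<in> graded_part k"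
  by (induction S rule: infinite_finite_induct) (auto intro: graded_part_add)

lemma graded_part_mult:
  assumes "p \<in> graded_part k" "q \<in> graded_part l"
  shows "p * q \<in> graded_part (k + l)"
  unfolding graded_part_def
proof (intro CollectI allI impI)
  fix i j assume "coeff (coeff (p * q) i) j \<noteq> 0"
  then have "(\<Sum>a\<le>i. \<Sum>b\<le>j. coeff (coeff p a) b * coeff (coeff q (i - a)) (j - b)) \<noteq> 0"
    by (simp add: coeff_mult coeff_sum)
  then obtain a where a: "a \<le> i" "(\<Sum>b\<le>j. coeff (coeff p a) b * coeff (coeff q (i - a)) (j - b)) \<noteq> 0"
    using sum.not_neutral_contains_not_neutral by (metis (no_types, lifting) atMost_iff)
  then obtain b where b: "b \<le> j" "coeff (coeff p a) b * coeff (coeff q (i - a)) (j - b) \<noteq> 0"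
    using sum.not_neutral_contains_not_neutral by (metis (no_types, lifting) atMost_iff)
  then have "coeff (coeff p a) b \<noteq> 0" "coeff (coeff q (i - a)) (j - b) \<noteq> 0" by auto
  from graded_partD[OF assms(1) this(1)] graded_partD[OF assms(2) this(2)]
  show "int i + int j = k + l" using a b by linarith
qed

lemma homog_graded: "homog k A \<in> graded_part (int k)"
  by (auto simp: graded_part_def coeff_homog split: if_splits)

lemma hom_part_graded: "hom_part k p \<in> graded_part (int k)"
  by (auto simp: graded_part_def coeff_hom_part split: if_splits)

lemma coeff_dehom: "coeff (poly p 1) j = (\<Sum>i\<le>degree p. coeff (coeff p i) j)"
  by (simp add: poly_altdef coeff_sum)

text \<open>In a form the exponent of \<open>t\<close> determines that of \<open>s\<close>, so
  setting \<open>s = 1\<close> merges no two monomials. This is why forms of one degree can be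
  compared at \<open>s = 1\<close>.\<close>

lemma coeff_dehom_graded:
  assumes "p \<in> graded_part (int k)"
  shows "coeff (poly p 1) j = (if j \<le> k then coeff (coeff p (k - j)) j else 0)"
proof -
  have "coeff (poly p 1) j = (\<Sum>i\<le>degree p. if i = k - j \<and> j \<le> k then coeff (coeff p (k - j)) j else 0)"
    unfolding coeff_dehom
  proof (rule sum.cong)
    fix i
    show "coeff (coeff p i) j = (if i = k - j \<and> j \<le> k then coeff (coeff p (k - j)) j else 0)"
      using graded_partD[OF assms, of i j] by (cases "coeff (coeff p i) j = 0") auto
  qed simp
  also have "\<dots> = (if j \<le> k then coeff (coeff p (k - j)) j else 0)"
    by (auto simp: coeff_eq_0)
  finally show ?thesis .
qed

lemma degree_dehom: "p \<in> graded_part (int k) \<Longrightarrow> degree (poly p 1) \<le> k"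
  by (intro degree_le) (simp add: coeff_dehom_graded)

lemma homog_dehom:
  assumes "p \<in> graded_part (int k)"
  shows "homog k (poly p 1) = p"
proof (rule poly_poly_eqI)
  fix i j
  show "coeff (coeff (homog k (poly p 1)) i) j = coeff (coeff p i) j"
  proof (cases "i + j = k")
    case True
    then show ?thesis by (auto simp: coeff_homog coeff_dehom_graded[OF assms])
  next
    case False
    then have "coeff (coeff p i) j = 0" using graded_partD[OF assms, of i j] by linarith
    then show ?thesis using False by (simp add: coeff_homog)
  qed
qed

lemma dehom_homog: "degree A \<le> k \<Longrightarrow> poly (homog k A) 1 = A"
  by (intro poly_eqI) (auto simp: coeff_dehom_graded[OF homog_graded] coeff_homog coeff_eq_0)

lemma graded_eqI:
  "p \<in> graded_part (int k) \<Longrightarrow> q \<in> graded_part (int k) \<Longrightarrow> poly p 1 = poly q 1 \<Longrightarrow> p = q"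
  using homog_dehom by metis

lemma graded_zeroI: "p \<in> graded_part (int k) \<Longrightarrow> poly p 1 = 0 \<Longrightarrow> p = 0"
  by (rule graded_eqI) auto

lemma hom_part_add: "hom_part k (p + q) = hom_part k p + hom_part k q"
  by (intro poly_poly_eqI) (simp add: coeff_hom_part)

lemma hom_part_0 [simp]: "hom_part k 0 = 0"
  by (intro poly_poly_eqI) (simp add: coeff_hom_part)

lemma hom_part_sum: "hom_part k (sum f S) = (\<Sum>i\<in>S. hom_part k (f i))"
  by (induction S rule: infinite_finite_induct) (auto simp: hom_part_add)

lemma hom_part_of_graded:
  assumes "p \<in> graded_part (int m)"
  shows "hom_part k p = (if k = m then p else 0)"
proof (rule poly_poly_eqI)
  fix i j
  have "i + j = m" if "coeff (coeff p i) j \<noteq> 0" using graded_partD[OF assms that] by linarith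
  then show "coeff (coeff (hom_part k p) i) j = coeff (coeff (if k = m then p else 0) i) j"
    by (cases "coeff (coeff p i) j = 0") (auto simp: coeff_hom_part)
qed

text \<open>Claimed for all large \<open>M\<close>, so that one bound can serve several polynomials
  at once.\<close>

lemma sum_hom_part:
  "\<exists>N. \<forall>M\<ge>N. p = (\<Sum>k\<le>M. hom_part k p)"
proof -
  define N where "N = degree p + (\<Sum>i\<le>degree p. degree (coeff p i))"
  have N: "i + j \<le> N" if "coeff (coeff p i) j \<noteq> 0" for i j
  proof -
    have i: "i \<le> degree p" using that by (intro le_degree) auto
    have "degree (coeff p i) \<le> (\<Sum>i\<le>degree p. degree (coeff p i))"
      by (rule member_le_sum) (use i in auto)
    then show ?thesis using i le_degree[OF that] by (simp add: N_def)
  qed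
  have "p = (\<Sum>k\<le>M. hom_part k p)" if "N \<le> M" for M
  proof (rule poly_poly_eqI)
    fix i j
    have "(\<Sum>k\<le>M. coeff (coeff (hom_part k p) i) j) = (\<Sum>k\<le>M. if k = i + j then coeff (coeff p i) j else 0)"
      by (intro sum.cong) (auto simp: coeff_hom_part)
    also have "\<dots> = coeff (coeff p i) j"
      using N[of i j] that by (cases "coeff (coeff p i) j = 0") auto
    finally show "coeff (coeff p i) j = coeff (coeff (\<Sum>k\<le>M. hom_part k p) i) j"
      by (simp add: coeff_sum)
  qed
  then show ?thesis by blast
qed

lemma hom_part_mult:
  assumes "P \<in> graded_part (int l)"
  shows "hom_part k (q * P) = (if l \<le> k then hom_part (k - l) q * P else 0)"
proof -
  obtain N where N: "\<And>M. M \<ge> N \<Longrightarrow> q = (\<Sum>m\<le>M. hom_part m q)" using sum_hom_part by blast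
  \<comment> \<open>Adding \<open>k\<close> ensures that the index \<open>k - l\<close> lies in the
    range of the sum.\<close>
  define M where "M = N + k"
  have "hom_part k (q * P) = hom_part k ((\<Sum>m\<le>M. hom_part m q) * P)"
    using N[of M] by (simp add: M_def)
  also have "\<dots> = (\<Sum>m\<le>M. hom_part k (hom_part m q * P))"
    by (simp add: sum_distrib_right hom_part_sum)
  also have "\<dots> = (\<Sum>m\<le>M. if l \<le> k \<and> m = k - l then hom_part (k - l) q * P else 0)"
  proof (rule sum.cong)
    fix m
    have gr: "hom_part m q * P \<in> graded_part (int (m + l))"
      using graded_part_mult[OF hom_part_graded assms] by simp
    show "hom_part k (hom_part m q * P) = (if l \<le> k \<and> m = k - l then hom_part (k - l) q * P else 0)"
      unfolding hom_part_of_graded[OF gr] by auto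
  qed simp
  also have "\<dots> = (if l \<le> k then hom_part (k - l) q * P else 0)"
    by (auto simp: M_def)
  finally show ?thesis .
qed

section \<open>Graded resolutions versus families of syzygies over \<open>k[t]\<close>\<close>

definition dehom :: "(nat \<Rightarrow> 'a::field poly poly) \<Rightarrow> nat \<Rightarrow> 'a poly" where
  "dehom a j = poly (a j) 1"

lemma poly_comb: "poly (comb d a b) 1 = dot d (dehom b) (dehom a)"
  by (simp add: comb_def dot_def dehom_def poly_sum)

lemma tuplesD: "a \<in> tuples n d \<Longrightarrow> j \<le> d \<Longrightarrow> a j \<in> graded_part (int n)"
  by (simp add: tuples_def)

text \<open>The rows are the images of the standard basis vectors under \<open>\<phi>\<close>, taken
  at \<open>s = 1\<close>. A relation among them over \<open>k[t]\<close> is homogenised to an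
  element of the kernel of \<open>\<phi>\<close>, which is zero by injectivity.\<close>

lemma has_mu_type_imp_family:
  assumes a: "a \<in> tuples n d" and type: "has_mu_type n d a \<mu>"
  obtains p where "syz_family d (dehom a) (\<lambda>i. \<mu> ! i) p"
proof -
  let ?es = "map (\<lambda>m. int n + int m) \<mu>" and ?fs = "replicate (d + 1) (int n)"
  have fs: "(int n # replicate d (int n)) ! j = int n" if "j < Suc d" for j
    using nth_replicate[of j "Suc d" "int n"] that by simp
  have len: "length \<mu> = d" using type by (simp add: has_mu_type_def partition_d_def)
  obtain \<phi> where \<phi>: "graded_hom ?es ?fs \<phi>" "inj_on \<phi> (free_mod d)"
    "\<phi> ` free_mod d = {b \<in> free_mod (d + 1). comb d a b = 0}"
    using type by (auto simp: has_mu_type_def)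
  have add: "\<phi> (\<lambda>i. b i + c i) = (\<lambda>j. \<phi> b j + \<phi> c j)" if "b \<in> free_mod d" "c \<in> free_mod d" for b c
    using \<phi>(1) that len by (simp add: graded_hom_def)
  have scale: "\<phi> (\<lambda>i. r * c i) = (\<lambda>j. r * \<phi> c j)" if "c \<in> free_mod d" for c r
    using \<phi>(1) that len by (simp add: graded_hom_def)
  have gr: "\<phi> c \<in> free_part ?fs k" if "c \<in> free_part ?es k" for c k
    using \<phi>(1) that unfolding graded_hom_def by blast
  define e :: "nat \<Rightarrow> nat \<Rightarrow> 'a poly poly" where "e i = (\<lambda>k. if k = i then 1 else 0)" for i
  have e: "e i \<in> free_mod d" if "i < d" for i using that by (simp add: free_mod_def e_def)
  have one: "(1 :: 'a poly poly) \<in> graded_part 0"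
    by (auto simp: graded_part_def one_pCons coeff_pCons split: nat.splits)
  have "e i \<in> free_part ?es (int n + int (\<mu> ! i))" if "i < d" for i
    using that e[OF that] one by (auto simp: free_part_def len e_def)
  then have eg: "\<phi> (e i) j \<in> graded_part (int (\<mu> ! i))" if "i < d" "j \<le> d" for i j
    using gr[of "e i" "int n + int (\<mu> ! i)"] that by (auto simp: free_part_def fs)
  have e0: "comb d a (\<phi> (e i)) = 0" if "i < d" for i using \<phi>(3) e[OF that] by blast
  have zero: "(\<lambda>i. 0) \<in> (free_mod d :: (nat \<Rightarrow> 'a poly poly) set)" by (simp add: free_mod_def)
  have \<phi>0: "\<phi> (\<lambda>i. 0) = (\<lambda>j. 0)" using scale[OF zero, of 0] by simp
  have lin: "\<phi> (\<lambda>i. if i < m then R i else 0) = (\<lambda>j. \<Sum>i<m. R i * \<phi> (e i) j)" if "m \<le> d" for R m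
    using that
  proof (induction m)
    case 0
    then show ?case by (simp add: \<phi>0)
  next
    case (Suc m)
    have "(\<lambda>i. if i < Suc m then R i else 0) = (\<lambda>i. (if i < m then R i else 0) + R m * e m i)"
      by (auto simp: e_def fun_eq_iff less_Suc_eq)
    moreover have "(\<lambda>i. if i < m then R i else 0) \<in> free_mod d" "(\<lambda>i. R m * e m i) \<in> free_mod d"
      using Suc.prems by (auto simp: free_mod_def e_def)
    ultimately have "\<phi> (\<lambda>i. if i < Suc m then R i else 0)
      = (\<lambda>j. \<phi> (\<lambda>i. if i < m then R i else 0) j + \<phi> (\<lambda>i. R m * e m i) j)"
      using add by simp
    also have "\<phi> (\<lambda>i. R m * e m i) = (\<lambda>j. R m * \<phi> (e m) j)"
      using Suc.prems by (intro scale e) simp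
    finally show ?case using Suc by simp
  qed
  define p where "p i = dehom (\<phi> (e i))" for i
  have "lin_indep_rows d p"
    unfolding lin_indep_rows_def
  proof (intro allI impI)
    fix r i assume r: "\<forall>j\<le>d. (\<Sum>i<d. r i * p i j) = 0" and i: "i < d"
    \<comment> \<open>A common degree, so large that no \<open>r i\<close> loses terms when
      homogenised in degree \<open>K - \<mu> ! i\<close>.\<close>
    define K where "K = (\<Sum>i<d. \<mu> ! i + degree (r i))"
    have K: "\<mu> ! i + degree (r i) \<le> K" if "i < d" for i
      unfolding K_def by (rule member_le_sum[of i "{..<d}" "\<lambda>i. \<mu> ! i + degree (r i)"]) (use that in auto)
    define R where "R i = homog (K - \<mu> ! i) (r i)" for i
    have R: "poly (R i) 1 = r i" if "i < d" for i
      using K[OF that] by (simp add: R_def dehom_homog)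
    have "(\<Sum>i<d. R i * \<phi> (e i) j) = 0" if "j \<le> d" for j
    proof (rule graded_zeroI)
      show "(\<Sum>i<d. R i * \<phi> (e i) j) \<in> graded_part (int K)"
      proof (rule graded_part_sum)
        fix i assume i: "i \<in> {..<d}"
        have "R i * \<phi> (e i) j \<in> graded_part (int (K - \<mu> ! i) + int (\<mu> ! i))"
          unfolding R_def using i that by (intro graded_part_mult homog_graded eg) auto
        then show "R i * \<phi> (e i) j \<in> graded_part (int K)" using K[of i] i by simp
      qed
      show "poly (\<Sum>i<d. R i * \<phi> (e i) j) 1 = 0"
        using r that R by (simp add: poly_sum p_def dehom_def)
    qed
    note sum0 = this
    let ?R = "\<lambda>i. if i < d then R i else 0"
    have R_free: "?R \<in> free_mod d" by (simp add: free_mod_def)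
    have \<phi>R: "\<phi> ?R = (\<lambda>j. \<Sum>i<d. R i * \<phi> (e i) j)" by (rule lin[OF order_refl])
    have "\<phi> ?R \<in> free_mod (d + 1)" using \<phi>(3) R_free by blast
    then have "\<phi> ?R j = 0" if "j > d" for j using that by (simp add: free_mod_def)
    moreover have "\<phi> ?R j = 0" if "j \<le> d" for j using sum0[OF that] by (simp only: \<phi>R)
    ultimately have "\<phi> ?R j = 0" for j by (cases "j \<le> d") auto
    then have "\<phi> ?R = \<phi> (\<lambda>i. 0)" by (simp only: \<phi>0) (rule ext)
    then have "?R = (\<lambda>i. 0)" by (rule inj_onD[OF \<phi>(2) _ R_free zero])
    from fun_cong[OF this, of i] have "R i = 0" using i by simp
    then show "r i = 0" using R[OF i] by simp
  qed
  moreover have "degree (p i j) \<le> \<mu> ! i" if "i < d" "j \<le> d" for i j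
    using degree_dehom[OF eg[OF that]] by (simp add: p_def dehom_def)
  moreover have "dot d (p i) (dehom a) = 0" if "i < d" for i
    using e0[OF that] poly_comb[of d a "\<phi> (e i)"] by (simp add: p_def)
  ultimately have "syz_family d (dehom a) (\<lambda>i. \<mu> ! i) p" by (simp add: syz_family_def)
  then show thesis by (rule that)
qed

text \<open>The map is given by the matrix of homogenised rows. Injectivity and exactness are
  checked on homogeneous components, where \<open>s = 1\<close> loses nothing. The degree bounds of
  \<open>syzygy_generation\<close> are what allow the coefficients to be homogenised in the degrees
  \<open>m - \<mu> ! i\<close>.\<close>

lemma family_imp_has_mu_type:
  assumes a: "a \<in> tuples n d" and un: "unimodular n d (dehom a)"
    and fam: "syz_family d (dehom a) (\<lambda>i. \<mu> ! i) p" and part: "partition_of n d \<mu>"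
  shows "has_mu_type n d a \<mu>"
proof -
  let ?es = "map (\<lambda>m. int n + int m) \<mu>" and ?fs = "replicate (d + 1) (int n)"
  have fs: "(int n # replicate d (int n)) ! j = int n" if "j < Suc d" for j
    using nth_replicate[of j "Suc d" "int n"] that by simp
  have len: "length \<mu> = d" and sum: "(\<Sum>i<d. \<mu> ! i) = n"
    using part by (auto simp: partition_of_def partition_d_def sum_list_sum_nth atLeast0LessThan)
  define P where "P i j = homog (\<mu> ! i) (p i j)" for i j
  define \<phi> where "\<phi> c j = (if j \<le> d then \<Sum>i<d. c i * P i j else 0)" for c j
  have P: "P i j \<in> graded_part (int (\<mu> ! i))" for i j by (simp add: P_def homog_graded)
  have dP: "poly (P i j) 1 = p i j" if "i < d" "j \<le> d" for i j
    using fam that by (simp add: P_def dehom_homog syz_family_def)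
  have li: "lin_indep_rows d p" using fam by (simp add: syz_family_def)
  have hom: "graded_hom ?es ?fs \<phi>"
    unfolding graded_hom_def
  proof (intro conjI ballI allI)
    show "\<phi> ` free_mod (length ?es) \<subseteq> free_mod (length ?fs)"
      by (auto simp: free_mod_def \<phi>_def)
  next
    fix b c :: "nat \<Rightarrow> 'a poly poly"
    show "\<phi> (\<lambda>i. b i + c i) = (\<lambda>j. \<phi> b j + \<phi> c j)"
      by (auto simp: \<phi>_def fun_eq_iff algebra_simps sum.distrib)
  next
    fix r and c :: "nat \<Rightarrow> 'a poly poly"
    show "\<phi> (\<lambda>i. r * c i) = (\<lambda>j. r * \<phi> c j)"
      by (auto simp: \<phi>_def fun_eq_iff sum_distrib_left mult.assoc)
  next
    fix k
    show "\<phi> ` free_part ?es k \<subseteq> free_part ?fs k"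
    proof
      fix y assume "y \<in> \<phi> ` free_part ?es k"
      then obtain c where c: "y = \<phi> c" "c \<in> free_part ?es k" by blast
      have "c i * P i j \<in> graded_part (k - int n)" if "i < d" for i j
      proof -
        have "c i \<in> graded_part (k - (int n + int (\<mu> ! i)))"
          using c(2) that by (simp add: free_part_def len)
        from graded_part_mult[OF this P[of i j]] show ?thesis by (simp add: algebra_simps)
      qed
      then have "\<phi> c j \<in> graded_part (k - int n)" for j
        by (auto simp: \<phi>_def intro!: graded_part_sum)
      then show "y \<in> free_part ?fs k"
        by (simp add: c(1) free_part_def fs) (simp add: free_mod_def \<phi>_def)
    qed
  qed
  have inj: "inj_on \<phi> (free_mod d)"
  proof (rule inj_onI)
    fix b c assume bc: "b \<in> free_mod d" "c \<in> free_mod d" "\<phi> b = \<phi> c"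
    define e where "e i = b i - c i" for i
    have e: "(\<Sum>i<d. e i * P i j) = 0" if "j \<le> d" for j
      using fun_cong[OF bc(3), of j] that by (simp add: \<phi>_def e_def algebra_simps sum_subtractf)
    have "hom_part k (e i) = 0" if i: "i < d" for i k
    proof -
      \<comment> \<open>Chosen so that the component of degree \<open>K\<close> of the relation
        contains the degree \<open>k\<close> part of this \<open>e i\<close>. Rows of degree above
        \<open>K\<close> contribute nothing to it, hence the case distinction in
        \<open>r\<close>.\<close>
      define K where "K = k + \<mu> ! i"
      define r where "r i = (if \<mu> ! i \<le> K then poly (hom_part (K - \<mu> ! i) (e i)) 1 else 0)" for i
      have "(\<Sum>i<d. r i * p i j) = 0" if "j \<le> d" for j
      proof -
        have "(\<Sum>i<d. r i * p i j) = (\<Sum>i<d. poly (hom_part K (e i * P i j)) 1)"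
          using that by (intro sum.cong) (auto simp: hom_part_mult[OF P] r_def dP)
        also have "\<dots> = poly (hom_part K (\<Sum>i<d. e i * P i j)) 1"
          by (simp add: hom_part_sum poly_sum)
        finally show ?thesis using e[OF that] by simp
      qed
      then have "r i = 0" using lin_indep_rowsD[OF li] i by blast
      then show ?thesis by (intro graded_zeroI[OF hom_part_graded]) (simp add: r_def K_def)
    qed
    note part0 = this
    have e0: "e i = 0" if "i < d" for i
    proof -
      obtain N where "\<forall>M\<ge>N. e i = (\<Sum>k\<le>M. hom_part k (e i))" using sum_hom_part by blast
      then have "e i = (\<Sum>k\<le>N. hom_part k (e i))" by blast
      then show ?thesis by (simp add: part0[OF that])
    qed
    show "b = c"
    proof
      fix i
      show "b i = c i" using bc(1,2) e0[of i] by (cases "i < d") (auto simp: e_def free_mod_def)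
    qed
  qed
  have PA: "(\<Sum>j\<le>d. P i j * a j) = 0" if "i < d" for i
  proof (rule graded_zeroI)
    show "(\<Sum>j\<le>d. P i j * a j) \<in> graded_part (int (\<mu> ! i + n))"
      using graded_part_mult[OF P tuplesD[OF a]] by (intro graded_part_sum) simp
    have "poly (\<Sum>j\<le>d. P i j * a j) 1 = dot d (p i) (dehom a)"
      using that by (simp add: poly_sum dot_def dehom_def dP)
    then show "poly (\<Sum>j\<le>d. P i j * a j) 1 = 0"
      using fam that by (simp add: syz_family_def)
  qed
  have im: "\<phi> ` free_mod d = {b \<in> free_mod (d + 1). comb d a b = 0}"
  proof (intro equalityI subsetI)
    fix b assume "b \<in> \<phi> ` free_mod d"
    then obtain c where c: "b = \<phi> c" by blast
    have "comb d a b = (\<Sum>j\<le>d. \<Sum>i<d. c i * (P i j * a j))"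
      by (simp add: comb_def c \<phi>_def sum_distrib_right mult.assoc)
    also have "\<dots> = (\<Sum>i<d. c i * (\<Sum>j\<le>d. P i j * a j))"
      by (subst sum.swap) (simp add: sum_distrib_left)
    also have "\<dots> = 0" by (simp add: PA)
    finally show "b \<in> {b \<in> free_mod (d + 1). comb d a b = 0}"
      by (simp add: c free_mod_def \<phi>_def)
  next
    fix b assume "b \<in> {b \<in> free_mod (d + 1). comb d a b = 0}"
    then have b: "b \<in> free_mod (d + 1)" "(\<Sum>j\<le>d. b j * a j) = 0" by (auto simp: comb_def)
    have "\<exists>r. (\<forall>j\<le>d. poly (hom_part m (b j)) 1 = (\<Sum>i<d. r i * p i j)) \<and>
        (\<forall>i<d. r i \<noteq> 0 \<longrightarrow> degree (r i) + \<mu> ! i \<le> m)" for m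
    proof -
      have "(\<Sum>j\<le>d. hom_part m (b j) * a j) = hom_part (m + n) (\<Sum>j\<le>d. b j * a j)"
        by (simp add: hom_part_sum hom_part_mult[OF tuplesD[OF a]])
      then have "poly (\<Sum>j\<le>d. hom_part m (b j) * a j) 1 = 0" by (simp add: b(2))
      then have "dot d (\<lambda>j. poly (hom_part m (b j)) 1) (dehom a) = 0"
        by (simp add: poly_sum dot_def dehom_def)
      note dp = this
      have dg: "degree (poly (hom_part m (b j)) 1) \<le> m" for j by (rule degree_dehom[OF hom_part_graded])
      from syzygy_generation[OF un fam sum dp dg]
      obtain r where "\<And>j. j \<le> d \<Longrightarrow> poly (hom_part m (b j)) 1 = (\<Sum>i<d. r i * p i j)"
        "\<And>i. i < d \<Longrightarrow> r i \<noteq> 0 \<Longrightarrow> degree (r i) + \<mu> ! i \<le> m" by blast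
      then show ?thesis by blast
    qed
    then have "\<forall>m. \<exists>r. (\<forall>j\<le>d. poly (hom_part m (b j)) 1 = (\<Sum>i<d. r i * p i j)) \<and>
        (\<forall>i<d. r i \<noteq> 0 \<longrightarrow> degree (r i) + \<mu> ! i \<le> m)" by blast
    from choice[OF this] obtain r where
      r: "\<And>m j. j \<le> d \<Longrightarrow> poly (hom_part m (b j)) 1 = (\<Sum>i<d. r m i * p i j)"
      "\<And>m i. i < d \<Longrightarrow> r m i \<noteq> 0 \<Longrightarrow> degree (r m i) + \<mu> ! i \<le> m" by blast
    define R where "R m i = (if \<mu> ! i \<le> m then homog (m - \<mu> ! i) (r m i) else 0)" for m i
    have R: "(\<Sum>i<d. R m i * P i j) = hom_part m (b j)" if "j \<le> d" for m j
    proof (rule graded_eqI[OF _ hom_part_graded])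
      show "(\<Sum>i<d. R m i * P i j) \<in> graded_part (int m)"
      proof (rule graded_part_sum)
        fix i
        show "R m i * P i j \<in> graded_part (int m)"
          using graded_part_mult[OF homog_graded[of "m - \<mu> ! i" "r m i"] P[of i j]] by (auto simp: R_def)
      qed
      have "poly (R m i) 1 = r m i" if "i < d" for i
        using r(2)[of i m] that by (cases "r m i = 0") (auto simp: R_def dehom_homog)
      then show "poly (\<Sum>i<d. R m i * P i j) 1 = poly (hom_part m (b j)) 1"
        using that by (simp add: poly_sum r(1) dP)
    qed
    \<comment> \<open>One bound for all entries, so that the coefficients found in each degree can
      be added up to a single preimage.\<close>
    have "\<exists>N. \<forall>j\<le>d. b j = (\<Sum>m\<le>N. hom_part m (b j))"
    proof -
      have "\<forall>j. \<exists>N. \<forall>M\<ge>N. b j = (\<Sum>m\<le>M. hom_part m (b j))" using sum_hom_part by blast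
      from choice[OF this] obtain N where N: "\<And>j M. M \<ge> N j \<Longrightarrow> b j = (\<Sum>m\<le>M. hom_part m (b j))"
        by blast
      have "N j \<le> (\<Sum>j\<le>d. N j)" if "j \<le> d" for j by (rule member_le_sum) (use that in auto)
      then show ?thesis using N by blast
    qed
    then obtain N where N: "\<And>j. j \<le> d \<Longrightarrow> b j = (\<Sum>m\<le>N. hom_part m (b j))" by blast
    define c where "c i = (if i < d then \<Sum>m\<le>N. R m i else 0)" for i
    have "\<phi> c j = b j" for j
    proof (cases "j \<le> d")
      case True
      have "\<phi> c j = (\<Sum>i<d. \<Sum>m\<le>N. R m i * P i j)"
        using True by (simp add: \<phi>_def c_def sum_distrib_right)
      also have "\<dots> = (\<Sum>m\<le>N. hom_part m (b j))"
        by (subst sum.swap) (simp add: R[OF True])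
      finally show ?thesis using N[OF True] by simp
    qed (use b(1) in \<open>simp add: \<phi>_def free_mod_def\<close>)
    then have "b = \<phi> c" by (intro ext) simp
    moreover have "c \<in> free_mod d" by (simp add: c_def free_mod_def)
    ultimately show "b \<in> \<phi> ` free_mod d" by (rule image_eqI)
  qed
  show ?thesis
    unfolding has_mu_type_def using part hom inj im gen_ideal_eq[of d a]
    by (auto simp: partition_of_def)
qed

section \<open>Coprimality and polynomial functions\<close>

text \<open>As \<open>p\<close> has nonzero constant term, the cofactor has constant term zero for
  positive exponent, and one factor of the variable can be cancelled.\<close>

lemma is_unit_if_dvd_monom:
  fixes p :: "'b::idom poly"
  assumes "p dvd monom 1 N" "coeff p 0 \<noteq> 0"
  shows "p dvd 1"
  using assms(1)
proof (induction N)
  case (Suc N)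
  then obtain q where q: "monom 1 (Suc N) = p * q" by (auto simp: dvd_def)
  have "coeff p 0 * coeff q 0 = coeff (monom 1 (Suc N)) 0" by (simp add: q coeff_mult)
  then have "coeff q 0 = 0" using assms(2) by simp
  then obtain q' where q': "q = pCons 0 q'" by (cases q) auto
  have "pCons 0 (monom 1 N) = pCons 0 (p * q')" using q by (simp add: q' monom_Suc)
  then show ?case using Suc.IH by simp
qed (simp add: one_pCons monom_0)

lemma coeff_dehom_tuple:
  assumes "a \<in> tuples n d" "j \<le> d"
  shows "coeff (dehom a j) l = (if l \<le> n then coeff (coeff (a j) (n - l)) l else 0)"
  using coeff_dehom_graded[OF tuplesD[OF assms]] by (simp add: dehom_def)

lemma degree_dehom_tuple: "a \<in> tuples n d \<Longrightarrow> j \<le> d \<Longrightarrow> degree (dehom a j) \<le> n"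
  by (simp add: dehom_def degree_dehom tuplesD)

text \<open>If all coefficients of \<open>t^n\<close> vanished, \<open>s\<close> would divide every
  entry. For the Bezout identity, a generator of the ideal of the dehomogenised entries is
  homogenised to a common divisor of the tuple, hence is a unit.\<close>

lemma unimodular_if_rel_prime:
  assumes a: "a \<in> tuples n d" and rp: "rel_prime d a"
  shows "unimodular n d (dehom a)"
proof -
  let ?A = "dehom a"
  have top: "\<exists>j\<le>d. coeff (?A j) n \<noteq> 0"
  proof (rule ccontr)
    assume "\<not> (\<exists>j\<le>d. coeff (?A j) n \<noteq> 0)"
    then have *: "coeff (coeff (a j) 0) n = 0" if "j \<le> d" for j
      using that coeff_dehom_tuple[OF a that, of n] by simp
    have "[:0, 1:] dvd a j" if "j \<le> d" for j
    proof -
      have "coeff (a j) 0 = 0"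
      proof (rule poly_eqI)
        fix l
        show "coeff (coeff (a j) 0) l = coeff 0 l"
          using *[OF that] graded_partD[OF tuplesD[OF a that], of 0 l]
          by (cases "coeff (coeff (a j) 0) l = 0") auto
      qed
      then show ?thesis using poly_eq_0_iff_dvd[of "a j" 0] by (simp add: poly_0_coeff_0)
    qed
    then have "[:0, 1:] dvd (1 :: 'a poly poly)" using rp by (auto simp: rel_prime_def)
    then obtain q :: "'a poly poly" where "1 = [:0, 1:] * q" by (auto simp: dvd_def)
    from arg_cong[OF this, of "\<lambda>p. poly p 0"] show False by simp
  qed
  \<comment> \<open>The nonzero elements of the ideal generated by the entries; one of least degree
    divides all entries by division with remainder.\<close>
  define Q where "Q g \<longleftrightarrow> g \<noteq> 0 \<and> (\<exists>u. dot d u ?A = g)" for g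
  obtain j0 where j0: "j0 \<le> d" "?A j0 \<noteq> 0" using top by (metis coeff_0)
  have "Q (?A j0)" unfolding Q_def using j0 dot_unit[OF j0(1), of ?A] by blast
  then obtain g where g: "Q g" "\<And>h. Q h \<Longrightarrow> degree g \<le> degree h"
    using ex_has_least_nat[of Q _ degree] by blast
  then obtain u where u: "dot d u ?A = g" and g0: "g \<noteq> 0" by (auto simp: Q_def)
  have gA: "g dvd ?A j" if j: "j \<le> d" for j
  proof (rule ccontr)
    assume "\<not> g dvd ?A j"
    then have nz: "?A j mod g \<noteq> 0" by (simp add: mod_eq_0_iff_dvd)
    have "dot d (\<lambda>i. 1 * unit_vec_fun j i + (- (?A j div g)) * u i) ?A = ?A j mod g"
      unfolding dot_linear dot_unit[OF j] u using minus_div_mult_eq_mod[of "?A j" g] by simp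
    then have "Q (?A j mod g)" unfolding Q_def using nz by blast
    from g(2)[OF this] show False using degree_mod_less'[OF g0 nz] by simp
  qed
  define G where "G = homog (degree g) g"
  have "G dvd a j" if j: "j \<le> d" for j
  proof (cases "?A j = 0")
    case True
    then have "a j = 0" using graded_zeroI[OF tuplesD[OF a j]] by (simp add: dehom_def)
    then show ?thesis by simp
  next
    case False
    obtain h where h: "?A j = g * h" using gA[OF j] by (auto simp: dvd_def)
    have "degree g + degree h \<le> n"
      using degree_dehom_tuple[OF a j] False g0 by (auto simp: h degree_mult_eq)
    moreover from this have "G * homog (n - degree g) h \<in> graded_part (int n)"
      using graded_part_mult[OF homog_graded[of "degree g" g] homog_graded[of "n - degree g" h]]
      by (simp add: G_def)
    ultimately have "a j = G * homog (n - degree g) h"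
      using h by (intro graded_eqI[OF tuplesD[OF a j]]) (auto simp: G_def dehom_homog dehom_def)
    then show ?thesis by simp
  qed
  then have "G dvd 1" using rp by (auto simp: rel_prime_def)
  then obtain H where "1 = G * H" by (auto simp: dvd_def)
  from arg_cong[OF this, of "\<lambda>p. poly p 1"] have gH: "poly H 1 * g = 1"
    by (simp add: G_def dehom_homog mult.commute)
  have "dot d (\<lambda>i. poly H 1 * u i + 0 * u i) ?A = 1" unfolding dot_linear u using gH by simp
  then show ?thesis
    unfolding unimodular_def using top degree_dehom_tuple[OF a] by blast
qed

text \<open>Homogenising the Bezout identity puts a power of \<open>s\<close> into the ideal, so a
  common divisor \<open>p\<close> divides that power. A nonzero coefficient of \<open>t^n\<close>
  gives \<open>p\<close> a nonzero constant term in \<open>s\<close>, which makes it a unit.\<close>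

lemma rel_prime_if_unimodular:
  assumes a: "a \<in> tuples n d" and un: "unimodular n d (dehom a)"
  shows "rel_prime d a"
  unfolding rel_prime_def
proof (intro allI impI)
  fix p assume p: "\<forall>j\<le>d. p dvd a j"
  obtain u where u: "dot d u (dehom a) = 1" using un by (auto simp: unimodular_def)
  obtain j0 where j0: "j0 \<le> d" "coeff (dehom a j0) n \<noteq> 0" using un by (auto simp: unimodular_def)
  define M where "M = (\<Sum>j\<le>d. degree (u j))"
  have M: "degree (u j) \<le> M" if "j \<le> d" for j
    unfolding M_def by (rule member_le_sum[of j "{..d}" "\<lambda>j. degree (u j)"]) (use that in auto)
  have "(\<Sum>j\<le>d. homog M (u j) * a j) = monom 1 (M + n)"
  proof (rule graded_eqI)
    show "(\<Sum>j\<le>d. homog M (u j) * a j) \<in> graded_part (int (M + n))"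
      using graded_part_mult[OF homog_graded tuplesD[OF a]] by (intro graded_part_sum) simp
    show "monom 1 (M + n) \<in> graded_part (int (M + n))"
      by (auto simp: graded_part_def coeff_monom one_pCons coeff_pCons split: nat.splits if_splits)
    have "poly (\<Sum>j\<le>d. homog M (u j) * a j) 1 = dot d u (dehom a)"
      by (simp add: poly_sum dot_def dehom_def dehom_homog M)
    then show "poly (\<Sum>j\<le>d. homog M (u j) * a j) 1 = poly (monom 1 (M + n)) 1"
      by (simp add: u poly_monom)
  qed
  moreover have "p dvd (\<Sum>j\<le>d. homog M (u j) * a j)"
    using p by (intro dvd_sum dvd_mult) auto
  ultimately have "p dvd monom 1 (M + n)" by simp
  moreover have "coeff p 0 \<noteq> 0"
  proof
    assume "coeff p 0 = 0"
    moreover obtain q where "a j0 = p * q" using p j0(1) by (auto simp: dvd_def)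
    ultimately have "coeff (a j0) 0 = 0" by (simp add: coeff_mult)
    then show False using j0 coeff_dehom_tuple[OF a j0(1), of n] by simp
  qed
  ultimately show "p dvd 1" by (rule is_unit_if_dvd_monom)
qed

lemma lin_indep_iff:
  assumes a: "a \<in> tuples n d"
  shows "lin_indep d a \<longleftrightarrow> (\<forall>c. dot d (\<lambda>j. [:c j:]) (dehom a) = 0 \<longrightarrow> (\<forall>j\<le>d. c j = 0))"
proof -
  have "(\<Sum>j\<le>d. Polynomial.smult [:c j:] (a j)) = 0 \<longleftrightarrow> dot d (\<lambda>j. [:c j:]) (dehom a) = 0" for c
  proof -
    have eq: "poly (\<Sum>j\<le>d. Polynomial.smult [:c j:] (a j)) 1 = dot d (\<lambda>j. [:c j:]) (dehom a)"
      by (simp add: poly_sum dot_def dehom_def)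
    have "(\<Sum>j\<le>d. Polynomial.smult [:c j:] (a j)) \<in> graded_part (int n)"
    proof (rule graded_part_sum)
      fix j assume "j \<in> {..d}"
      then show "Polynomial.smult [:c j:] (a j) \<in> graded_part (int n)"
        using tuplesD[OF a, of j] by (auto simp: graded_part_def)
    qed
    from graded_zeroI[OF this] show ?thesis using eq by auto
  qed
  then show ?thesis by (simp add: lin_indep_def)
qed

text \<open>A linear relation over the field is a syzygy of degree \<open>0\<close>, and rows of
  positive degree generate none but zero.\<close>

lemma lin_indep_if_family:
  assumes a: "a \<in> tuples n d" and un: "unimodular n d (dehom a)"
    and fam: "syz_family d (dehom a) \<mu> p" and sum: "(\<Sum>i<d. \<mu> i) = n"
    and pos: "\<And>i. i < d \<Longrightarrow> 1 \<le> \<mu> i"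
  shows "lin_indep d a"
  unfolding lin_indep_iff[OF a]
proof (intro allI impI)
  fix c j assume c: "dot d (\<lambda>j. [:c j:]) (dehom a) = 0" and j: "j \<le> d"
  have dg: "degree [:c j:] \<le> 0" for j by simp
  from syzygy_generation[OF un fam sum c dg] obtain r where
    r: "\<And>j. j \<le> d \<Longrightarrow> [:c j:] = (\<Sum>i<d. r i * p i j)"
    "\<And>i. i < d \<Longrightarrow> r i \<noteq> 0 \<Longrightarrow> degree (r i) + \<mu> i \<le> 0" by blast
  have "r i = 0" if "i < d" for i using r(2)[OF that] pos[OF that] by auto
  then show "c j = 0" using r(1)[OF j] by simp
qed

text \<open>A row of degree \<open>0\<close> would be a nontrivial linear relation over the
  field.\<close>

lemma family_pos:
  assumes a: "a \<in> tuples n d" and li: "lin_indep d a"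
    and fam: "syz_family d (dehom a) \<mu> p" and i: "i < d"
  shows "1 \<le> \<mu> i"
proof (rule ccontr)
  assume "\<not> 1 \<le> \<mu> i"
  then have "degree (p i j) = 0" if "j \<le> d" for j using fam i that by (force simp: syz_family_def)
  then have p: "p i j = [:coeff (p i j) 0:]" if "j \<le> d" for j
    using that degree_eq_zeroE[of "p i j"] by (metis coeff_pCons_0)
  have "dot d (\<lambda>j. [:coeff (p i j) 0:]) (dehom a) = dot d (p i) (dehom a)"
    using p by (intro dot_cong) simp
  then have "dot d (\<lambda>j. [:coeff (p i j) 0:]) (dehom a) = 0"
    using fam i by (simp add: syz_family_def)
  moreover have "\<forall>c. dot d (\<lambda>j. [:c j:]) (dehom a) = 0 \<longrightarrow> (\<forall>j\<le>d. c j = 0)"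
    using li lin_indep_iff[OF a] by blast
  from spec[OF this, of "\<lambda>j. coeff (p i j) 0"]
  have "dot d (\<lambda>j. [:coeff (p i j) 0:]) (dehom a) = 0 \<longrightarrow> (\<forall>j\<le>d. coeff (p i j) 0 = 0)" .
  ultimately have "\<forall>j\<le>d. coeff (p i j) 0 = 0" by blast
  then have z: "p i j = 0" if "j \<le> d" for j
    using p[OF that] that by (metis pCons_0_0)
  have "(\<Sum>k<d. unit_vec_fun i k * p k j) = 0" if "j \<le> d" for j
    using z[OF that] by (intro sum.neutral) (auto simp: unit_vec_fun_def)
  then have "unit_vec_fun i i = (0 :: 'a poly)"
    using lin_indep_rowsD[of d p "unit_vec_fun i" i] fam i by (auto simp: syz_family_def)
  then show False by (simp add: unit_vec_fun_def)
qed

section \<open>Polynomial functions and openness of coprimality\<close>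

lemma poly_funs_sum:
  "(\<And>i. i \<in> S \<Longrightarrow> f i \<in> poly_funs n d) \<Longrightarrow> (\<lambda>a. \<Sum>i\<in>S. f i a) \<in> poly_funs n d"
  by (induction S rule: infinite_finite_induct) (auto intro: poly_funs.intros)

lemma poly_funs_prod:
  "(\<And>i. i \<in> S \<Longrightarrow> f i \<in> poly_funs n d) \<Longrightarrow> (\<lambda>a. \<Prod>i\<in>S. f i a) \<in> poly_funs n d"
  by (induction S rule: infinite_finite_induct) (auto intro: poly_funs.intros)

lemma poly_funs_rdet:
  assumes "\<And>i j. i < N \<Longrightarrow> j < N \<Longrightarrow> (\<lambda>a. E a i j) \<in> poly_funs n d"
  shows "(\<lambda>a. rdet N (E a)) \<in> poly_funs n d"
  unfolding rdet_leibniz using assms permutes_in_image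
  by (intro poly_funs_sum poly_funs.mult poly_funs.const poly_funs_prod) fastforce

lemma poly_funs_coeff:
  assumes "j \<le> d" "l \<le> n"
  shows "(\<lambda>a. coeff (coeff (a j) (n - l)) l) \<in> poly_funs n d"
  using poly_funs.coord[of j d "n - l" n] assms by simp

lemma rdet_one: "rdet N (\<lambda>i j. if i = j then 1 else 0) = (1 :: 'a::comm_ring_1)"
proof -
  have "mat N N (\<lambda>(i, j). if i = j then 1 else 0) = (1\<^sub>m N :: 'a::comm_ring_1 mat)"
    by (auto simp: one_mat_def)
  then have "rdet N (\<lambda>i j. if i = j then 1 else 0) = det (1\<^sub>m N :: 'a mat)"
    by (simp only: rdet_def)
  then show ?thesis by simp
qed

text \<open>Division by an entry \<open>A l\<close> of degree exactly \<open>n\<close> bounds all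
  coefficients except the \<open>l\<close>-th, into which the quotients are moved by Koszul
  relations. The bound \<open>2 * n\<close> on \<open>h\<close> then bounds the \<open>l\<close>-th
  as well, since \<open>G l * A l\<close> is \<open>h\<close> minus products of degree at most
  \<open>2 * n\<close>.\<close>

lemma unimodular_bounded_combination:
  fixes A :: "nat \<Rightarrow> 'a::field poly"
  assumes un: "unimodular n d A" and h: "degree h \<le> 2 * n"
  obtains G where "\<And>j. j \<le> d \<Longrightarrow> degree (G j) \<le> n" "dot d G A = h"
proof -
  obtain u where u: "dot d u A = 1" using un by (auto simp: unimodular_def)
  obtain l where l: "l \<le> d" "coeff (A l) n \<noteq> 0" using un by (auto simp: unimodular_def)
  have degA: "degree (A j) \<le> n" if "j \<le> d" for j using un that by (simp add: unimodular_def)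
  have Al: "A l \<noteq> 0" "degree (A l) = n" using l degA[OF l(1)] le_degree[OF l(2)] by auto
  define G where "G j = (if j = l then h * u l + (\<Sum>i\<in>{..d} - {l}. (h * u i) div A l * A i)
     else (h * u j) mod A l)" for j
  have split: "dot d f A = f l * A l + (\<Sum>i\<in>{..d} - {l}. f i * A i)" for f
    unfolding dot_def using l(1) by (subst sum.remove[of _ l]) auto
  have "(\<Sum>i\<in>{..d} - {l}. G i * A i) + (\<Sum>i\<in>{..d} - {l}. (h * u i) div A l * A i) * A l
      = (\<Sum>i\<in>{..d} - {l}. h * u i * A i)"
    unfolding sum_distrib_right sum.distrib[symmetric]
  proof (rule sum.cong)
    fix i assume i: "i \<in> {..d} - {l}"
    have "(h * u i) mod A l * A i + (h * u i) div A l * A i * A l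
      = ((h * u i) div A l * A l + (h * u i) mod A l) * A i" by (simp only: algebra_simps)
    then show "G i * A i + (h * u i) div A l * A i * A l = h * u i * A i"
      using i by (simp add: G_def)
  qed simp
  then have "dot d G A = dot d (\<lambda>j. h * u j + 0 * u j) A"
    unfolding split by (simp add: G_def algebra_simps)
  then have dG: "dot d G A = h" unfolding dot_linear by (simp add: u)
  have deg: "degree (G j) \<le> n" if "j \<noteq> l" for j
    using degree_mod_less[OF Al(1), of "h * u j"] that Al(2) by (auto simp: G_def)
  have "degree (\<Sum>i\<in>{..d} - {l}. G i * A i) \<le> 2 * n"
  proof (rule degree_sum_le)
    fix i assume "i \<in> {..d} - {l}"
    then show "degree (G i * A i) \<le> 2 * n"
      using deg[of i] degA[of i] degree_mult_le[of "G i" "A i"] by force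
  qed simp
  then have "degree (h - (\<Sum>i\<in>{..d} - {l}. G i * A i)) \<le> 2 * n"
    using h by (intro degree_diff_le)
  moreover have "G l * A l = h - (\<Sum>i\<in>{..d} - {l}. G i * A i)" using dG by (simp add: split eq_diff_eq)
  ultimately have "degree (G l * A l) \<le> 2 * n" by simp
  then have "degree (G l) \<le> n" using Al by (cases "G l = 0") (auto simp: degree_mult_eq)
  then show thesis using that[of G] deg dG by metis
qed

text \<open>Bounded combinations \<open>G_l\<close> of \<open>A\<close> equal to \<open>t^l\<close>, \<open>l \<le> 2 n\<close>, still span all polynomials of
  degree at most \<open>2 n\<close> when \<open>A\<close> is replaced by \<open>A'\<close>, provided the determinant \<open>F\<close> of their
  coefficients is nonzero.\<close>

lemma unimodular_open:
  assumes a: "a \<in> tuples n d" and un: "unimodular n d (dehom a)"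
  obtains F where "F \<in> poly_funs n d" "F a \<noteq> 0"
    "\<And>a'. a' \<in> tuples n d \<Longrightarrow> F a' \<noteq> 0 \<Longrightarrow> unimodular n d (dehom a')"
proof -
  \<comment> \<open>The dimension of the space of polynomials of degree at most
    \<open>2 * n\<close>.\<close>
  define N where "N = Suc (2 * n)"
  have "\<forall>l. \<exists>G. l < N \<longrightarrow> (\<forall>j\<le>d. degree (G j) \<le> n) \<and> dot d G (dehom a) = monom 1 l"
  proof
    fix l
    show "\<exists>G. l < N \<longrightarrow> (\<forall>j\<le>d. degree (G j) \<le> n) \<and> dot d G (dehom a) = monom 1 l"
    proof (cases "l < N")
      case True
      then have "degree (monom (1::'a) l) \<le> 2 * n" by (simp add: degree_monom_eq N_def)
      from unimodular_bounded_combination[OF un this] show ?thesis by metis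
    qed simp
  qed
  from choice[OF this] obtain G where
    G: "\<And>l j. l < N \<Longrightarrow> j \<le> d \<Longrightarrow> degree (G l j) \<le> n" "\<And>l. l < N \<Longrightarrow> dot d (G l) (dehom a) = monom 1 l"
    by blast
  define E :: "(nat \<Rightarrow> 'a poly poly) \<Rightarrow> nat \<Rightarrow> nat \<Rightarrow> 'a" where
    "E a' l k = (\<Sum>j\<le>d. \<Sum>i\<le>n. coeff (coeff (a' j) (n - i)) i * (if i \<le> k then coeff (G l j) (k - i) else 0))"
    for a' l k
  have E: "E a' l k = coeff (dot d (G l) (dehom a')) k" if a': "a' \<in> tuples n d" for a' l k
    unfolding dot_def coeff_sum E_def
  proof (rule sum.cong)
    fix j assume "j \<in> {..d}"
    then have j: "j \<le> d" by simp
    have "coeff (G l j * dehom a' j) k = (\<Sum>i\<le>k. coeff (dehom a' j) i * coeff (G l j) (k - i))"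
      by (subst mult.commute) (simp add: coeff_mult)
    also have "\<dots> = (\<Sum>i\<in>{..k} \<inter> {..n}. coeff (coeff (a' j) (n - i)) i * coeff (G l j) (k - i))"
      by (intro sum.mono_neutral_cong_right) (auto simp: coeff_dehom_tuple[OF a' j])
    also have "\<dots> = (\<Sum>i\<le>n. coeff (coeff (a' j) (n - i)) i * (if i \<le> k then coeff (G l j) (k - i) else 0))"
      by (intro sum.mono_neutral_cong_left) auto
    finally show "(\<Sum>i\<le>n. coeff (coeff (a' j) (n - i)) i * (if i \<le> k then coeff (G l j) (k - i) else 0))
      = coeff (G l j * dehom a' j) k" by simp
  qed simp
  define F where "F a' = rdet N (E a')" for a'
  have "F \<in> poly_funs n d"
    unfolding F_def E_def
    by (intro poly_funs_rdet poly_funs_sum poly_funs.mult poly_funs.const poly_funs_coeff) auto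
  moreover have "F a \<noteq> 0"
  proof -
    have "F a = rdet N (\<lambda>i j. if i = j then 1 else 0)"
      unfolding F_def by (intro rdet_cong) (auto simp: E[OF a] G(2))
    then show ?thesis by (simp add: rdet_one)
  qed
  moreover have "unimodular n d (dehom a')" if a': "a' \<in> tuples n d" and F: "F a' \<noteq> 0" for a'
  proof -
    have comb: "\<exists>z. (\<forall>j\<le>d. degree (z j) \<le> n) \<and> dot d z (dehom a') = h" if h: "degree h \<le> 2 * n" for h
    proof -
      obtain v where v: "\<And>k. k < N \<Longrightarrow> (\<Sum>l<N. v l * E a' l k) = F a' * coeff h k"
        using rdet_cramer[of N "E a'" "coeff h"] unfolding F_def by blast
      define z where "z j = (\<Sum>l<N. [:v l / F a':] * G l j)" for j
      have dz: "degree (z j) \<le> n" if "j \<le> d" for j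
        unfolding z_def using G(1)[OF _ that]
        by (intro degree_sum_le) (auto intro: order.trans[OF degree_smult_le])
      have "dot d z (dehom a') = h"
      proof (rule poly_eqI)
        fix k
        show "coeff (dot d z (dehom a')) k = coeff h k"
        proof (cases "k < N")
          case True
          have "coeff (dot d z (dehom a')) k = (\<Sum>l<N. v l * E a' l k) / F a'"
            unfolding z_def dot_sum by (simp add: coeff_sum E[OF a'] sum_divide_distrib)
          then show ?thesis using v[OF True] F by simp
        next
          case False
          have "degree (dot d z (dehom a')) \<le> 2 * n"
            unfolding dot_def
          proof (rule degree_sum_le)
            fix j assume "j \<in> {..d}"
            then show "degree (z j * dehom a' j) \<le> 2 * n"
              using dz[of j] degree_dehom_tuple[OF a', of j] degree_mult_le[of "z j" "dehom a' j"] by force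
          qed simp
          then show ?thesis using False h by (simp add: N_def coeff_eq_0)
        qed
      qed
      then show ?thesis using dz by blast
    qed
    have "\<exists>u. dot d u (dehom a') = 1" using comb[of 1] by auto
    moreover have "\<exists>j\<le>d. coeff (dehom a' j) n \<noteq> 0"
    proof (rule ccontr)
      \<comment> \<open>Then no combination with coefficients of degree at most \<open>n\<close>
        could have a term \<open>t^(2 n)\<close>.\<close>
      assume neg: "\<not> (\<exists>j\<le>d. coeff (dehom a' j) n \<noteq> 0)"
      obtain z where z: "\<And>j. j \<le> d \<Longrightarrow> degree (z j) \<le> n" "dot d z (dehom a') = monom 1 (2 * n)"
        using comb[of "monom 1 (2 * n)"] by (auto simp: degree_monom_eq)
      have "coeff (z j * dehom a' j) (n + n) = 0" if "j \<le> d" for j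
        using neg that by (simp add: coeff_mult_top[OF z(1)[OF that] degree_dehom_tuple[OF a' that]])
      then have "coeff (dot d z (dehom a')) (n + n) = 0" by (simp add: dot_def coeff_sum)
      then show False by (simp add: z(2))
    qed
    ultimately show ?thesis using degree_dehom_tuple[OF a'] by (simp add: unimodular_def)
  qed
  ultimately show thesis by (rule that)
qed

section \<open>Semicontinuity\<close>

lemma (in vector_space) independent_image_family:
  assumes I: "finite I" and c: "\<And>c. (\<Sum>i\<in>I. scale (c i) (w i)) = 0 \<Longrightarrow> \<forall>i\<in>I. c i = 0"
  shows "inj_on w I" "independent (w ` I)"
proof -
  show inj: "inj_on w I"
  proof (rule inj_onI, rule ccontr)
    fix i j assume ij: "i \<in> I" "j \<in> I" "w i = w j" "i \<noteq> j"
    define e where "e k = (if k = i then 1 else if k = j then - 1 else 0 :: 'a)" for k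
    have "(\<Sum>k\<in>I. scale (e k) (w k)) = (\<Sum>k\<in>{i, j}. scale (e k) (w k))"
      using ij I by (intro sum.mono_neutral_right) (auto simp: e_def)
    also have "\<dots> = 0" using ij by (simp add: e_def)
    finally have "e i = 0" using c ij(1) by blast
    then show False by (simp add: e_def)
  qed
  show "independent (w ` I)"
    unfolding dependent_finite[OF finite_imageI[OF I]]
  proof
    assume "\<exists>u. (\<exists>v\<in>w ` I. u v \<noteq> 0) \<and> (\<Sum>v\<in>w ` I. scale (u v) v) = 0"
    then obtain u i where u: "i \<in> I" "u (w i) \<noteq> 0" "(\<Sum>v\<in>w ` I. scale (u v) v) = 0" by blast
    have "(\<Sum>i\<in>I. scale (u (w i)) (w i)) = 0" using u(3) by (simp add: sum.reindex[OF inj])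
    then show False using c[of "\<lambda>i. u (w i)"] u(1,2) by blast
  qed
qed

lemma (in vector_space) nontrivial_combination:
  assumes "finite I" "finite J" "card J < card I" "\<And>i. i \<in> I \<Longrightarrow> w i \<in> span (z ` J)"
  obtains c where "\<exists>i\<in>I. c i \<noteq> 0" "(\<Sum>i\<in>I. scale (c i) (w i)) = 0"
proof (rule ccontr)
  assume "\<not> thesis"
  then have *: "\<forall>i\<in>I. c i = 0" if "(\<Sum>i\<in>I. scale (c i) (w i)) = 0" for c
    using that \<open>\<And>c. \<exists>i\<in>I. c i \<noteq> 0 \<Longrightarrow> (\<Sum>i\<in>I. scale (c i) (w i)) = 0 \<Longrightarrow> thesis\<close> by blast
  note ind = independent_image_family[of I w, OF assms(1) *]
  have "card (w ` I) \<le> card (z ` J)"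
    using independent_span_bound[OF finite_imageI[OF assms(2)] ind(2)] assms(4) by blast
  then show False
    using card_image[OF ind(1)] card_image_le[OF assms(2), of z] assms(3) by linarith
qed

text \<open>Only scalars of the ground field act, so that spaces of tuples of bounded degree are
  finite-dimensional and can be compared by dimension.\<close>

definition tuple_scale :: "'a::field \<Rightarrow> (nat \<Rightarrow> 'a poly) \<Rightarrow> nat \<Rightarrow> 'a poly" where
  "tuple_scale c f = (\<lambda>j. [:c:] * f j)"

interpretation tuple_space: vector_space tuple_scale
  by standard (auto simp: tuple_scale_def fun_eq_iff algebra_simps one_pCons[symmetric] smult_add_left smult_add_right)

interpretation tuple_poly: vector_space_pair tuple_scale "\<lambda>c p. [:c:] * p"
  by standard (auto simp: algebra_simps smult_add_left smult_add_right)

definition tuple_part :: "nat \<Rightarrow> nat \<Rightarrow> (nat \<Rightarrow> 'a::field poly) set" where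
  "tuple_part d m = {x. (\<forall>j\<le>d. degree (x j) \<le> m) \<and> (\<forall>j>d. x j = 0)}"

lemma tuple_part_subspace: "tuple_space.subspace (tuple_part d m)"
  by (auto simp: tuple_space.subspace_def tuple_part_def tuple_scale_def
      intro: degree_add_le order.trans[OF degree_smult_le])

lemma linear_dot: "Vector_Spaces.linear tuple_scale (\<lambda>c p. [:c:] * p) (\<lambda>x. dot d x A)"
proof (unfold_locales, goal_cases)
  case (1 b1 b2)
  then show ?case by (simp add: dot_def sum.distrib algebra_simps)
next
  case (2 r b)
  then show ?case by (simp only: dot_def tuple_scale_def sum_distrib_left mult.assoc)
qed

lemma sum_fun_apply: "(\<Sum>i\<in>I. f i) j = (\<Sum>i\<in>I. f i j)"
  by (induction I rule: infinite_finite_induct) auto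

text \<open>Collecting the coefficients row by row into polynomials \<open>r k\<close> turns a
  relation over the field among monomial multiples into a relation over \<open>k[t]\<close> among
  the rows.\<close>

lemma lin_indep_rows_monomials:
  fixes p :: "nat \<Rightarrow> nat \<Rightarrow> 'a::field poly"
  assumes "lin_indep_rows d p"
    and "\<And>j. j \<le> d \<Longrightarrow> (\<Sum>(k, \<alpha>)\<in>(SIGMA k:{..<d}. {..<M k}). [:c (k, \<alpha>):] * (monom 1 \<alpha> * p k j)) = 0"
    and "k < d" "\<alpha> < M k"
  shows "c (k, \<alpha>) = 0"
proof -
  define r where "r k = (\<Sum>\<alpha><M k. monom (c (k, \<alpha>)) \<alpha>)" for k
  have "(\<Sum>k<d. r k * p k j) = 0" if "j \<le> d" for j
  proof -
    have "(\<Sum>k<d. r k * p k j) = (\<Sum>k<d. \<Sum>\<alpha><M k. [:c (k, \<alpha>):] * (monom 1 \<alpha> * p k j))"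
      unfolding r_def sum_distrib_right
      by (intro sum.cong refl) (simp add: smult_monom flip: smult_smult mult_smult_left)
    also have "\<dots> = 0"
      using assms(2)[OF that] by (subst (asm) sum.Sigma[symmetric]) auto
    finally show ?thesis .
  qed
  then have "r k = 0" using lin_indep_rowsD[OF assms(1)] assms(3) by blast
  moreover have "coeff (r k) \<alpha> = c (k, \<alpha>)"
    using assms(4) by (simp add: r_def coeff_sum coeff_monom)
  ultimately show ?thesis by simp
qed

text \<open>Let \<open>g\<close> be a generalised inverse of \<open>x \<mapsto> A \<cdot> x\<close> on tuples of degree at most \<open>m\<close>, and let
  \<open>h x = x - g (A \<cdot> x)\<close>, which takes values in the syzygies of \<open>A\<close>. Then \<open>F\<close> is the determinant of
  \<open>x \<mapsto> g (A' \<cdot> x) + h x\<close>: this map is the identity for \<open>A' = A\<close>, and it is singular if the syzygies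
  of \<open>A'\<close> form a space of larger dimension than those of \<open>A\<close>, since then \<open>h\<close> kills one of them.\<close>

lemma syzygy_semicontinuity:
  assumes a: "a \<in> tuples n d" and un: "unimodular n d (dehom a)"
    and fam: "syz_family d (dehom a) \<nu> q" and sum: "(\<Sum>i<d. \<nu> i) = n"
  obtains F where "F \<in> poly_funs n d" "F a \<noteq> 0"
    "\<And>a' \<mu> p. a' \<in> tuples n d \<Longrightarrow> syz_family d (dehom a') \<mu> p \<Longrightarrow>
       (\<Sum>k<d. Suc m - \<nu> k) < (\<Sum>k<d. Suc m - \<mu> k) \<Longrightarrow> F a' = 0"
proof -
  let ?A = "\<lambda>x. dot d x (dehom a)"
  interpret A: Vector_Spaces.linear tuple_scale "\<lambda>c p. [:c:] * p" ?A by (rule linear_dot)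
  obtain g where g: "range g \<subseteq> tuple_part d m" "Vector_Spaces.linear (\<lambda>c p. [:c:] * p) tuple_scale g"
    "\<And>x. x \<in> tuple_part d m \<Longrightarrow> ?A (g (?A x)) = ?A x"
    using tuple_poly.linear_exists_right_inverse_on[OF linear_dot tuple_part_subspace, of d m d "dehom a"]
    by blast
  interpret g: Vector_Spaces.linear "\<lambda>c p. [:c:] * p" tuple_scale g by (rule g(2))
  define h where "h x = x - g (?A x)" for x
  interpret h: Vector_Spaces.linear tuple_scale tuple_scale h
  proof (unfold_locales, goal_cases)
    case (1 b1 b2)
    show ?case by (simp add: h_def A.add g.add)
  next
    case (2 r b)
    show ?case by (simp only: h_def A.scale g.scale tuple_space.scale_right_diff_distrib)
  qed
  have h_ker: "h x \<in> tuple_part d m \<and> ?A (h x) = 0" if x: "x \<in> tuple_part d m" for x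
  proof
    show "h x \<in> tuple_part d m"
      unfolding h_def using g(1) x by (intro tuple_space.subspace_diff[OF tuple_part_subspace]) auto
    show "?A (h x) = 0" unfolding h_def A.diff using g(3)[OF x] by simp
  qed
  \<comment> \<open>Pairs of a row and a power of \<open>t\<close> whose product has degree bound at
    most \<open>m\<close>. Truncated subtraction yields no pairs for rows with
    \<open>\<mu> k > m\<close>.\<close>
  define ix where "ix \<mu> = (SIGMA k:{..<d}. {..<Suc m - \<mu> k})" for \<mu> :: "nat \<Rightarrow> nat"
  have ix: "finite (ix \<mu>)" "card (ix \<mu>) = (\<Sum>k<d. Suc m - \<mu> k)" for \<mu>
    by (simp_all add: ix_def)
  define mon where "mon p = (\<lambda>(k :: nat, \<alpha> :: nat) j. if j \<le> d then monom 1 \<alpha> * p k j else 0)" for p :: "nat \<Rightarrow> nat \<Rightarrow> 'a poly"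
  have mon_part: "mon p i \<in> tuple_part d m" if "syz_family d (dehom a') \<mu> p" "i \<in> ix \<mu>" for a' \<mu> p i
  proof -
    obtain k \<alpha> where i: "i = (k, \<alpha>)" "k < d" "\<alpha> < Suc m - \<mu> k" using \<open>i \<in> ix \<mu>\<close> by (auto simp: ix_def)
    have "degree (monom 1 \<alpha> * p k j) \<le> m" if "j \<le> d" for j
    proof -
      have "degree (p k j) \<le> \<mu> k" using \<open>syz_family d (dehom a') \<mu> p\<close> i(2) that by (simp add: syz_family_def)
      moreover have "degree (monom (1::'a) \<alpha>) \<le> \<alpha>" by (rule degree_monom_le)
      ultimately show ?thesis using degree_mult_le[of "monom 1 \<alpha>" "p k j"] i(3) by linarith
    qed
    then show ?thesis by (simp add: tuple_part_def mon_def i)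
  qed
  have ker_span: "x \<in> tuple_space.span (mon q ` ix \<nu>)" if x: "x \<in> tuple_part d m" "?A x = 0" for x
  proof -
    have "degree (x j) \<le> m" if "j \<le> d" for j using x(1) that by (simp add: tuple_part_def)
    from syzygy_generation[OF un fam sum x(2) this] obtain r where
      r: "\<And>j. j \<le> d \<Longrightarrow> x j = (\<Sum>i<d. r i * q i j)"
      "\<And>i. i < d \<Longrightarrow> r i \<noteq> 0 \<Longrightarrow> degree (r i) + \<nu> i \<le> m" by blast
    have expand: "r k = (\<Sum>\<alpha><Suc m - \<nu> k. [:coeff (r k) \<alpha>:] * monom 1 \<alpha>)" if "k < d" for k
    proof (rule poly_eqI)
      fix l
      have "coeff (\<Sum>\<alpha><Suc m - \<nu> k. [:coeff (r k) \<alpha>:] * monom 1 \<alpha>) l =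
          (\<Sum>\<alpha><Suc m - \<nu> k. if \<alpha> = l then coeff (r k) l else 0)"
        unfolding coeff_sum by (intro sum.cong) (auto simp: coeff_monom)
      also have "\<dots> = coeff (r k) l"
      proof (cases "r k = 0")
        case False
        then show ?thesis using r(2)[OF that False] by (auto simp: coeff_eq_0)
      qed simp
      finally show "coeff (r k) l = coeff (\<Sum>\<alpha><Suc m - \<nu> k. [:coeff (r k) \<alpha>:] * monom 1 \<alpha>) l" by simp
    qed
    have x_eq: "x = (\<Sum>i\<in>ix \<nu>. tuple_scale (coeff (r (fst i)) (snd i)) (mon q i))"
    proof
      fix j
      show "x j = (\<Sum>i\<in>ix \<nu>. tuple_scale (coeff (r (fst i)) (snd i)) (mon q i)) j"
      proof (cases "j \<le> d")
        case True
        have "x j = (\<Sum>k<d. \<Sum>\<alpha><Suc m - \<nu> k. [:coeff (r k) \<alpha>:] * monom 1 \<alpha> * q k j)"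
          unfolding r(1)[OF True] by (intro sum.cong refl, subst expand) (simp_all only: sum_distrib_right lessThan_iff)
        also have "\<dots> = (\<Sum>i\<in>ix \<nu>. tuple_scale (coeff (r (fst i)) (snd i)) (mon q i) j)"
          unfolding ix_def using True
          by (subst sum.Sigma) (auto simp: tuple_scale_def mon_def intro!: sum.cong)
        finally show ?thesis by (simp add: sum_fun_apply)
      next
        case False
        then show ?thesis using x(1)
          by (auto simp: tuple_part_def sum_fun_apply tuple_scale_def mon_def split_beta)
      qed
    qed
    show ?thesis
      by (subst x_eq) (intro tuple_space.span_sum tuple_space.span_scale tuple_space.span_base imageI)
  qed
  define L where "L = Suc m"
  have L: "0 < L" "\<And>l. l \<le> m \<longleftrightarrow> l < L" by (auto simp: L_def)
  define N where "N = Suc d * L"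
  \<comment> \<open>Monomial basis of the tuples of degree at most \<open>m\<close>, numbered by
    \<open>s = j * L + l\<close> for \<open>t^l\<close> in slot \<open>j\<close>; \<open>crd\<close>
    gives the coordinates.\<close>
  define bas :: "nat \<Rightarrow> nat \<Rightarrow> 'a poly" where
    "bas s = (\<lambda>j. if j = s div L then monom 1 (s mod L) else 0)" for s
  define crd where "crd s x = coeff (x (s div L)) (s mod L)" for s and x :: "nat \<Rightarrow> 'a poly"
  have N: "s div L \<le> d" if "s < N" for s
    using less_mult_imp_div_less[of s "Suc d" L] that unfolding N_def less_Suc_eq_le by blast
  have bas_part: "bas s \<in> tuple_part d m" if "s < N" for s
  proof -
    have "s mod L \<le> m" using L mod_less_divisor[OF L(1), of s] by simp
    then have "degree (monom (1::'a) (s mod L)) \<le> m"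
      by (rule order.trans[OF degree_monom_le])
    then show ?thesis using N[OF that] by (auto simp: tuple_part_def bas_def)
  qed
  have expand: "x = (\<Sum>s<N. tuple_scale (crd s x) (bas s))" if x: "x \<in> tuple_part d m" for x
  proof
    fix j
    show "x j = (\<Sum>s<N. tuple_scale (crd s x) (bas s)) j"
    proof (rule poly_eqI)
      fix l
      have "coeff ((\<Sum>s<N. tuple_scale (crd s x) (bas s)) j) l
          = (\<Sum>s<N. if s div L = j \<and> s mod L = l then coeff (x j) l else 0)"
        unfolding sum_fun_apply coeff_sum
        by (intro sum.cong refl) (auto simp: tuple_scale_def bas_def crd_def coeff_monom)
      also have "\<dots> = coeff (x j) l"
      proof (cases "j \<le> d \<and> l \<le> m")
        case True
        then have jl: "j \<le> d" "l < L" using L(2) by auto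
        have eq: "s div L = j \<and> s mod L = l \<longleftrightarrow> s = j * L + l" for s
        proof
          assume "s div L = j \<and> s mod L = l"
          then show "s = j * L + l" using div_mult_mod_eq[of s L] by simp
        qed (use jl in simp)
        have "j * L + l < Suc j * L" using jl by simp
        also have "\<dots> \<le> N" unfolding N_def using jl by (intro mult_le_mono1) simp
        finally have "j * L + l < N" .
        then show ?thesis unfolding eq by simp
      next
        case False
        have "coeff (x j) l = 0"
        proof (cases "j \<le> d")
          case True
          then have "degree (x j) \<le> m" using x by (simp add: tuple_part_def)
          then show ?thesis using False True by (intro coeff_eq_0) simp
        qed (use x in \<open>simp add: tuple_part_def\<close>)
        then show ?thesis by (auto intro!: sum.neutral)
      qed
      finally show "coeff (x j) l = coeff ((\<Sum>s<N. tuple_scale (crd s x) (bas s)) j) l" by simp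
    qed
  qed
  \<comment> \<open>Expanding \<open>a'\<close> by linearity of \<open>g\<close> makes the matrix
    entries visibly affine in the coefficients of \<open>a'\<close>.\<close>
  define E where "E a' s t = (\<Sum>j\<le>d. \<Sum>i\<le>n. coeff (coeff (a' j) (n - i)) i *
      crd t (g (bas s j * monom 1 i))) + crd t (h (bas s))" for a' s t
  have crd_add: "crd t (x + y) = crd t x + crd t y" for t x y by (simp add: crd_def)
  have crd_zero: "crd t 0 = 0" for t by (simp add: crd_def)
  have crd_scale: "crd t (tuple_scale c x) = c * crd t x" for t c x by (simp add: crd_def tuple_scale_def)
  have crd_sum: "crd t (sum f I) = (\<Sum>i\<in>I. crd t (f i))" for t I and f :: "'b \<Rightarrow> nat \<Rightarrow> 'a poly"
    by (simp add: crd_def sum_fun_apply coeff_sum)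
  have E: "E a' s t = crd t (g (dot d (bas s) (dehom a')) + h (bas s))" if a': "a' \<in> tuples n d" for a' s t
  proof -
    have A': "dehom a' j = (\<Sum>i\<le>n. [:coeff (coeff (a' j) (n - i)) i:] * monom 1 i)" if "j \<le> d" for j
    proof (rule poly_eqI)
      fix l
      have "coeff (\<Sum>i\<le>n. [:coeff (coeff (a' j) (n - i)) i:] * monom 1 i) l =
        (\<Sum>i\<le>n. if i = l then coeff (coeff (a' j) (n - l)) l else 0)"
        unfolding coeff_sum by (intro sum.cong) (auto simp: coeff_monom)
      then show "coeff (dehom a' j) l = coeff (\<Sum>i\<le>n. [:coeff (coeff (a' j) (n - i)) i:] * monom 1 i) l"
        by (simp add: coeff_dehom_tuple[OF a' that])
    qed
    have "dot d (bas s) (dehom a') =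
        (\<Sum>j\<le>d. \<Sum>i\<le>n. [:coeff (coeff (a' j) (n - i)) i:] * (bas s j * monom 1 i))"
      unfolding dot_def by (intro sum.cong refl) (simp add: A' sum_distrib_left mult.left_commute)
    then have "g (dot d (bas s) (dehom a')) =
        (\<Sum>j\<le>d. \<Sum>i\<le>n. tuple_scale (coeff (coeff (a' j) (n - i)) i) (g (bas s j * monom 1 i)))"
      by (simp only: g.sum g.scale)
    then show ?thesis by (simp only: E_def crd_add crd_sum crd_scale)
  qed
  define F where "F a' = rdet N (E a')" for a'
  have "F \<in> poly_funs n d"
    unfolding F_def E_def
    by (intro poly_funs_rdet poly_funs.add poly_funs_sum poly_funs.mult poly_funs.const poly_funs_coeff) auto
  moreover have "F a \<noteq> 0"
  proof -
    have "crd t (bas s) = (if s = t then 1 else 0)" for s t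
    proof (cases "s = t")
      case False
      then have "s div L \<noteq> t div L \<or> s mod L \<noteq> t mod L" by (metis div_mult_mod_eq)
      then show ?thesis using False by (auto simp: crd_def bas_def coeff_monom)
    qed (simp add: crd_def bas_def)
    then have "F a = rdet N (\<lambda>i j. if i = j then 1 else 0)"
      unfolding F_def by (intro rdet_cong) (simp add: E[OF a] h_def)
    then show ?thesis by (simp add: rdet_one)
  qed
  moreover have "F a' = 0" if a': "a' \<in> tuples n d" and fam': "syz_family d (dehom a') \<mu> p"
    and less: "(\<Sum>k<d. Suc m - \<nu> k) < (\<Sum>k<d. Suc m - \<mu> k)" for a' \<mu> p
  proof -
    have hs: "h (mon p i) \<in> tuple_space.span (mon q ` ix \<nu>)" if "i \<in> ix \<mu>" for i
      using h_ker[OF mon_part[OF fam' that]] ker_span by blast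
    have "card (ix \<nu>) < card (ix \<mu>)" using less by (simp only: ix(2))
    from tuple_space.nontrivial_combination[of "ix \<mu>" "ix \<nu>" "\<lambda>i. h (mon p i)" "mon q", OF ix(1) ix(1) this hs]
    obtain c where c: "\<exists>i\<in>ix \<mu>. c i \<noteq> 0" "(\<Sum>i\<in>ix \<mu>. tuple_scale (c i) (h (mon p i))) = 0"
      by blast
    define x where "x = (\<Sum>i\<in>ix \<mu>. tuple_scale (c i) (mon p i))"
    have hx: "h x = 0" using c(2) by (simp only: x_def h.sum h.scale)
    have x: "x \<in> tuple_part d m"
      unfolding x_def using mon_part[OF fam']
      by (intro tuple_space.subspace_sum[OF tuple_part_subspace] tuple_space.subspace_scale[OF tuple_part_subspace])
    have mon0: "dot d (mon p i) (dehom a') = 0" if "i \<in> ix \<mu>" for i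
    proof -
      obtain k \<alpha> where i: "i = (k, \<alpha>)" "k < d" using \<open>i \<in> ix \<mu>\<close> by (auto simp: ix_def)
      have "dot d (mon p i) (dehom a') = dot d (\<lambda>j. monom 1 \<alpha> * p k j + 0 * p k j) (dehom a')"
        by (intro dot_cong) (simp add: mon_def i)
      then show ?thesis using fam' i(2) unfolding dot_linear by (simp add: syz_family_def)
    qed
    interpret A': Vector_Spaces.linear tuple_scale "\<lambda>c p. [:c:] * p" "\<lambda>x. dot d x (dehom a')"
      by (rule linear_dot)
    have x0: "dot d x (dehom a') = 0" unfolding x_def A'.sum A'.scale by (simp add: mon0)
    have "x \<noteq> 0"
    proof
      assume "x = 0"
      obtain k \<alpha> where k: "k < d" "\<alpha> < Suc m - \<mu> k" "c (k, \<alpha>) \<noteq> 0" using c(1) by (auto simp: ix_def)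
      have "(\<Sum>(k, \<alpha>)\<in>(SIGMA k:{..<d}. {..<Suc m - \<mu> k}). [:c (k, \<alpha>):] * (monom 1 \<alpha> * p k j)) = 0"
        if "j \<le> d" for j
      proof -
        have "x j = (\<Sum>(k, \<alpha>)\<in>(SIGMA k:{..<d}. {..<Suc m - \<mu> k}). [:c (k, \<alpha>):] * (monom 1 \<alpha> * p k j))"
          unfolding x_def sum_fun_apply ix_def[symmetric]
          by (intro sum.cong refl) (use that in \<open>auto simp: tuple_scale_def mon_def\<close>)
        then show ?thesis using \<open>x = 0\<close> by simp
      qed
      note sum0 = this
      have "lin_indep_rows d p" using fam' by (simp add: syz_family_def)
      from lin_indep_rows_monomials[where M = "\<lambda>k. Suc m - \<mu> k" and c = c, OF this sum0 k(1,2)]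
      have "c (k, \<alpha>) = 0" .
      then show False using k(3) by contradiction
    qed
    have "\<exists>s<N. crd s x \<noteq> 0"
    proof (rule ccontr)
      assume "\<not> (\<exists>s<N. crd s x \<noteq> 0)"
      then have "x = 0" by (subst expand[OF x]) simp
      then show False using \<open>x \<noteq> 0\<close> by contradiction
    qed
    moreover have "(\<Sum>s<N. crd s x * E a' s t) = 0" for t
    proof -
      define v where "v s = crd s x" for s
      have xv: "(\<Sum>s<N. tuple_scale (v s) (bas s)) = x" unfolding v_def by (rule expand[OF x, symmetric])
      have "dot d (\<Sum>s<N. tuple_scale (v s) (bas s)) (dehom a') =
          (\<Sum>s<N. [:v s:] * dot d (bas s) (dehom a'))"
        by (simp only: A'.sum A'.scale)
      then have "g (\<Sum>s<N. [:v s:] * dot d (bas s) (dehom a')) = 0"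
        by (simp only: xv x0 g.zero)
      then have g0: "(\<Sum>s<N. tuple_scale (v s) (g (dot d (bas s) (dehom a')))) = 0"
        by (simp only: g.sum g.scale)
      have h0: "(\<Sum>s<N. tuple_scale (v s) (h (bas s))) = 0"
      proof -
        have "h (\<Sum>s<N. tuple_scale (v s) (bas s)) = (\<Sum>s<N. tuple_scale (v s) (h (bas s)))"
          by (simp only: h.sum h.scale)
        moreover have "h (\<Sum>s<N. tuple_scale (v s) (bas s)) = 0" by (simp only: xv hx)
        ultimately show ?thesis by (rule trans[OF sym])
      qed
      have "(\<Sum>s<N. v s * E a' s t) =
          crd t (\<Sum>s<N. tuple_scale (v s) (g (dot d (bas s) (dehom a')) + h (bas s)))"
        by (simp only: E[OF a'] crd_sum crd_scale)
      also have "(\<Sum>s<N. tuple_scale (v s) (g (dot d (bas s) (dehom a')) + h (bas s))) = 0"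
        by (simp only: tuple_space.scale_right_distrib sum.distrib g0 h0 add_0)
      finally show ?thesis by (simp only: v_def crd_zero)
    qed
    ultimately show "F a' = 0"
      unfolding F_def rdet_zero_iff_left by (intro exI[of _ "\<lambda>s. crd s x"] conjI allI impI)
  qed
  ultimately show thesis by (rule that)
qed

section \<open>Degeneration\<close>

lemma poly_funs_line:
  assumes "f \<in> poly_funs n d"
  obtains P where "\<And>\<epsilon>. f (\<lambda>j. a j + [:[:\<epsilon>:]:] * b j) = poly P \<epsilon>"
proof -
  have "\<exists>P. \<forall>\<epsilon>. f (\<lambda>j. a j + [:[:\<epsilon>:]:] * b j) = poly P \<epsilon>"
    using assms
  proof induction
    case (const c)
    show ?case by (intro exI[of _ "[:c:]"]) simp
  next
    case (coord j i)
    show ?case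
      by (intro exI[of _ "[:coeff (coeff (a j) i) (n - i), coeff (coeff (b j) i) (n - i):]"]) simp
  next
    case (add f g)
    then obtain P Q where "\<forall>\<epsilon>. f (\<lambda>j. a j + [:[:\<epsilon>:]:] * b j) = poly P \<epsilon>"
      "\<forall>\<epsilon>. g (\<lambda>j. a j + [:[:\<epsilon>:]:] * b j) = poly Q \<epsilon>" by blast
    then show ?case by (intro exI[of _ "P + Q"]) simp
  next
    case (mult f g)
    then obtain P Q where "\<forall>\<epsilon>. f (\<lambda>j. a j + [:[:\<epsilon>:]:] * b j) = poly P \<epsilon>"
      "\<forall>\<epsilon>. g (\<lambda>j. a j + [:[:\<epsilon>:]:] * b j) = poly Q \<epsilon>" by blast
    then show ?case by (intro exI[of _ "P * Q"]) simp
  qed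
  then show thesis using that by blast
qed

text \<open>Infinitude of the field enters here: restricted to the line, \<open>f\<close> is a
  polynomial in one variable with infinitely many zeros.\<close>

lemma poly_funs_line_zero:
  fixes a b :: "nat \<Rightarrow> 'a::field poly poly"
  assumes "infinite (UNIV :: 'a set)" "f \<in> poly_funs n d"
    and zero: "\<And>\<epsilon>. \<epsilon> \<noteq> 0 \<Longrightarrow> f (\<lambda>j. a j + [:[:\<epsilon>:]:] * b j) = 0"
  shows "f a = 0"
proof -
  obtain P where P: "\<And>\<epsilon>. f (\<lambda>j. a j + [:[:\<epsilon>:]:] * b j) = poly P \<epsilon>"
    using poly_funs_line[OF assms(2)] by blast
  have "P = 0"
  proof (rule ccontr)
    assume "P \<noteq> 0"
    then have "finite {x. poly P x = 0}" by (rule poly_roots_finite)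
    moreover have "UNIV \<subseteq> insert 0 {x. poly P x = 0}" using P zero by auto
    ultimately show False using assms(1) by (meson finite.insertI finite_subset)
  qed
  then show ?thesis using P[of 0] by simp
qed

lemma sum_two_parts:
  fixes \<mu> :: "nat \<Rightarrow> nat"
  assumes "i < d" "j < d" "i \<noteq> j"
  shows "(\<Sum>k<d. (\<mu>(i := x, j := y)) k) + \<mu> i + \<mu> j = (\<Sum>k<d. \<mu> k) + x + y"
  using sum_fun_upd_le[OF assms(1), of \<mu> x] sum_fun_upd_le[OF assms(2), of "\<mu>(i := x)" y] assms(3)
  by (simp add: fun_upd_twist)

text \<open>With \<open>q = c + t q'\<close> for the syzygy \<open>q\<close> of the larger degree and \<open>p\<close> the one of the smaller
  degree, \<open>(t p - \<epsilon> c) \<and> (p + \<epsilon> q') = \<epsilon> (p \<and> q - \<epsilon> c \<and> q')\<close>. Hence the maximal minors of the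
  modified matrix are, up to the factor \<open>\<epsilon>\<close>, a linear perturbation of the original ones.\<close>

lemma degeneration_step:
  fixes a :: "nat \<Rightarrow> 'a::field poly poly"
  assumes inf: "infinite (UNIV :: 'a set)"
    and a: "a \<in> P_set n d" and fam: "syz_family d (dehom a) \<mu> p" and sum: "(\<Sum>k<d. \<mu> k) = n"
    and ij: "i < d" "j < d" "\<mu> i + 2 \<le> \<mu> j"
    and f: "f \<in> poly_funs n d"
    and f0: "\<And>a' p'. a' \<in> P_set n d \<Longrightarrow>
      syz_family d (dehom a') (\<mu>(i := \<mu> i + 1, j := \<mu> j - 1)) p' \<Longrightarrow> f a' = 0"
  shows "f a = 0"
proof -
  let ?A = "dehom a" and ?\<mu> = "\<mu>(i := \<mu> i + 1, j := \<mu> j - 1)"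
  have ne: "i \<noteq> j" using ij(3) by auto
  have at: "a \<in> tuples n d" and li: "lin_indep d a" and rp: "rel_prime d a"
    using a by (auto simp: P_set_def)
  have un: "unimodular n d ?A" by (rule unimodular_if_rel_prime[OF at rp])
  have pos: "1 \<le> \<mu> k" if "k < d" for k by (rule family_pos[OF at li fam that])
  obtain u where u: "dot d u ?A = 1" using un by (auto simp: unimodular_def)
  define g where "g = bordered_det d u p"
  note hb = hilbert_burch[OF un fam u, folded g_def]
  obtain c where gc: "g = [:c:]" using hb(3) sum by (auto elim: degree_eq_zeroE)
  have c: "c \<noteq> 0" using hb(2) gc by simp
  \<comment> \<open>\<open>\<kappa>\<close> is the constant vector and \<open>q\<close> the quotient
    by \<open>t\<close> in the decomposition of row \<open>j\<close>. The letter \<open>c\<close> is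
    already taken by the constant value of \<open>g\<close>.\<close>
  define \<kappa> :: "nat \<Rightarrow> 'a poly" where "\<kappa> = (\<lambda>l. [:poly (p j l) 0:])"
  define q where "q = (\<lambda>l. synthetic_div (p j l) 0)"
  have pj: "p j = (\<lambda>l. 1 * \<kappa> l + [:0, 1:] * q l)"
    using synthetic_div_correct[of "p j _" 0] by (auto simp: \<kappa>_def q_def)
  have degp: "degree (p k l) \<le> \<mu> k" if "k < d" "l \<le> d" for k l
    using fam that by (simp add: syz_family_def)
  have degq: "degree (q l) \<le> \<mu> j - 1" if "l \<le> d" for l
    using degp[OF ij(2) that] by (simp add: q_def degree_synthetic_div diff_le_mono)
  \<comment> \<open>The direction of the perturbation: the minors with rows \<open>\<kappa>\<close>
    and \<open>q\<close>. The original minors are \<open>c\<close> times the entries of the tuple,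
    whence the factor \<open>- inverse c\<close>.\<close>
  define B where "B l = [:- inverse c:] * bordered_det d (unit_vec_fun l) (p(i := \<kappa>, j := q))" for l
  have degB: "degree (B l) \<le> n" if "l \<le> d" for l
  proof -
    have "degree (bordered_det d (unit_vec_fun l :: nat \<Rightarrow> 'a poly) (p(i := \<kappa>, j := q)))
        \<le> 0 + (\<Sum>k<d. (\<mu>(i := 0, j := \<mu> j - 1)) k)"
      using degp degq by (intro bordered_det_degree(1)) (auto simp: unit_vec_fun_def \<kappa>_def)
    then have "degree (bordered_det d (unit_vec_fun l :: nat \<Rightarrow> 'a poly) (p(i := \<kappa>, j := q))) \<le> n"
      using sum_two_parts[OF ij(1,2) ne, of \<mu> 0 "\<mu> j - 1"] sum ij(3) by linarith
    then show ?thesis unfolding B_def by (simp add: order.trans[OF degree_smult_le])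
  qed
  define b where "b l = (if l \<le> d then homog n (B l) else 0)" for l
  define P where "P \<epsilon> = p(i := (\<lambda>l. [:0, 1:] * p i l + [:- \<epsilon>:] * \<kappa> l), j := (\<lambda>l. 1 * p i l + [:\<epsilon>:] * q l))" for \<epsilon>
  have minors: "bordered_det d y (P \<epsilon>) = [:\<epsilon>:] * (bordered_det d y p - [:\<epsilon>:] * bordered_det d y (p(i := \<kappa>, j := q)))" for \<epsilon> y
  proof -
    let ?D = "\<lambda>v w. bordered_det d y (p(i := v, j := w))"
    have D1: "?D (\<lambda>l. r * v l + s * v' l) w = r * ?D v w + s * ?D v' w" for r s v v' w
      unfolding fun_upd_twist[OF ne] by (rule bordered_det_linear[OF ij(1)])
    have D2: "?D w (\<lambda>l. r * v l + s * v' l) = r * ?D w v + s * ?D w v'" for r s v v' w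
      using bordered_det_linear[OF ij(2), of y "p(i := w)" r v s v'] by simp
    have Ds: "?D v v = 0" for v by (rule bordered_det_same[of i j]) (use ij ne in auto)
    have Da: "?D \<kappa> (p i) = - ?D (p i) \<kappa>"
    proof -
      have "0 = ?D (\<lambda>l. 1 * \<kappa> l + 1 * p i l) (\<lambda>l. 1 * \<kappa> l + 1 * p i l)" by (simp only: Ds)
      also have "\<dots> = ?D \<kappa> (p i) + ?D (p i) \<kappa>" unfolding D1 D2 Ds by simp
      finally show ?thesis by (simp add: eq_neg_iff_add_eq_0)
    qed
    have "bordered_det d y p = ?D (p i) (p j)" by simp
    also have "\<dots> = ?D (p i) (\<lambda>l. 1 * \<kappa> l + [:0, 1:] * q l)" using pj by (rule arg_cong)
    also have "\<dots> = 1 * ?D (p i) \<kappa> + [:0, 1:] * ?D (p i) q" by (rule D2)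
    finally have Dp: "bordered_det d y p = 1 * ?D (p i) \<kappa> + [:0, 1:] * ?D (p i) q" .
    have "bordered_det d y (P \<epsilon>) = [:0, 1:] * ([:\<epsilon>:] * ?D (p i) q) + [:- \<epsilon>:] * (?D \<kappa> (p i) + [:\<epsilon>:] * ?D \<kappa> q)"
      unfolding P_def D1 D2 Ds by simp
    also have "\<dots> = [:\<epsilon>:] * (bordered_det d y p - [:\<epsilon>:] * bordered_det d y (p(i := \<kappa>, j := q)))"
      unfolding Dp Da by (simp add: algebra_simps smult_add_right smult_diff_right)
    finally show ?thesis .
  qed
  define a' where "a' \<epsilon> = (\<lambda>l. a l + [:[:\<epsilon>:]:] * b l)" for \<epsilon>
  have a't: "a' \<epsilon> \<in> tuples n d" for \<epsilon>
  proof -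
    have "[:[:\<epsilon>:]:] \<in> graded_part 0"
      by (auto simp: graded_part_def coeff_pCons split: nat.splits)
    from graded_part_mult[OF this homog_graded] have "[:[:\<epsilon>:]:] * homog n (B l) \<in> graded_part (int n)" for l
      by simp
    then show ?thesis
      using at by (auto simp: a'_def b_def tuples_def free_mod_def intro: graded_part_add)
  qed
  have A': "dehom (a' \<epsilon>) l = ?A l + [:\<epsilon>:] * B l" if "l \<le> d" for \<epsilon> l
    using that by (simp add: a'_def dehom_def b_def dehom_homog degB)
  have dotA': "[:c:] * dot d y (dehom (a' \<epsilon>)) = bordered_det d y p - [:\<epsilon>:] * bordered_det d y (p(i := \<kappa>, j := q))" for y \<epsilon>
  proof -
    have y: "y l = (\<Sum>k\<le>d. y k * unit_vec_fun k l)" if "l \<le> d" for l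
      using that by (simp add: unit_vec_fun_def if_distrib[of "\<lambda>x. _ * x"] cong: if_cong)
    have "bordered_det d y r = (\<Sum>k\<le>d. y k * bordered_det d (unit_vec_fun k) r)" for r
    proof -
      have "bordered_det d y r = bordered_det d (\<lambda>l. \<Sum>k\<le>d. y k * unit_vec_fun k l) r"
        using y by (intro bordered_det_cong) auto
      then show ?thesis by (simp only: bordered_det_sum0[OF finite_atMost])
    qed
    then have B: "dot d y B = [:- inverse c:] * bordered_det d y (p(i := \<kappa>, j := q))"
      by (simp add: dot_def B_def sum_distrib_left mult.left_commute)
    have "dot d y (dehom (a' \<epsilon>)) = dot d y ?A + [:\<epsilon>:] * dot d y B"
      by (simp add: dot_def A' distrib_left sum.distrib sum_distrib_left mult.left_commute)
    then have "[:c:] * dot d y (dehom (a' \<epsilon>)) = [:c:] * dot d y ?A + [:\<epsilon>:] * ([:c:] * ([:- inverse c:] * bordered_det d y (p(i := \<kappa>, j := q))))"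
      by (simp only: B distrib_left mult.left_commute)
    also have "[:c:] * ([:- inverse c:] * bordered_det d y (p(i := \<kappa>, j := q))) = - bordered_det d y (p(i := \<kappa>, j := q))"
      using c by simp
    finally show ?thesis by (simp only: hb(1)[of y] gc)  simp
  qed
  \<comment> \<open>The factor \<open>\<epsilon> * c\<close> is invertible for
    \<open>\<epsilon> \<noteq> 0\<close>. Repeated rows then show that the rows of
    \<open>P \<epsilon>\<close> are syzygies of the perturbed tuple, and a Bezout vector shows that
    they are independent.\<close>
  have key: "bordered_det d y (P \<epsilon>) = [:\<epsilon> * c:] * dot d y (dehom (a' \<epsilon>))" for y \<epsilon>
    using minors[of y \<epsilon>] unfolding dotA'[of y \<epsilon>, symmetric]
    by (simp add: mult.commute[of c \<epsilon>])
  have fam': "syz_family d (dehom (a' \<epsilon>)) ?\<mu> (P \<epsilon>)" if \<epsilon>: "\<epsilon> \<noteq> 0" and un': "unimodular n d (dehom (a' \<epsilon>))" for \<epsilon>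
    unfolding syz_family_def
  proof (intro conjI allI impI)
    fix k l assume kl: "k < d" "l \<le> d"
    have "degree ([:0, 1:] * p i l + [:- \<epsilon>:] * \<kappa> l) \<le> \<mu> i + 1"
    proof (rule degree_add_le)
      show "degree ([:0, 1:] * p i l) \<le> \<mu> i + 1"
        using degp[OF ij(1) kl(2)] degree_pCons_le[of 0 "p i l"] by simp
    qed (simp add: \<kappa>_def)
    \<comment> \<open>The gap between the two degrees keeps \<open>\<mu> i\<close> below
      \<open>\<mu> j - 1\<close>.\<close>
    moreover have "degree (1 * p i l + [:\<epsilon>:] * q l) \<le> \<mu> j - 1"
      using degp[OF ij(1) kl(2)] degq[OF kl(2)] ij(3)
      by (intro degree_add_le) (auto intro: order.trans[OF degree_smult_le])
    ultimately show "degree (P \<epsilon> k l) \<le> ?\<mu> k" using degp[OF kl] by (auto simp: P_def)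
  next
    fix k assume "k < d"
    then have "[:\<epsilon> * c:] * dot d (P \<epsilon> k) (dehom (a' \<epsilon>)) = 0"
      unfolding key[symmetric] by (rule bordered_det_same0)
    then show "dot d (P \<epsilon> k) (dehom (a' \<epsilon>)) = 0" using \<epsilon> c by simp
  next
    obtain v where "dot d v (dehom (a' \<epsilon>)) = 1" using un' by (auto simp: unimodular_def)
    then have "bordered_det d v (P \<epsilon>) \<noteq> 0" unfolding key using \<epsilon> c by simp
    then show "lin_indep_rows d (P \<epsilon>)" by (rule lin_indep_rows_if_det)
  qed
  obtain F where F: "F \<in> poly_funs n d" "F a \<noteq> 0"
    "\<And>a'. a' \<in> tuples n d \<Longrightarrow> F a' \<noteq> 0 \<Longrightarrow> unimodular n d (dehom a')"
    by (rule unimodular_open[OF at un]) blast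
  \<comment> \<open>Where \<open>F\<close> vanishes, the perturbed tuple may fail to be coprime; the
    product with \<open>f\<close> is zero there anyway, and \<open>F a \<noteq> 0\<close> allows
    \<open>F\<close> to be cancelled at the end.\<close>
  have Ff: "F (a' \<epsilon>) * f (a' \<epsilon>) = 0" if \<epsilon>: "\<epsilon> \<noteq> 0" for \<epsilon>
  proof (cases "F (a' \<epsilon>) = 0")
    case False
    then have un': "unimodular n d (dehom (a' \<epsilon>))" by (rule F(3)[OF a't])
    note fm = fam'[OF \<epsilon> un']
    have "(\<Sum>k<d. ?\<mu> k) = n"
      using sum_two_parts[OF ij(1,2) ne, of \<mu> "\<mu> i + 1" "\<mu> j - 1"] sum ij(3) by linarith
    then have "lin_indep d (a' \<epsilon>)"
      using pos ij(3) by (intro lin_indep_if_family[OF a't un' fm]) auto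
    then have "a' \<epsilon> \<in> P_set n d"
      using a't rel_prime_if_unimodular[OF a't un'] by (simp add: P_set_def)
    from f0[OF this fm] show ?thesis by simp
  qed simp
  have "(\<lambda>a. F a * f a) a = 0"
  proof (rule poly_funs_line_zero[OF inf poly_funs.mult[OF F(1) f]])
    fix \<epsilon> :: 'a assume "\<epsilon> \<noteq> 0"
    from Ff[OF this]
    show "F (\<lambda>j. a j + [:[:\<epsilon>:]:] * b j) * f (\<lambda>j. a j + [:[:\<epsilon>:]:] * b j) = 0" unfolding a'_def .
  qed
  then show ?thesis using F(2) by simp
qed

section \<open>Dominance order and closure\<close>

lemma sum_list_take: "k \<le> length l \<Longrightarrow> sum_list (take k l) = (\<Sum>m<k. l ! m)"
  by (simp add: sum_list_sum_nth atLeast0LessThan min_absorb2)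

lemma sum_list_take_update2:
  fixes l :: "nat list"
  assumes "i < j" "j < length l" "k \<le> length l" "1 \<le> l ! j"
  shows "sum_list (take k (l[i := l ! i + 1, j := l ! j - 1])) =
    sum_list (take k l) + (if i < k \<and> k \<le> j then 1 else 0)"
proof -
  let ?f = "(!) l"
  have nth: "(l[i := l ! i + 1, j := l ! j - 1]) ! m = (?f(i := l ! i + 1, j := l ! j - 1)) m" if "m < length l" for m
    using assms(1,2) that by (auto simp: nth_list_update)
  have eq: "sum_list (take k (l[i := l ! i + 1, j := l ! j - 1])) = (\<Sum>m<k. (?f(i := l ! i + 1, j := l ! j - 1)) m)"
    using assms(3) by (subst sum_list_take) (auto simp: nth intro!: sum.cong)
  consider "k \<le> i" | "i < k" "k \<le> j" | "j < k" by linarith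
  then show ?thesis
  proof cases
    case 1
    then show ?thesis unfolding eq using assms by (auto simp: sum_list_take intro!: sum.cong)
  next
    case 2
    have "(\<Sum>m<k. (?f(i := l ! i + 1, j := l ! j - 1)) m) = (\<Sum>m<k. (?f(i := l ! i + 1)) m)"
      using 2 by (intro sum.cong) auto
    then show ?thesis
      unfolding eq using sum_fun_upd_le[OF 2(1), of ?f "l ! i + 1"] 2 assms(3) by (simp add: sum_list_take)
  next
    case 3
    have "i < k" using 3 assms(1) by simp
    from sum_two_parts[OF this 3, of ?f "l ! i + 1" "l ! j - 1"]
    show ?thesis unfolding eq using 3 assms by (simp add: sum_list_take)
  qed
qed

text \<open>A unit is moved from a late part to an early one. The partitions first differ at
  \<open>i0\<close>, and \<open>j0\<close> ends the first stretch on which the partial sums of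
  \<open>\<mu>'\<close> are strictly smaller; this strictness leaves room for the move.\<close>

lemma dominance_step:
  assumes part': "partition_of n d \<mu>'" and part: "partition_of n d \<mu>"
    and le: "partition_le d \<mu>' \<mu>" and neq: "\<mu>' \<noteq> \<mu>"
  obtains i j where "i < j" "j < d" "\<mu>' ! i + 2 \<le> \<mu>' ! j"
    "partition_of n d (\<mu>'[i := \<mu>' ! i + 1, j := \<mu>' ! j - 1])"
    "partition_le d (\<mu>'[i := \<mu>' ! i + 1, j := \<mu>' ! j - 1]) \<mu>"
proof -
  define S where "S l k = sum_list (take k l)" for l :: "nat list" and k
  have len: "length \<mu>' = d" "length \<mu> = d" and srt: "sorted \<mu>'" "sorted \<mu>"
    and ge1: "\<And>k. k < d \<Longrightarrow> 1 \<le> \<mu>' ! k" and tot: "S \<mu>' d = n" "S \<mu> d = n"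
    using part part' by (auto simp: partition_of_def partition_d_def S_def)
  have S_Suc: "S l (Suc k) = S l k + l ! k" if "k < length l" for l k
    using that by (simp add: S_def take_Suc_conv_app_nth)
  have S_le: "S \<mu>' k \<le> S \<mu> k" if "k \<le> d" for k
    using le that by (cases k) (auto simp: partition_le_def S_def)
  have mono': "\<mu>' ! a \<le> \<mu>' ! b" if "a \<le> b" "b < d" for a b
    using srt(1) that len by (simp add: sorted_iff_nth_mono)
  have mono: "\<mu> ! a \<le> \<mu> ! b" if "a \<le> b" "b < d" for a b
    using srt(2) that len by (simp add: sorted_iff_nth_mono)
  have "\<exists>k. k < d \<and> \<mu>' ! k \<noteq> \<mu> ! k" using neq len nth_equalityI by metis
  then obtain i0 where i0: "i0 < d" "\<mu>' ! i0 \<noteq> \<mu> ! i0" "\<And>k. k < i0 \<Longrightarrow> \<mu>' ! k = \<mu> ! k"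
    using exists_least_iff[of "\<lambda>k. k < d \<and> \<mu>' ! k \<noteq> \<mu> ! k"] by (metis order_less_trans)
  have "S \<mu>' i0 = S \<mu> i0" using i0 len by (simp add: S_def sum_list_take)
  then have lt0: "\<mu>' ! i0 < \<mu> ! i0" using S_le[of "Suc i0"] S_Suc[of i0 \<mu>] S_Suc[of i0 \<mu>'] i0 len by simp
  have "\<exists>k. i0 \<le> k \<and> k < d \<and> S \<mu>' (Suc k) = S \<mu> (Suc k)"
    using tot i0 by (intro exI[of _ "d - 1"]) auto
  then obtain j0 where j0: "i0 \<le> j0" "j0 < d" "S \<mu>' (Suc j0) = S \<mu> (Suc j0)"
    "\<And>k. i0 \<le> k \<Longrightarrow> k < j0 \<Longrightarrow> S \<mu>' (Suc k) \<noteq> S \<mu> (Suc k)"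
    using exists_least_iff[of "\<lambda>k. i0 \<le> k \<and> k < d \<and> S \<mu>' (Suc k) = S \<mu> (Suc k)"]
    by (metis order_less_trans)
  have less: "S \<mu>' k < S \<mu> k" if "i0 < k" "k \<le> j0" for k
    using j0(4)[of "k - 1"] S_le[of k] that j0(2) by (cases k) auto
  have "i0 \<noteq> j0" using j0(3) \<open>S \<mu>' i0 = S \<mu> i0\<close> lt0 S_Suc[of i0 \<mu>] S_Suc[of i0 \<mu>'] i0 len by auto
  then have "S \<mu>' j0 < S \<mu> j0" using j0 by (intro less) auto
  then have gt0: "\<mu> ! j0 < \<mu>' ! j0" using j0 S_Suc[of j0 \<mu>] S_Suc[of j0 \<mu>'] len by simp
  \<comment> \<open>Through \<open>\<mu>\<close>: the part at \<open>i0\<close> is smaller in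
    \<open>\<mu>'\<close>, the part at \<open>j0\<close> is larger, and \<open>\<mu>\<close> is
    sorted.\<close>
  have gap: "\<mu>' ! i0 + 2 \<le> \<mu>' ! j0" using lt0 gt0 mono[OF j0(1,2)] by simp
  \<comment> \<open>The last position with the value at \<open>i0\<close>, and below the first one
    with the value at \<open>j0\<close>, so that the changed list stays sorted.\<close>
  define i where "i = Max {k. k < d \<and> \<mu>' ! k = \<mu>' ! i0}"
  have "i \<in> {k. k < d \<and> \<mu>' ! k = \<mu>' ! i0}" unfolding i_def using i0 by (intro Max_in) auto
  then have i: "i < d" "\<mu>' ! i = \<mu>' ! i0" by auto
  have i_max: "k \<le> i" if "k < d" "\<mu>' ! k = \<mu>' ! i0" for k
    unfolding i_def using that by (intro Max_ge) auto
  define j where "j = Min {k. k < d \<and> \<mu>' ! k = \<mu>' ! j0}"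
  have "j \<in> {k. k < d \<and> \<mu>' ! k = \<mu>' ! j0}" unfolding j_def using j0 by (intro Min_in) auto
  then have j: "j < d" "\<mu>' ! j = \<mu>' ! j0" by auto
  have j_min: "j \<le> k" if "k < d" "\<mu>' ! k = \<mu>' ! j0" for k
    unfolding j_def using that by (intro Min_le) auto
  have gap': "\<mu>' ! i + 2 \<le> \<mu>' ! j" using gap i j by simp
  have "i < j" using gap' mono'[of j i] i(1) by (metis add_leD1 add_le_same_cancel1 linorder_not_less numeral_One order_trans not_numeral_le_zero)
  have above: "\<mu>' ! i + 1 \<le> \<mu>' ! k" if "i < k" "k < d" for k
    using mono'[of i k] i_max[of k] that i by fastforce
  have below: "\<mu>' ! k \<le> \<mu>' ! j - 1" if "k < j" for k
    using mono'[of k j] j_min[of k] that j by fastforce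
  let ?\<nu> = "\<mu>'[i := \<mu>' ! i + 1, j := \<mu>' ! j - 1]"
  have S\<nu>: "S ?\<nu> k = S \<mu>' k + (if i < k \<and> k \<le> j then 1 else 0)" if "k \<le> d" for k
    unfolding S_def using \<open>i < j\<close> j(1) ge1[OF j(1)] that len by (intro sum_list_take_update2) auto
  have nth: "?\<nu> ! k = (if k = j then \<mu>' ! j - 1 else if k = i then \<mu>' ! i + 1 else \<mu>' ! k)" if "k < d" for k
    using that \<open>i < j\<close> j(1) len by (auto simp: nth_list_update)
  have "sorted ?\<nu>"
    unfolding sorted_iff_nth_mono
  proof (intro allI impI)
    fix a b assume "a \<le> b" "b < length ?\<nu>"
    then have ab: "a \<le> b" "b < d" "a < d" using len by auto
    show "?\<nu> ! a \<le> ?\<nu> ! b"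
      unfolding nth[OF ab(2)] nth[OF ab(3)]
      using mono'[OF ab(1,2)] above[of b] below[of a] gap' ab \<open>i < j\<close> by (auto split: if_splits)
  qed
  moreover have "1 \<le> ?\<nu> ! k" if "k < d" for k
    unfolding nth[OF that] using ge1[OF that] gap' by auto
  then have "\<forall>m\<in>set ?\<nu>. 1 \<le> m" using len by (auto simp: in_set_conv_nth)
  moreover have "sum_list ?\<nu> = n" using S\<nu>[of d] tot len j(1) by (simp add: S_def)
  ultimately have "partition_of n d ?\<nu>" using len by (simp add: partition_of_def partition_d_def)
  moreover have "partition_le d ?\<nu> \<mu>"
    unfolding partition_le_def
  proof
    fix k assume "k \<in> {1..d}"
    then have k: "k \<le> d" by simp
    have "S \<mu>' k < S \<mu> k" if "i < k" "k \<le> j"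
      using that i_max[of i0] i0(1) j_min[of j0] j0(2) by (intro less) auto
    then show "sum_list (take k ?\<nu>) \<le> sum_list (take k \<mu>)"
      using S\<nu>[OF k] S_le[OF k] by (auto simp: S_def split: if_splits)
  qed
  ultimately show thesis using that \<open>i < j\<close> j(1) gap' by blast
qed

text \<open>For \<open>Suc m\<close> equal to the first part of \<open>\<nu>\<close> not summed, its
  sum is exactly \<open>i * Suc m\<close> minus the first \<open>i\<close> parts, while that of
  \<open>\<mu>\<close> is at least the corresponding expression.\<close>

lemma partition_le_if_truncated_sums:
  assumes part': "partition_of n d \<nu>" and part: "partition_of n d \<mu>"
    and le: "\<And>m. (\<Sum>k<d. Suc m - \<mu> ! k) \<le> (\<Sum>k<d. Suc m - \<nu> ! k)"
  shows "partition_le d \<nu> \<mu>"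
  unfolding partition_le_def
proof
  fix i assume i: "i \<in> {1..d}"
  have len: "length \<nu> = d" "length \<mu> = d" and srt: "sorted \<nu>"
    and ge1: "\<And>k. k < d \<Longrightarrow> 1 \<le> \<nu> ! k" and tot: "sum_list \<nu> = n" "sum_list \<mu> = n"
    using part part' by (auto simp: partition_of_def partition_d_def)
  show "sum_list (take i \<nu>) \<le> sum_list (take i \<mu>)"
  proof (cases "i = d")
    case False
    then have id: "i < d" using i by simp
    have mono: "\<nu> ! a \<le> \<nu> ! b" if "a \<le> b" "b < d" for a b
      using srt that len by (simp add: sorted_iff_nth_mono)
    obtain m where m: "\<nu> ! i = Suc m" using ge1[OF id] by (cases "\<nu> ! i") auto
    have "(\<Sum>k<i. Suc m - \<mu> ! k) \<le> (\<Sum>k<d. Suc m - \<mu> ! k)"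
      using id by (intro sum_mono2) auto
    also have "\<dots> \<le> (\<Sum>k<d. Suc m - \<nu> ! k)" by (rule le)
    also have "\<dots> = (\<Sum>k<i. Suc m - \<nu> ! k)"
    proof (rule sum.mono_neutral_right)
      show "\<forall>k\<in>{..<d} - {..<i}. Suc m - \<nu> ! k = 0"
        using mono[of i] m by auto
    qed (use id in auto)
    finally have 1: "(\<Sum>k<i. Suc m - \<mu> ! k) \<le> (\<Sum>k<i. Suc m - \<nu> ! k)" .
    have "(\<Sum>k<i. Suc m - \<nu> ! k) + (\<Sum>k<i. \<nu> ! k) = (\<Sum>k<i. Suc m)"
      unfolding sum.distrib[symmetric]
    proof (rule sum.cong)
      fix k assume "k \<in> {..<i}"
      then have "\<nu> ! k \<le> Suc m" using mono[of k i] m id by simp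
      then show "Suc m - \<nu> ! k + \<nu> ! k = Suc m" by simp
    qed simp
    moreover have "(\<Sum>k<i. Suc m) \<le> (\<Sum>k<i. Suc m - \<mu> ! k) + (\<Sum>k<i. \<mu> ! k)"
      unfolding sum.distrib[symmetric] by (intro sum_mono) simp
    ultimately have "(\<Sum>k<i. \<nu> ! k) \<le> (\<Sum>k<i. \<mu> ! k)" using 1 by linarith
    then show ?thesis using id len by (simp add: sum_list_take)
  qed (use tot len in simp)
qed

section \<open>Closures and strata\<close>

lemma zariski_closure_of:
  fixes S :: "(nat \<Rightarrow> 'a::field poly poly) set"
  assumes "S \<subseteq> tuples n d"
  shows "zariski n d closure_of S =
    {a \<in> tuples n d. \<forall>f\<in>poly_funs n d. (\<forall>s\<in>S. f s = 0) \<longrightarrow> f a = 0}" (is "_ = ?R")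
proof
  let ?F = "{f \<in> poly_funs n d. \<forall>s\<in>S. f s = 0}"
  have eq: "zero_locus n d ?F = ?R"
    unfolding zero_locus_def Ball_def mem_Collect_eq
    by (intro Collect_cong conj_cong refl all_cong1) (rule imp_conjL)
  have "closedin (zariski n d) (zero_locus n d ?F)"
    unfolding closedin_zariski by (intro exI[of _ ?F] conjI refl) simp
  moreover have "S \<subseteq> zero_locus n d ?F" 
    unfolding eq using assms by (intro subsetI CollectI conjI ballI impI) auto
  ultimately show "zariski n d closure_of S \<subseteq> ?R"
    unfolding eq by (rule closure_of_minimal[rotated])
next
  obtain F where F: "F \<subseteq> poly_funs n d" "zariski n d closure_of S = zero_locus n d F"
    using closedin_closure_of[of "zariski n d" S] unfolding closedin_zariski by blast
  have "S \<subseteq> zariski n d closure_of S"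
    using assms by (intro closure_of_subset) (simp add: topspace_zariski)
  then have "\<forall>s\<in>S. f s = 0" if "f \<in> F" for f
    using that unfolding F(2) zero_locus_def by blast
  then show "?R \<subseteq> zariski n d closure_of S"
    unfolding F(2) zero_locus_def using F(1) by blast
qed

lemma partition_of_nth:
  assumes "partition_of n d \<mu>"
  shows "(\<Sum>i<d. \<mu> ! i) = n" "\<And>i. i < d \<Longrightarrow> 1 \<le> \<mu> ! i"
  using assms by (auto simp: partition_of_def partition_d_def sum_list_sum_nth atLeast0LessThan)

lemma syz_family_cong:
  "(\<And>k. k < d \<Longrightarrow> \<mu> k = \<nu> k) \<Longrightarrow> syz_family d A \<mu> p \<longleftrightarrow> syz_family d A \<nu> p"
  by (simp add: syz_family_def)

lemma P_mu_iff_family: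
  assumes "partition_of n d \<mu>"
  shows "a \<in> P_mu n d \<mu> \<longleftrightarrow> a \<in> P_set n d \<and> (\<exists>p. syz_family d (dehom a) (\<lambda>i. \<mu> ! i) p)"
proof -
  have "has_mu_type n d a \<mu> \<longleftrightarrow> (\<exists>p. syz_family d (dehom a) (\<lambda>i. \<mu> ! i) p)" if "a \<in> P_set n d"
  proof -
    have "a \<in> tuples n d" "unimodular n d (dehom a)"
      using that unimodular_if_rel_prime by (auto simp: P_set_def)
    then show ?thesis
      using has_mu_type_imp_family family_imp_has_mu_type assms by metis
  qed
  then show ?thesis by (auto simp: P_mu_def)
qed

lemma exists_type:
  assumes "a \<in> P_set n d"
  obtains \<nu> where "partition_of n d \<nu>" "a \<in> P_mu n d \<nu>"
proof -
  have a: "a \<in> tuples n d" "lin_indep d a" and un: "unimodular n d (dehom a)"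
    using assms unimodular_if_rel_prime by (auto simp: P_set_def)
  obtain \<mu> p where p: "syz_family d (dehom a) \<mu> p" "(\<Sum>i<d. \<mu> i) = n"
    by (rule exists_minimal_family[OF un])
  obtain \<nu> q where q: "syz_family d (dehom a) (\<lambda>i. \<nu> ! i) q" "sorted \<nu>" "length \<nu> = d"
    "set \<nu> = \<mu> ` {..<d}" "sum_list \<nu> = (\<Sum>i<d. \<mu> i)"
    by (rule syz_family_sort[OF p(1)])
  have "partition_of n d \<nu>"
    using q p family_pos[OF a p(1)] by (auto simp: partition_of_def partition_d_def)
  then show thesis using that q(1) assms by (auto simp: P_mu_iff_family)
qed

text \<open>Induction on the total deficit of the partial sums of \<open>\<mu>'\<close> against
  those of \<open>\<mu>\<close>. Vanishing is passed down from the next larger type by one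
  degeneration.\<close>

lemma vanishing_degenerates:
  fixes f :: "(nat \<Rightarrow> 'a::field poly poly) \<Rightarrow> 'a"
  assumes inf: "infinite (UNIV :: 'a set)" and f: "f \<in> poly_funs n d"
    and part: "partition_of n d \<mu>" and f0: "\<And>a. a \<in> P_mu n d \<mu> \<Longrightarrow> f a = 0"
    and part': "partition_of n d \<mu>'" "partition_le d \<mu>' \<mu>" and a: "a \<in> P_mu n d \<mu>'"
  shows "f a = 0"
  using part' a
proof (induction "\<Sum>k\<le>d. sum_list (take k \<mu>) - sum_list (take k \<mu>')" arbitrary: \<mu>' a rule: less_induct)
  case less
  show ?case
  proof (cases "\<mu>' = \<mu>")
    case False
    then obtain i j where ij: "i < j" "j < d" "\<mu>' ! i + 2 \<le> \<mu>' ! j"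
      and \<nu>: "partition_of n d (\<mu>'[i := \<mu>' ! i + 1, j := \<mu>' ! j - 1])"
        "partition_le d (\<mu>'[i := \<mu>' ! i + 1, j := \<mu>' ! j - 1]) \<mu>"
      using dominance_step[OF less.prems(1) part less.prems(2)] by blast
    let ?\<nu> = "\<mu>'[i := \<mu>' ! i + 1, j := \<mu>' ! j - 1]"
    have len: "length \<mu>' = d" using less.prems(1) by (simp add: partition_of_def partition_d_def)
    have take: "sum_list (take k ?\<nu>) = sum_list (take k \<mu>') + (if i < k \<and> k \<le> j then 1 else 0)" if "k \<le> d" for k
      using ij len that by (intro sum_list_take_update2) auto
    have "(\<Sum>k\<le>d. sum_list (take k \<mu>) - sum_list (take k ?\<nu>)) < (\<Sum>k\<le>d. sum_list (take k \<mu>) - sum_list (take k \<mu>'))"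
    proof (rule sum_strict_mono_ex1)
      show "\<forall>k\<in>{..d}. sum_list (take k \<mu>) - sum_list (take k ?\<nu>) \<le> sum_list (take k \<mu>) - sum_list (take k \<mu>')"
        using take by auto
      \<comment> \<open>The partial sum of length \<open>j\<close> grows by one and stays bounded by
        that of \<open>\<mu>\<close>, so its truncated deficit really drops.\<close>
      have "sum_list (take j ?\<nu>) \<le> sum_list (take j \<mu>)"
        using bspec[OF \<nu>(2)[unfolded partition_le_def], of j] ij by simp
      then show "\<exists>k\<in>{..d}. sum_list (take k \<mu>) - sum_list (take k ?\<nu>) < sum_list (take k \<mu>) - sum_list (take k \<mu>')"
        using take[of j] ij by (intro bexI[of _ j]) auto
    qed simp
    note IH = less.hyps[OF this \<nu>]
    obtain p where p: "a \<in> P_set n d" "syz_family d (dehom a) (\<lambda>k. \<mu>' ! k) p"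
      using less.prems by (auto simp: P_mu_iff_family)
    show ?thesis
    proof (rule degeneration_step[OF inf p partition_of_nth(1)[OF less.prems(1)] _ ij(2,3) f])
      fix a' :: "nat \<Rightarrow> 'a poly poly" and p' assume a': "a' \<in> P_set n d"
        and p': "syz_family d (dehom a') ((\<lambda>k. \<mu>' ! k)(i := \<mu>' ! i + 1, j := \<mu>' ! j - 1)) p'"
      have "syz_family d (dehom a') (\<lambda>k. ?\<nu> ! k) p'"
        using p' ij len by (subst syz_family_cong) (auto simp: nth_list_update)
      then show "f a' = 0" using IH a' \<nu>(1) by (auto simp: P_mu_iff_family)
    qed (use ij in simp)
  qed (use less.prems f0 in blast)
qed

theorem theorem3p7:
  fixes n d :: nat and \<mu> :: "nat list"
  assumes "infinite (UNIV :: 'a::field set)"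
    and "2 \<le> d" and "d \<le> n"
    and "partition_of n d \<mu>"
  shows "subtopology (zariski n d) (P_set n d) closure_of (P_mu n d \<mu>) =
    (\<Union>\<mu>'\<in>{\<mu>'. partition_of n d \<mu>' \<and> partition_le d \<mu>' \<mu>}.
       (P_mu n d \<mu>' :: (nat \<Rightarrow> 'a poly poly) set))"
proof -
  let ?Z = "\<lambda>a :: nat \<Rightarrow> 'a poly poly. \<forall>f\<in>poly_funs n d. (\<forall>s\<in>P_mu n d \<mu>. f s = 0) \<longrightarrow> f a = 0"
  have sub: "(P_mu n d \<mu> :: (nat \<Rightarrow> 'a poly poly) set) \<subseteq> P_set n d"
    "(P_set n d :: (nat \<Rightarrow> 'a poly poly) set) \<subseteq> tuples n d"
    by (auto simp: P_mu_def P_set_def)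
  have "subtopology (zariski n d) (P_set n d) closure_of (P_mu n d \<mu>) =
      P_set n d \<inter> (zariski n d closure_of (P_mu n d \<mu> :: (nat \<Rightarrow> 'a poly poly) set))"
    using sub(1) by (simp add: closure_of_subtopology Int_absorb1)
  also have "\<dots> = {a \<in> P_set n d. ?Z a}"
    using sub by (subst zariski_closure_of) auto
  also have "\<dots> = (\<Union>\<mu>'\<in>{\<mu>'. partition_of n d \<mu>' \<and> partition_le d \<mu>' \<mu>}. P_mu n d \<mu>')"
  proof (intro equalityI subsetI)
    fix a :: "nat \<Rightarrow> 'a poly poly" assume "a \<in> {a \<in> P_set n d. ?Z a}"
    then have a: "a \<in> P_set n d" and Z: "?Z a" by auto
    have at: "a \<in> tuples n d" and un: "unimodular n d (dehom a)"
      using a unimodular_if_rel_prime by (auto simp: P_set_def)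
    obtain \<nu> where \<nu>: "partition_of n d \<nu>" "a \<in> P_mu n d \<nu>" by (rule exists_type[OF a])
    then obtain q where q: "syz_family d (dehom a) (\<lambda>i. \<nu> ! i) q" by (auto simp: P_mu_iff_family)
    \<comment> \<open>If this failed for some \<open>m\<close>, every tuple of type
      \<open>\<mu>\<close> would have more syzygies of degree \<open>m\<close> than
      \<open>a\<close>, and the function given by semicontinuity would separate \<open>a\<close>
      from them.\<close>
    have "(\<Sum>k<d. Suc m - \<mu> ! k) \<le> (\<Sum>k<d. Suc m - \<nu> ! k)" for m
    proof (rule ccontr)
      assume neg: "\<not> (\<Sum>k<d. Suc m - \<mu> ! k) \<le> (\<Sum>k<d. Suc m - \<nu> ! k)"
      obtain F where F: "F \<in> poly_funs n d" "F a \<noteq> 0"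
        "\<And>a' \<mu> p. a' \<in> tuples n d \<Longrightarrow> syz_family d (dehom a') \<mu> p \<Longrightarrow>
           (\<Sum>k<d. Suc m - \<nu> ! k) < (\<Sum>k<d. Suc m - \<mu> k) \<Longrightarrow> F a' = 0"
        by (rule syzygy_semicontinuity[OF at un q partition_of_nth(1)[OF \<nu>(1)], of m]) blast
      have "F s = 0" if "s \<in> P_mu n d \<mu>" for s
      proof -
        obtain p where "s \<in> P_set n d" "syz_family d (dehom s) (\<lambda>i. \<mu> ! i) p"
          using \<open>s \<in> P_mu n d \<mu>\<close> assms(4) by (auto simp: P_mu_iff_family)
        then show ?thesis using F(3) sub(2) neg by (metis linorder_not_le subsetD)
      qed
      then show False using Z F(1,2) by blast
    qed
    then have "partition_le d \<nu> \<mu>" by (rule partition_le_if_truncated_sums[OF \<nu>(1) assms(4)])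
    then show "a \<in> (\<Union>\<mu>'\<in>{\<mu>'. partition_of n d \<mu>' \<and> partition_le d \<mu>' \<mu>}. P_mu n d \<mu>')"
      using \<nu> by blast
  next
    fix a :: "nat \<Rightarrow> 'a poly poly"
    assume "a \<in> (\<Union>\<mu>'\<in>{\<mu>'. partition_of n d \<mu>' \<and> partition_le d \<mu>' \<mu>}. P_mu n d \<mu>')"
    then obtain \<mu>' where \<mu>': "partition_of n d \<mu>'" "partition_le d \<mu>' \<mu>" "a \<in> P_mu n d \<mu>'" by blast
    have "f a = 0" if "f \<in> poly_funs n d" "\<forall>s\<in>P_mu n d \<mu>. f s = 0" for f
      using that(2) by (intro vanishing_degenerates[OF assms(1) that(1) assms(4) _ \<mu>']) blast
    then show "a \<in> {a \<in> P_set n d. ?Z a}" using \<mu>'(3) by (auto simp: P_mu_def)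
  qed
  finally show ?thesis .
qed

end
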